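(* Let $d \ge 1$ be a constant. Consider the store-and-forward packet routing problem on a $d$-dimensional uni-directional grid with $n$ nodes, uniform link capacity $c$ and uniform buffer size $B$, where $B, c \in [3, \log_2 n]$ are integers. Let $\mathrm{diam}(G)$ be the diameter of the grid, $p_{\max} = 2\cdot \mathrm{diam}(G)\cdot\left(1+n\left(\frac{B}{c}+d\right)\right)$ and $k = \lceil \log_2(1+3p_{\max})\rceil$. There exists an online deterministic centralized packet-routing algorithm (which may reject and preempt packets) whose competitive ratio is $O\left(k^{d+3}(B+d\cdot c)\right) = O(\log^{d+4} n)$.
   Context: Store-and-forward packet routing model. The network is a directed graph $G=(V,E)$ with $n=|V|$ nodes. Every edge has capacity $c$: at most $c$ packets can traverse it in one time step, and traversing an edge takes one time step. Every node has a buffer that can store at most $B$ packets. Time is discrete and the network is synchronous. Each packet request is a 4-tuple $r_i=(a_i,b_i,t_i,d_i)$: source $a_i$, destination $b_i$, time $t_i$ at which the packet is input to $a_i$ via the node's local input (any number of packets may be input to a node in one time step), and deadline $d_i$ (possibly $\infty$). In each time step, each node considers the packets input locally, those arriving along incoming edges, and those in its buffer; packets destined to this node are delivered and removed; of the others, the node forwards at most $c$ along each outgoing edge, stores at most $B$, and deletes the rest. Deleting a locally input packet is rejection; deleting an injected packet before it reaches its destination is preemption. Throughput = number of packets delivered by their deadline. An online algorithm learns nothing about $r_i$ before time $t_i$; a centralized algorithm may use all information revealed so far. A deterministic online algorithm ALG is $\rho$-competitive if for every input sequence $\sigma$, $|\mathrm{ALG}(\sigma)| \ge \frac1\rho |\mathrm{OPT}(\sigma)|$,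 where $|\mathrm{OPT}(\sigma)|$ is the maximum achievable throughput. A $d$-dimensional uni-directional grid has vertex set $[\ell_1]\times\cdots\times[\ell_d]$ (so $n=\prod_j \ell_j$) and a directed edge from $x$ to $x+e_j$ for each coordinate $j$ whenever both are vertices ($e_j$ the $j$-th unit vector); requests satisfy $a_i\le b_i$ coordinatewise. The diameter is the maximum length of a shortest directed path over pairs of vertices connected by a directed path. *)

theory Defs
  imports Complex_Main "HOL-Library.Extended_Nat"
begin

record 'v request =
  src :: 'v
  dst :: 'v
  rtime :: nat
  deadline :: enat

text \<open>A schedule assigns to packet index i and time t the node at which packet i
  is considered in time step t (None if the packet is not in the network at that time).
  Moving from S i t = Some v to S i (t+1) = Some w with w different from v means the packet
  traversed edge (v,w) in step t; S i (t+1) = Some v means it was stored in the buffer of v.\<close>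
type_synonym 'v schedule = "nat \<Rightarrow> nat \<Rightarrow> 'v option"

definition feasible_schedule ::
  "('v \<times> 'v) set \<Rightarrow> nat \<Rightarrow> nat \<Rightarrow> 'v request list \<Rightarrow> 'v schedule \<Rightarrow> bool" where
  "feasible_schedule E c B \<sigma> S \<longleftrightarrow>
     (\<forall>i<length \<sigma>. \<forall>t. t < rtime (\<sigma>!i) \<longrightarrow> S i t = None) \<and>
     (\<forall>i<length \<sigma>. S i (rtime (\<sigma>!i)) = Some (src (\<sigma>!i))) \<and>
     (\<forall>i<length \<sigma>. \<forall>t w. rtime (\<sigma>!i) \<le> t \<longrightarrow> S i (Suc t) = Some w \<longrightarrow>
        (\<exists>v. S i t = Some v \<and> v \<noteq> dst (\<sigma>!i) \<and> (w = v \<or> (v, w) \<in> E))) \<and>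
     (\<forall>t v w. v \<noteq> w \<longrightarrow>
        card {i. i < length \<sigma> \<and> S i t = Some v \<and> S i (Suc t) = Some w} \<le> c) \<and>
     (\<forall>t v. card {i. i < length \<sigma> \<and> S i t = Some v \<and> S i (Suc t) = Some v} \<le> B)"

definition delivered :: "'v request list \<Rightarrow> 'v schedule \<Rightarrow> nat \<Rightarrow> bool" where
  "delivered \<sigma> S i \<longleftrightarrow> (\<exists>t. S i t = Some (dst (\<sigma>!i)) \<and> enat t \<le> deadline (\<sigma>!i))"

definition throughput :: "'v request list \<Rightarrow> 'v schedule \<Rightarrow> nat" where
  "throughput \<sigma> S = card {i. i < length \<sigma> \<and> delivered \<sigma> S i}"

definition opt_throughput :: "('v \<times> 'v) set \<Rightarrow> nat \<Rightarrow> nat \<Rightarrow> 'v request list \<Rightarrow> nat" where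
  "opt_throughput E c B \<sigma> = Max {throughput \<sigma> S | S. feasible_schedule E c B \<sigma> S}"

definition input_seq :: "('v request \<Rightarrow> bool) \<Rightarrow> 'v request list \<Rightarrow> bool" where
  "input_seq valid \<sigma> \<longleftrightarrow> sorted (map rtime \<sigma>) \<and> (\<forall>r\<in>set \<sigma>. valid r)"

text \<open>A deterministic centralized online algorithm maps each input sequence to the schedule
  it produces. Online: the decisions made up to time step T (hence the positions of all packets
  up to time T+1) depend only on the requests revealed up to time T.\<close>
definition online :: "('v request list \<Rightarrow> 'v schedule) \<Rightarrow> bool" where
  "online A \<longleftrightarrow> (\<forall>\<sigma> \<sigma>' T. sorted (map rtime \<sigma>) \<longrightarrow> sorted (map rtime \<sigma>') \<longrightarrow>
      filter (\<lambda>r. rtime r \<le> T) \<sigma> = filter (\<lambda>r. rtime r \<le> T) \<sigma>' \<longrightarrow>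
      (\<forall>i t. i < length \<sigma> \<longrightarrow> rtime (\<sigma>!i) \<le> T \<longrightarrow> t \<le> Suc T \<longrightarrow> A \<sigma> i t = A \<sigma>' i t))"

definition competitive ::
  "('v \<times> 'v) set \<Rightarrow> nat \<Rightarrow> nat \<Rightarrow> ('v request \<Rightarrow> bool) \<Rightarrow> ('v request list \<Rightarrow> 'v schedule) \<Rightarrow> real \<Rightarrow> bool" where
  "competitive E c B valid A \<rho> \<longleftrightarrow>
     (\<forall>\<sigma>. input_seq valid \<sigma> \<longrightarrow>
        feasible_schedule E c B \<sigma> (A \<sigma>) \<and>
        real (opt_throughput E c B \<sigma>) \<le> \<rho> * real (throughput \<sigma> (A \<sigma>)))"

definition grid_vertices :: "nat list \<Rightarrow> nat list set" where
  "grid_vertices l = {x. length x = length l \<and> (\<forall>j<length l. x!j < l!j)}"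

definition grid_edges :: "nat list \<Rightarrow> (nat list \<times> nat list) set" where
  "grid_edges l = {(x, x[j := Suc (x!j)]) | x j.
      x \<in> grid_vertices l \<and> j < length l \<and> Suc (x!j) < l!j}"

definition grid_request :: "nat list \<Rightarrow> nat list request \<Rightarrow> bool" where
  "grid_request l r \<longleftrightarrow> src r \<in> grid_vertices l \<and> dst r \<in> grid_vertices l \<and>
     list_all2 (\<le>) (src r) (dst r)"

definition diameter :: "'v set \<Rightarrow> ('v \<times> 'v) set \<Rightarrow> nat" where
  "diameter V E = Max {(LEAST k. (x, y) \<in> E ^^ k) | x y. x \<in> V \<and> y \<in> V \<and> (x, y) \<in> E\<^sup>*}"

end

theory Submission
  imports Defs "HOL-Library.FuncSet"
begin

text \<open>
  Space-time is sheared into a directed grid of dimension \<open>D = d + 1\<close> and cut into cubic tiles whose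
  side is of order \<open>log n\<close>. Whenever a request has an admissible route that crosses at least three tile
  boundaries in at least two directions, its chain of tiles is subjected to exponential-weight
  admission control: it is accepted if the tiles of some chain have total weight below one, and
  acceptance roughly doubles the weights along the chain. Hence few accepted chains share a
  tile, and the total weight, which pays for the rejected packets, is proportional to the number of
  accepted ones. In addition the tiles around the two end points are reserved for one accepted
  packet each. An accepted packet need not know its exact route in advance: simple local rules
  guide it through its chain of tiles and it is never dropped.

  A packet that an optimal schedule delivers along a route that is thin in all directions except
  one runs straight along that direction, on edges reserved for such packets; of several packets
  competing for an edge the one with the earliest arrival survives. This is the greedy rule of
  interval scheduling, and the packets lost can be charged to nearby deliveries.

  A tile has \<open>O(log\<^sup>D n)\<close> points, each used by at most \<open>2 (B + d c)\<close> packets of an optimal schedule,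
  which bounds the loss.
\<close>

section \<open>Sheared grids and the transit system\<close>

text \<open>Shearing treats hopping and waiting alike: either raises one coordinate by one, so the
  level of a point is its time up to a constant. Packets that meet at a point meet there at one
  moment, and the arrival time depends on the end point alone, whatever turns are taken. This is why
  routes may be improvised without risk to the deadline.

  Two demands shape the construction. A tile must be longer than the number of chains through it,
  which is about the logarithm of the bound \<open>p\<close> on the length of a chain; but an
  offline packet may sit in buffers for arbitrarily long, so its own chain has no such bound. Long
  routes are therefore replaced by shortcuts that leave them at one of \<open>W\<close> times. For
  the average over these to be harmless, \<open>W\<close> has to dominate the number of shortcuts
  that meet a tile, which is of order \<open>(D * m + \<Lambda>) * n * (B + d * c)\<close>. So
  \<open>p\<close> is polynomial in \<open>n\<close>, and a side of order \<open>log n\<close>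
  suffices.

  Capacity 3 is one unit each for local, transit and straight traffic.\<close>

definition inc :: "nat \<Rightarrow> (nat \<Rightarrow> nat) \<Rightarrow> nat \<Rightarrow> nat" where
  "inc j z = z(j := Suc (z j))"

definition level :: "nat \<Rightarrow> (nat \<Rightarrow> nat) \<Rightarrow> nat" where
  "level D z = (\<Sum>l<D. z l)"

definition tile :: "nat \<Rightarrow> (nat \<Rightarrow> nat) \<Rightarrow> nat \<Rightarrow> nat" where
  "tile m z = (\<lambda>l. z l div m)"

definition pts :: "nat \<Rightarrow> (nat \<Rightarrow> nat) set" where
  "pts D = {z. \<forall>l\<ge>D. z l = 0}"

definition towards :: "nat \<Rightarrow> (nat \<Rightarrow> nat) \<Rightarrow> (nat \<Rightarrow> nat) \<Rightarrow> nat" where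
  "towards D c z = (LEAST l. l < D \<and> z l < c l)"

section \<open>Arithmetic of points, levels and tiles\<close>

lemma inc_same [simp]: "inc j z j = Suc (z j)"
  and inc_other [simp]: "l \<noteq> j \<Longrightarrow> inc j z l = z l"
  by (auto simp: inc_def)

lemma inc_apply: "inc j z l = (if l = j then Suc (z l) else z l)"
  by (simp add: inc_def)

lemma inc_ge: "z l \<le> inc j z l"
  by (simp add: inc_apply)

lemma inc_inj: "inc j z = inc j z' \<Longrightarrow> z = z'"
  by (metis ext inc_apply nat.inject)

lemma inc_inj_dir: "inc j z = inc j' z \<Longrightarrow> j = j'"
  by (metis inc_other inc_same n_not_Suc_n)

lemma level_inc: "j < D \<Longrightarrow> level D (inc j z) = Suc (level D z)"
proof -
  assume "j < D"
  then have "level D (inc j z) = (\<Sum>l<D. z l + (if l = j then 1 else 0))"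
    unfolding level_def by (intro sum.cong) (auto simp: inc_apply)
  also have "\<dots> = Suc (level D z)"
    using \<open>j < D\<close> by (simp add: sum.distrib level_def)
  finally show ?thesis .
qed

lemma level_mono: "(\<And>l. l < D \<Longrightarrow> z l \<le> z' l) \<Longrightarrow> level D z \<le> level D z'"
  unfolding level_def by (intro sum_mono) auto

lemma level_less: "(\<And>l. l < D \<Longrightarrow> z l \<le> z' l) \<Longrightarrow> l < D \<Longrightarrow> z l < z' l \<Longrightarrow> level D z < level D z'"
  unfolding level_def by (intro sum_strict_mono_ex1) auto

lemma pts_eqI: "z \<in> pts D \<Longrightarrow> z' \<in> pts D \<Longrightarrow> (\<And>l. l < D \<Longrightarrow> z l = z' l) \<Longrightarrow> z = z'"
proof (rule ext)
  fix l
  assume "z \<in> pts D" "z' \<in> pts D" "\<And>l. l < D \<Longrightarrow> z l = z' l"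
  then show "z l = z' l" by (cases "l < D") (auto simp: pts_def)
qed

lemma pts_level_eq:
  assumes "z \<in> pts D" "z' \<in> pts D" "\<And>l. z l \<le> z' l" "level D z = level D z'"
  shows "z = z'"
proof (rule pts_eqI[OF assms(1,2)])
  fix l assume "l < D"
  then show "z l = z' l"
    using level_less[of D z z' l] assms(3,4) by (metis le_neq_implies_less less_irrefl)
qed

lemma pts_inc: "z \<in> pts D \<Longrightarrow> j < D \<Longrightarrow> inc j z \<in> pts D"
  by (auto simp: pts_def inc_apply)

lemma tile_pts: "z \<in> pts D \<Longrightarrow> tile m z \<in> pts D"
  by (auto simp: pts_def tile_def)

lemma tile_inc_in: "Suc (z j) mod m \<noteq> 0 \<Longrightarrow> tile m (inc j z) = tile m z"
  by (rule ext) (auto simp: tile_def inc_apply div_Suc)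

lemma tile_inc_out: "Suc (z j) mod m = 0 \<Longrightarrow> tile m (inc j z) = inc j (tile m z)"
  by (rule ext) (auto simp: tile_def inc_apply div_Suc)

lemma towards:
  assumes "\<exists>l<D. z l < c l"
  shows "towards D c z < D" "z (towards D c z) < c (towards D c z)"
  using LeastI_ex[of "\<lambda>l. l < D \<and> z l < c l"] assms by (auto simp: towards_def)

lemma inc_towards_le:
  assumes "\<exists>l<D. z l < c l" "\<And>l. z l \<le> c l"
  shows "inc (towards D c z) z l \<le> c l"
  using towards[OF assms(1)] assms(2)[of l] by (auto simp: inc_apply)

text \<open>One boundary makes room for an entry tile above the source tile, one for an exit tile
  below the destination tile, and the third keeps these two tiles apart.\<close>

definition thick :: "nat \<Rightarrow> nat \<Rightarrow> (nat \<Rightarrow> nat) \<Rightarrow> (nat \<Rightarrow> nat) \<Rightarrow> nat set" where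
  "thick D m a b = {l. l < D \<and> a l div m + 3 \<le> b l div m}"

text \<open>Thin directions are completed before the transit track is joined, so that transit moves
  in thick directions only. In those the entry is the lower corner of its tile, which leaves the
  side of the tile for delays.\<close>

definition entry :: "nat \<Rightarrow> nat \<Rightarrow> (nat \<Rightarrow> nat) \<Rightarrow> (nat \<Rightarrow> nat) \<Rightarrow> nat \<Rightarrow> nat" where
  "entry D m a b = (\<lambda>l. if l \<in> thick D m a b then m * (a l div m + 1) else b l)"

text \<open>Stopping one tile early keeps every point of this tile below the destination in the
  thick directions, so a packet that strays within a tile of its chain cannot overshoot.\<close>

definition exit_tile :: "nat \<Rightarrow> nat \<Rightarrow> (nat \<Rightarrow> nat) \<Rightarrow> (nat \<Rightarrow> nat) \<Rightarrow> nat \<Rightarrow> nat" where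
  "exit_tile D m a b = (\<lambda>l. if l \<in> thick D m a b then b l div m - 1 else b l div m)"

text \<open>Three tiles wide, because a thin direction may still gain two tiles on the way to
  \<open>entry\<close>.\<close>

definition src_box :: "nat \<Rightarrow> nat \<Rightarrow> (nat \<Rightarrow> nat) \<Rightarrow> (nat \<Rightarrow> nat) set" where
  "src_box D m a = {U \<in> pts D. \<forall>l<D. a l div m \<le> U l \<and> U l \<le> a l div m + 2}"

definition dst_box :: "nat \<Rightarrow> nat \<Rightarrow> (nat \<Rightarrow> nat) \<Rightarrow> (nat \<Rightarrow> nat) set" where
  "dst_box D m b = {U \<in> pts D. \<forall>l<D. b l div m \<le> U l + 1 \<and> U l \<le> b l div m}"

lemma finite_thick [simp]: "finite (thick D m a b)"
  by (simp add: thick_def)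

text \<open>Every edge has three tracks. On the local track a packet travels from its origin to the lower
  corner \<open>entry\<close> of a tile (\<open>Inbound\<close>) and, at the other end, from its last tile to its destination
  (\<open>Outbound\<close>). In between it follows a prescribed chain \<open>P i\<close> of tiles on the transit track: where it
  is alone it turns into the direction in which it has to leave the tile, otherwise all transit
  packets at that point go straight on. An inbound packet waits for a free transit edge by climbing
  along a line. The third track is left to the packets that do not use this mechanism.\<close>

datatype phase = Unborn | Inbound | Transit | Outbound | Done

text \<open>The dynamics come without assumptions, so that the runs on two inputs can be compared in
  \<open>transit_cong\<close>.\<close>

locale transit_dyn =
  fixes D m :: nat and I :: "nat set" and r :: "nat \<Rightarrow> nat"
    and a b :: "nat \<Rightarrow> nat \<Rightarrow> nat" and P :: "nat \<Rightarrow> (nat \<Rightarrow> nat) set" and \<Lambda> :: nat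
begin

abbreviation "T i \<equiv> thick D m (a i) (b i)"
abbreviation "ent i \<equiv> entry D m (a i) (b i)"
abbreviation "lst i \<equiv> exit_tile D m (a i) (b i)"

text \<open>Minimum and maximum serve to name two distinct thick directions.\<close>

definition "join_dir i = Min (T i)"
definition "climb_dir i = Max (T i)"
definition "want i U = (SOME j. j \<in> T i \<and> inc j U \<in> P i)"

definition occ :: "(nat \<Rightarrow> phase \<times> nat \<times> (nat \<Rightarrow> nat)) \<Rightarrow> (nat \<Rightarrow> nat) \<Rightarrow> nat set" where
  "occ s z = {i \<in> I. \<exists>h. s i = (Transit, h, z)}"

definition trdir :: "(nat \<Rightarrow> phase \<times> nat \<times> (nat \<Rightarrow> nat)) \<Rightarrow> nat \<Rightarrow> nat" where
  "trdir s i = (case s i of (_, h, z) \<Rightarrow> if occ s z = {i} then want i (tile m z) else h)"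

text \<open>The middle component of a transit state is the direction of the last move. An inbound
  packet gives way: it joins only if no transit packet at its point is about to take the edge in
  \<open>join_dir\<close>.\<close>

definition step :: "nat \<Rightarrow> (nat \<Rightarrow> phase \<times> nat \<times> (nat \<Rightarrow> nat)) \<Rightarrow> nat \<Rightarrow> phase \<times> nat \<times> (nat \<Rightarrow> nat)" where
  "step t s i = (case s i of (ph, h, z) \<Rightarrow>
    (case ph of
       Unborn \<Rightarrow> if r i = Suc t then (Inbound, 0, a i) else s i
     | Inbound \<Rightarrow>
         if \<exists>l<D. z l < ent i l then (Inbound, 0, inc (towards D (ent i) z) z)
         else if \<exists>q\<in>occ s z. trdir s q = join_dir i then (Inbound, 0, inc (climb_dir i) z)
         else (Transit, join_dir i, inc (join_dir i) z)
     | Transit \<Rightarrow>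
         (if tile m (inc (trdir s i) z) = lst i then Outbound else Transit, trdir s i, inc (trdir s i) z)
     | Outbound \<Rightarrow> if z = b i then (Done, 0, z) else (Outbound, 0, inc (towards D (b i) z) z)
     | Done \<Rightarrow> s i))"

primrec state :: "nat \<Rightarrow> nat \<Rightarrow> phase \<times> nat \<times> (nat \<Rightarrow> nat)" where
  "state 0 = (\<lambda>i. if r i = 0 then (Inbound, 0, a i) else (Unborn, 0, a i))"
| "state (Suc t) = step t (state t)"

definition pos :: "nat \<Rightarrow> nat \<Rightarrow> nat \<Rightarrow> nat" where
  "pos t i = snd (snd (state t i))"

definition arrival :: "nat \<Rightarrow> nat" where
  "arrival i = level D (b i) - \<Lambda>"

lemma unborn: "t < r i \<Longrightarrow> state t i = (Unborn, 0, a i)"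
  by (induction t) (auto simp: step_def)

end

text \<open>This makes the mechanism online: a packet released after \<open>N\<close> is unborn up
  to time \<open>N\<close>, hence absent from every \<open>occ\<close>, and influences no decision
  about the others before time \<open>Suc N\<close>.\<close>

lemma transit_cong:
  assumes eq: "\<And>i. i \<in> I \<and> r i \<le> N \<longleftrightarrow> i \<in> I' \<and> r' i \<le> N"
    and eq2: "\<And>i. i \<in> I \<Longrightarrow> r i \<le> N \<Longrightarrow> r i = r' i \<and> a i = a' i \<and> b i = b' i \<and> P i = P' i"
  shows "t \<le> Suc N \<Longrightarrow> i \<in> I \<Longrightarrow> r i \<le> N \<Longrightarrow>
    transit_dyn.state D m I r a b P t i = transit_dyn.state D m I' r' a' b' P' t i"
proof (induction t arbitrary: i)
  case 0
  then show ?case using eq2[of i] by (simp add: transit_dyn.state.simps)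
next
  case (Suc t)
  define s where "s = transit_dyn.state D m I r a b P t"
  define s' where "s' = transit_dyn.state D m I' r' a' b' P' t"
  have IH: "s i = s' i" if "i \<in> I" "r i \<le> N" for i
    using Suc.IH[of i] Suc.prems that by (simp add: s_def s'_def)
  have tN: "t \<le> N" using Suc.prems by simp
  have at1: "i \<in> I \<and> r i \<le> N" if "i \<in> I" "s i = (Transit, h, z)" for i h z
    using transit_dyn.unborn[of t r i D m I a b P] tN that by (cases "t < r i") (auto simp: s_def)
  have at2: "i \<in> I' \<and> r' i \<le> N" if "i \<in> I'" "s' i = (Transit, h, z)" for i h z
    using transit_dyn.unborn[of t r' i D m I' a' b' P'] tN that by (cases "t < r' i") (auto simp: s'_def)
  have at_eq: "transit_dyn.occ I s z = transit_dyn.occ I' s' z" for z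
    unfolding transit_dyn.occ_def using at1 at2 IH eq by (auto, metis+)
  have td: "transit_dyn.trdir D m I a b P s q = transit_dyn.trdir D m I' a' b' P' s' q"
    if "q \<in> I" "r q \<le> N" for q
    unfolding transit_dyn.trdir_def transit_dyn.want_def IH[OF that] at_eq
    using eq2[OF that] by (simp cong: if_cong)
  have ex: "(\<exists>q\<in>transit_dyn.occ I s z. transit_dyn.trdir D m I a b P s q = j) \<longleftrightarrow>
     (\<exists>q\<in>transit_dyn.occ I' s' z. transit_dyn.trdir D m I' a' b' P' s' q = j)" for z j
  proof -
    have "transit_dyn.trdir D m I a b P s q = transit_dyn.trdir D m I' a' b' P' s' q"
      if "q \<in> transit_dyn.occ I s z" for q
      using that at1 td by (auto simp: transit_dyn.occ_def)
    then show ?thesis using at_eq by auto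
  qed
  have "transit_dyn.step D m I r a b P t s i = transit_dyn.step D m I' r' a' b' P' t s' i"
    using IH[OF Suc.prems(2,3)] eq2[OF Suc.prems(2,3)] td[OF Suc.prems(2,3)]
    unfolding transit_dyn.step_def ex transit_dyn.join_dir_def transit_dyn.climb_dir_def
    by (simp cong: if_cong prod.case_cong phase.case_cong)
  then show ?case by (simp add: transit_dyn.state.simps s_def s'_def)
qed

text \<open>\<open>load\<close> makes the potential payers for delays run out before the tile does;
  \<open>disj\<close> keeps the local track to one packet per point. Both are supplied by admission
  control.\<close>

locale transit = transit_dyn +
  assumes finI: "finite I"
    and a_pts: "i \<in> I \<Longrightarrow> a i \<in> pts D" and b_pts: "i \<in> I \<Longrightarrow> b i \<in> pts D"
    and a_le_b: "i \<in> I \<Longrightarrow> a i l \<le> b i l"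
    and birth: "i \<in> I \<Longrightarrow> level D (a i) = r i + \<Lambda>"
    and card_T: "i \<in> I \<Longrightarrow> 2 \<le> card (T i)"
    and entry_P: "i \<in> I \<Longrightarrow> tile m (ent i) \<in> P i"
    and P_le: "i \<in> I \<Longrightarrow> U \<in> P i \<Longrightarrow> U l \<le> lst i l"
    and P_step: "i \<in> I \<Longrightarrow> U \<in> P i \<Longrightarrow> U \<noteq> lst i \<Longrightarrow> \<exists>j\<in>T i. inc j U \<in> P i"
    and load: "card {q \<in> I. U \<in> P q} + 2 \<le> m"
    and disj: "i \<in> I \<Longrightarrow> q \<in> I \<Longrightarrow> i \<noteq> q \<Longrightarrow>
      (src_box D m (a i) \<union> dst_box D m (b i)) \<inter> (src_box D m (a q) \<union> dst_box D m (b q)) = {}"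
begin

section \<open>Geometry of entry and exit\<close>

lemma m2: "m \<ge> 2"
  using load[of undefined] by simp

lemma T_D: "l \<in> T i \<Longrightarrow> l < D"
  by (simp add: thick_def)

lemma dirs:
  assumes "i \<in> I"
  shows "join_dir i \<in> T i" "climb_dir i \<in> T i" "join_dir i \<noteq> climb_dir i"
proof -
  have ne: "T i \<noteq> {}" using card_T[OF assms] by auto
  then show "join_dir i \<in> T i" "climb_dir i \<in> T i"
    by (auto simp: join_dir_def climb_dir_def)
  show "join_dir i \<noteq> climb_dir i"
  proof
    assume "join_dir i = climb_dir i"
    then have "T i \<subseteq> {join_dir i}"
      unfolding join_dir_def climb_dir_def
      by (metis Max_ge Min_le dual_order.antisym finite_thick singletonI subsetI)
    then show False using card_T[OF assms] card_mono[of "{join_dir i}" "T i"] by simp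
  qed
qed

lemma want:
  assumes "i \<in> I" "U \<in> P i" "U \<noteq> lst i"
  shows "want i U \<in> T i" "inc (want i U) U \<in> P i"
  using someI_ex[of "\<lambda>j. j \<in> T i \<and> inc j U \<in> P i"] P_step[OF assms]
  unfolding want_def by auto

lemma ent_tile: "tile m (ent i) l = (if l \<in> T i then a i l div m + 1 else b i l div m)"
  using m2 by (simp add: tile_def entry_def)

lemma a_le_ent: "i \<in> I \<Longrightarrow> a i l \<le> ent i l"
  using a_le_b[of i l] m2 dividend_less_times_div[of m "a i l"] by (auto simp: entry_def)

lemma ent_pts: "i \<in> I \<Longrightarrow> ent i \<in> pts D"
  using b_pts[of i] by (auto simp: pts_def entry_def thick_def)

lemma below_exit:
  assumes "i \<in> I" "l \<in> T i" "z l div m \<le> lst i l"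
  shows "z l \<le> b i l"
proof -
  have "z l div m < b i l div m"
    using assms by (auto simp: exit_tile_def thick_def split: if_splits)
  then show ?thesis using div_le_mono[of "b i l" "z l" m] by (meson leD nat_le_linear)
qed

text \<open>Each point at which a packet is held up is shared with another packet, which then leaves the
  line for good. So delays are paid for by distinct packets of the same tile, and as there are fewer
  of these than the tile is long, every packet turns, or joins the transit track, in time.\<close>

definition passed :: "(nat \<Rightarrow> phase \<times> nat \<times> (nat \<Rightarrow> nat)) \<Rightarrow> nat \<Rightarrow> (nat \<Rightarrow> nat) \<Rightarrow> nat \<Rightarrow> bool" where
  "passed s h z q \<longleftrightarrow> (case s q of (ph, _, z') \<Rightarrow>
     ph = Outbound \<or> ph = Done \<or> ph = Transit \<and> (\<exists>l. l \<noteq> h \<and> z l < z' l))"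

text \<open>The payers in \<open>Q\<close> are distinct and have the current tile on their chains,
  so \<open>load\<close> limits their number.\<close>

definition credit :: "(nat \<Rightarrow> phase \<times> nat \<times> (nat \<Rightarrow> nat)) \<Rightarrow> nat \<Rightarrow> nat \<Rightarrow> (nat \<Rightarrow> nat) \<Rightarrow> nat \<Rightarrow> bool" where
  "credit s i h z n \<longleftrightarrow>
     (\<exists>Q\<subseteq>{q \<in> I. tile m z \<in> P q} - {i}. n \<le> card Q \<and> (\<forall>q\<in>Q. passed s h z q))"

text \<open>The \<open>- 1\<close> in the transit credit reflects that a joining packet steps off
  the lower corner at once: it stands at offset 1 with nothing paid yet. A packet whose last
  direction is the wanted one needs no credit.\<close>

definition good :: "nat \<Rightarrow> (nat \<Rightarrow> phase \<times> nat \<times> (nat \<Rightarrow> nat)) \<Rightarrow> nat \<Rightarrow> bool" where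
  "good t s i \<longleftrightarrow> (case s i of (ph, h, z) \<Rightarrow>
     (ph = Unborn \<longleftrightarrow> t < r i) \<and>
     (ph \<noteq> Unborn \<longrightarrow> z \<in> pts D \<and> (\<forall>l. a i l \<le> z l \<and> z l \<le> b i l)) \<and>
     (ph \<in> {Inbound, Transit, Outbound} \<longrightarrow> level D z = t + \<Lambda>) \<and>
     (ph = Inbound \<longrightarrow> (\<forall>l. z l \<le> ent i l) \<or>
        (\<forall>l. l \<noteq> climb_dir i \<longrightarrow> z l = ent i l) \<and> ent i (climb_dir i) \<le> z (climb_dir i) \<and>
        tile m z = tile m (ent i) \<and> credit s i (climb_dir i) z (z (climb_dir i) - ent i (climb_dir i))) \<and>
     (ph = Transit \<longrightarrow> (\<forall>l. l \<notin> T i \<longrightarrow> z l = b i l) \<and> tile m z \<in> P i \<and> tile m z \<noteq> lst i \<and> h \<in> T i \<and>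
        (h \<noteq> want i (tile m z) \<longrightarrow> credit s i h z (z h mod m - 1))) \<and>
     (ph = Outbound \<longrightarrow> tile m z \<in> dst_box D m (b i)) \<and>
     (ph = Done \<longrightarrow> level D (b i) < t + \<Lambda>))"

text \<open>Since the middle component is the direction of the last move, the second clause says
  that no transit edge was taken by two packets in the last step.\<close>

definition safe :: "nat \<Rightarrow> bool" where
  "safe t \<longleftrightarrow> (\<forall>i\<in>I. good t (state t) i) \<and>
     (\<forall>i\<in>I. \<forall>q\<in>I. \<forall>h z. state t i = (Transit, h, z) \<longrightarrow> state t q = (Transit, h, z) \<longrightarrow> i = q)"

section \<open>Payment for delays\<close>

lemma credit_0: "credit s i h z 0"
  unfolding credit_def by (intro exI[of _ "{}"]) auto

lemma credit_bound:
  assumes "i \<in> I" "tile m z \<in> P i" "Q \<subseteq> {q \<in> I. tile m z \<in> P q} - {i}"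
  shows "card Q + 3 \<le> m" "finite Q"
proof -
  show fin: "finite Q" using finite_subset[of Q I] assms(3) finI by auto
  have "card (insert i Q) \<le> card {q \<in> I. tile m z \<in> P q}"
    using assms finI by (intro card_mono) auto
  moreover have "i \<notin> Q" using assms by auto
  ultimately show "card Q + 3 \<le> m" using load[of "tile m z"] fin by simp
qed

text \<open>Leaving the line is irreversible: the coordinates of \<open>q\<close> never decrease,
  while those of the line other than \<open>h\<close> do not grow.\<close>

lemma passed_step:
  assumes "passed s h z q" "\<And>l. l \<noteq> h \<Longrightarrow> z' l \<le> z l"
  shows "passed (step t s) h z' q"
proof -
  obtain ph k y where s: "s q = (ph, k, y)" by (cases "s q") auto
  show ?thesis
  proof (cases ph)
    case Transit
    then obtain l where "l \<noteq> h" "z l < y l" using assms(1) s by (auto simp: passed_def)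
    then have "z' l < inc j y l" for j using assms(2)[of l] inc_ge[of y l j] by simp
    then show ?thesis using Transit s \<open>l \<noteq> h\<close> by (auto simp: passed_def step_def)
  qed (use assms s in \<open>auto simp: passed_def step_def\<close>)
qed

text \<open>Each delay finds a fresh payer: \<open>q\<close> still stands on the line, so it is not
  among those that have passed, and it leaves with this very move. The 4 consists of
  \<open>q\<close> and the 3 of \<open>credit_bound\<close>.\<close>

lemma credit_step:
  assumes "i \<in> I" "tile m z \<in> P i" "credit s i h z n" "z' = inc h z"
    and q: "q \<in> I" "q \<noteq> i" "tile m z \<in> P q" "s q = (Transit, k, z)" "trdir s q \<noteq> h"
  shows "n + 4 \<le> m" "tile m z' = tile m z \<Longrightarrow> credit (step t s) i h z' (Suc n)"
proof -
  obtain Q where Q: "Q \<subseteq> {q \<in> I. tile m z \<in> P q} - {i}" "n \<le> card Q" "\<forall>q\<in>Q. passed s h z q"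
    using assms(3) by (auto simp: credit_def)
  have nq: "q \<notin> Q" using Q(3) q(4) by (auto simp: passed_def)
  have sub: "insert q Q \<subseteq> {q \<in> I. tile m z \<in> P q} - {i}" using Q(1) q by auto
  have cardq: "card (insert q Q) = Suc (card Q)"
    using nq credit_bound(2)[OF assms(1,2) Q(1)] by simp
  then show "n + 4 \<le> m" using credit_bound(1)[OF assms(1,2) sub] Q(2) by simp
  have "passed (step t s) h z' x" if "x \<in> insert q Q" for x
  proof (cases "x = q")
    case True
    then show ?thesis using q(4,5) assms(4)
      by (auto simp: passed_def step_def intro!: exI[of _ "trdir s q"])
  next
    case False
    then show ?thesis using that Q(3) assms(4) by (intro passed_step[of s h z]) auto
  qed
  then show "credit (step t s) i h z' (Suc n)" if "tile m z' = tile m z"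
    unfolding credit_def that using sub cardq Q(2) by (intro exI[of _ "insert q Q"]) auto
qed

text \<open>Local traffic stays inside the reserved boxes, so their disjointness separates
  it.\<close>

lemma box_tile:
  assumes "i \<in> I" "good t s i" "s i = (ph, h, z)" "ph = Inbound \<or> ph = Outbound"
  shows "tile m z \<in> src_box D m (a i) \<union> dst_box D m (b i)"
proof (cases "ph = Outbound")
  case True
  then show ?thesis using assms by (auto simp: good_def)
next
  case False
  then have ph: "ph = Inbound" using assms by auto
  have z: "z \<in> pts D" "\<And>l. a i l \<le> z l" using assms ph by (auto simp: good_def)
  have "tile m z l \<le> tile m (ent i) l" for l
  proof -
    have "(\<forall>l. z l \<le> ent i l) \<or> tile m z = tile m (ent i)"
      using assms ph by (auto simp: good_def)
    then show ?thesis by (metis div_le_mono tile_def order_refl)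
  qed
  moreover have "tile m (ent i) l \<le> a i l div m + 2" if "l < D" for l
    using that unfolding ent_tile by (auto simp: thick_def)
  ultimately have "tile m z l \<le> a i l div m + 2" if "l < D" for l
    using that le_trans by blast
  moreover have "a i l div m \<le> tile m z l" for l using z(2) by (simp add: tile_def div_le_mono)
  ultimately show ?thesis using tile_pts[OF z(1)] by (simp add: src_box_def)
qed

section \<open>Preservation of the invariant\<close>

lemma occI: "i \<in> I \<Longrightarrow> s i = (Transit, h, z) \<Longrightarrow> i \<in> occ s z"
  by (auto simp: occ_def)

lemma good_Inbound:
  assumes "safe t" "i \<in> I" and st: "state t i = (Inbound, h, z)"
  shows "good (Suc t) (state (Suc t)) i"
proof -
  let ?s = "state t"
  have g: "good t ?s i" using assms by (simp add: safe_def)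
  have r: "\<not> Suc t < r i" and zp: "z \<in> pts D" and az: "\<And>l. a i l \<le> z l" and zb: "\<And>l. z l \<le> b i l"
    and lev: "level D z = t + \<Lambda>" using g st by (auto simp: good_def)
  have azi: "a i l \<le> inc j z l" for j l using az[of l] inc_ge[of z l j] by simp
  note d = dirs[OF assms(2)]
  have fD: "join_dir i < D" "climb_dir i < D" using d T_D by auto
  show ?thesis
  proof (cases "\<exists>l<D. z l < ent i l")
    case True
    let ?e = "towards D (ent i) z"
    have eD: "?e < D" using towards[OF True] by simp
    \<comment> \<open>A climbing packet is nowhere below \<open>ent\<close>, so the case assumption
      excludes climbing.\<close>
    have le: "z l \<le> ent i l" for l
    proof -
      have "(\<forall>l. z l \<le> ent i l) \<or> (\<forall>l. l \<noteq> climb_dir i \<longrightarrow> z l = ent i l) \<and> ent i (climb_dir i) \<le> z (climb_dir i)"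
        using g st by (auto simp: good_def)
      then show ?thesis using True by (metis leD le_less_linear order.refl)
    qed
    have le': "inc ?e z l \<le> ent i l" for l by (rule inc_towards_le[OF True le])
    have eb: "ent i l \<le> b i l" for l
    proof (cases "l \<in> T i")
      case True
      have "a i l div m + 1 \<le> b i l div m" using True by (auto simp: thick_def)
      then have "m * (a i l div m + 1) \<le> m * (b i l div m)" by (rule mult_le_mono2)
      also have "\<dots> \<le> b i l" by simp
      finally show ?thesis using True by (simp add: entry_def)
    qed (simp add: entry_def)
    have le_b: "inc ?e z l \<le> b i l" for l using le'[of l] eb[of l] by simp
    have "state (Suc t) i = (Inbound, 0, inc ?e z)" using st True by (simp add: step_def)
    then show ?thesis using r pts_inc[OF zp eD] level_inc[OF eD, of z] lev le' az azi
        le_b by (auto simp: good_def)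
  next
    case False
    let ?g = "climb_dir i" and ?f = "join_dir i"
    have zent: "z l = ent i l" if "l \<noteq> ?g" for l
    proof (cases "l < D")
      case True
      have "(\<forall>l. z l \<le> ent i l) \<or> (\<forall>l. l \<noteq> ?g \<longrightarrow> z l = ent i l)"
        using g st by (auto simp: good_def)
      moreover have "ent i l \<le> z l" using False True by (meson leI)
      ultimately show ?thesis using that by (metis dual_order.antisym)
    next
      case l: False
      then show ?thesis using zp ent_pts[OF assms(2)] by (auto simp: pts_def)
    qed
    have zg: "ent i ?g \<le> z ?g" using False fD by (meson leI)
    have cr: "tile m z = tile m (ent i) \<and> credit ?s i ?g z (z ?g - ent i ?g)"
    proof (cases "\<forall>l. z l \<le> ent i l")
      case True
      then have "z = ent i" using zent zg by (intro ext) (metis dual_order.antisym)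
      then show ?thesis by (simp add: credit_0)
    next
      case False
      then show ?thesis using g st by (auto simp: good_def)
    qed
    have tP: "tile m z \<in> P i" using cr entry_P[OF assms(2)] by simp
    show ?thesis
    proof (cases "\<exists>q\<in>occ ?s z. trdir ?s q = ?f")
      case True
      then obtain q k where q: "q \<in> I" "?s q = (Transit, k, z)" "trdir ?s q = ?f" by (auto simp: occ_def)
      have qi: "q \<noteq> i" using q st by auto
      have "good t ?s q" using q assms(1) by (simp add: safe_def)
      then have qP: "tile m z \<in> P q" using q(2) by (simp add: good_def)
      \<comment> \<open>\<open>q\<close> leaves along \<open>join_dir\<close>, which is not the
        climbing direction; hence it leaves the line of the climb and can pay.\<close>
      have td: "trdir ?s q \<noteq> ?g" using q d by auto
      note cs = credit_step[OF assms(2) tP conjunct2[OF cr] refl q(1) qi qP q(2) td]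
      \<comment> \<open>The climb starts at a multiple of \<open>m\<close>, so the offset within the
        tile is the distance climbed, which the credit keeps below \<open>m\<close>.\<close>
      define y where "y = z ?g - ent i ?g"
      have "ent i ?g = m * (a i ?g div m + 1)" using d by (simp add: entry_def)
      then have "Suc (z ?g) = m * (a i ?g div m + 1) + Suc y" using zg by (simp add: y_def)
      then have "Suc (z ?g) mod m = Suc y mod m" by (simp only: mod_mult_self4)
      moreover have "Suc y < m" using cs(1) by (simp add: y_def)
      ultimately have "Suc (z ?g) mod m \<noteq> 0" by simp
      then have tl: "tile m (inc ?g z) = tile m z" by (rule tile_inc_in)
      have "state (Suc t) i = (Inbound, 0, inc ?g z)" using st False True by (auto simp: step_def)
      moreover have "inc ?g z l \<le> b i l" for l
      proof (cases "l = ?g")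
        case True
        have "tile m (inc ?g z) l \<le> lst i l" using P_le[OF assms(2) tP] tl by simp
        then show ?thesis using below_exit[OF assms(2), of l "inc ?g z"] d True by (simp add: tile_def)
      qed (use zb in simp)
      moreover have "credit (state (Suc t)) i ?g (inc ?g z) (inc ?g z ?g - ent i ?g)"
        using cs(2)[OF tl, of t] zg by (simp add: Suc_diff_le)
      ultimately show ?thesis using r pts_inc[OF zp fD(2)] level_inc[OF fD(2), of z] lev zent zg cr tl
          azi by (auto simp: good_def)
    next
      case notq: False
      have zf: "z ?f = m * (a i ?f div m + 1)" using zent[of ?f] d by (simp add: entry_def)
      have m3: "m \<ge> 3" using credit_bound(1)[OF assms(2) tP, of "{}"] by simp
      have md: "Suc (z ?f) mod m = 1"
      proof -
        have "Suc (z ?f) = m * (a i ?f div m + 1) + 1" using zf by simp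
        then have "Suc (z ?f) mod m = 1 mod m" by (simp only: mod_mult_self4)
        then show ?thesis using m3 by simp
      qed
      then have tl: "tile m (inc ?f z) = tile m z" by (intro tile_inc_in) simp
      have st': "state (Suc t) i = (if tile m (inc ?f z) = tile m z then Transit else Transit, ?f, inc ?f z)"
        using st False notq by (auto simp: step_def)
      have "tile m z ?f = a i ?f div m + 1" using zf m3 by (simp add: tile_def)
      \<comment> \<open>The third boundary of a thick direction is used here: the entry tile lies
        strictly before the exit tile.\<close>
      then have ne: "tile m z \<noteq> lst i" using d(1) by (auto simp: exit_tile_def thick_def)
      have "inc ?f z l \<le> b i l" for l
      proof (cases "l = ?f")
        case True
        have "tile m (inc ?f z) l \<le> lst i l" using P_le[OF assms(2) tP] tl by simp
        then show ?thesis using below_exit[OF assms(2), of l "inc ?f z"] d True by (simp add: tile_def)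
      qed (use zb in simp)
      moreover have "inc ?f z l = b i l" if "l \<notin> T i" for l
      proof -
        have "l \<noteq> ?f" "l \<noteq> ?g" using that d by auto
        then show ?thesis using zent[of l] that by (simp add: entry_def)
      qed
      moreover have "inc ?f z ?f mod m - 1 = 0" using md by simp
      ultimately show ?thesis using r pts_inc[OF zp fD(1)] level_inc[OF fD(1), of z] lev tl tP ne d st'
          azi credit_0 by (auto simp: good_def)
    qed
  qed
qed

text \<open>A packet fails to turn only in company. The companion then goes straight as well, and by
  \<open>safe\<close> it came along another edge, so it departs in another direction.\<close>

lemma straight:
  assumes "safe t" "i \<in> I" "state t i = (Transit, h, z)" "trdir (state t) i \<noteq> want i (tile m z)"
  obtains q k where "q \<in> I" "q \<noteq> i" "tile m z \<in> P q" "state t q = (Transit, k, z)"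
    "trdir (state t) q \<noteq> h" "trdir (state t) i = h"
proof -
  have "occ (state t) z \<noteq> {i}" "trdir (state t) i = h"
    using assms by (auto simp: trdir_def split: if_splits)
  moreover have "i \<in> occ (state t) z" using assms occI by blast
  ultimately obtain q where q: "q \<in> occ (state t) z" "q \<noteq> i" by blast
  then obtain k where k: "q \<in> I" "state t q = (Transit, k, z)" by (auto simp: occ_def)
  have "occ (state t) z \<noteq> {q}" using q(2) \<open>i \<in> occ (state t) z\<close> by auto
  then have "trdir (state t) q = k" using k by (simp add: trdir_def)
  moreover have "k \<noteq> h" using assms k q(2) unfolding safe_def by blast
  moreover have "good t (state t) q" using assms(1) k by (simp add: safe_def)
  then have "tile m z \<in> P q" using k by (simp add: good_def)
  ultimately show ?thesis using that k q(2) \<open>trdir (state t) i = h\<close> by blast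
qed

lemma trdir_T:
  assumes "safe t" "i \<in> I" "state t i = (Transit, h, z)"
  shows "trdir (state t) i \<in> T i"
proof -
  have "good t (state t) i" using assms by (simp add: safe_def)
  then have "h \<in> T i" "tile m z \<in> P i" "tile m z \<noteq> lst i" using assms(3) by (simp_all add: good_def)
  then show ?thesis using want[OF assms(2)] assms(3) by (auto simp: trdir_def)
qed

lemma good_Transit:
  assumes "safe t" "i \<in> I" and st: "state t i = (Transit, h, z)"
  shows "good (Suc t) (state (Suc t)) i"
proof -
  let ?s = "state t"
  define e where "e = trdir ?s i"
  have g: "good t ?s i" using assms by (simp add: safe_def)
  have r: "\<not> Suc t < r i" and zp: "z \<in> pts D" and az: "\<And>l. a i l \<le> z l" and zb: "\<And>l. z l \<le> b i l"
    and lev: "level D z = t + \<Lambda>" and nT: "\<And>l. l \<notin> T i \<Longrightarrow> z l = b i l"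
    and tP: "tile m z \<in> P i" and ne: "tile m z \<noteq> lst i"
    and cr: "h \<noteq> want i (tile m z) \<Longrightarrow> credit ?s i h z (z h mod m - 1)"
    using g st by (auto simp: good_def)
  have azi: "a i l \<le> inc j z l" for j l using az[of l] inc_ge[of z l j] by simp
  have eT: "e \<in> T i" using trdir_T[OF assms] by (simp add: e_def)
  then have eD: "e < D" by (rule T_D)
  have st': "state (Suc t) i = (if tile m (inc e z) = lst i then Outbound else Transit, e, inc e z)"
    using st by (simp add: step_def e_def)
  have tP': "tile m (inc e z) \<in> P i" and
    cr': "e \<noteq> want i (tile m (inc e z)) \<Longrightarrow> credit (state (Suc t)) i e (inc e z) (inc e z e mod m - 1)"
  proof -
    \<comment> \<open>A wanted move stays in the tile or enters the next tile of the chain. Any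
      other move is paid for by a companion and, payers being scarce, cannot reach the
      boundary.\<close>
    consider (want) "e = want i (tile m z)" "Suc (z e) mod m \<noteq> 0"
      | (cross) "e = want i (tile m z)" "Suc (z e) mod m = 0"
      | (other) "e \<noteq> want i (tile m z)" by blast
    then have "tile m (inc e z) \<in> P i \<and> (e \<noteq> want i (tile m (inc e z)) \<longrightarrow>
        credit (state (Suc t)) i e (inc e z) (inc e z e mod m - 1))"
    proof cases
      case want
      then show ?thesis using tile_inc_in[of z e m] want(2) tP by simp
    next
      case cross
      then show ?thesis using tile_inc_out[of z e m] cross(2) local.want[OF assms(2) tP ne] by (simp add: credit_0)
    next
      case other
      obtain q k where q: "q \<in> I" "q \<noteq> i" "tile m z \<in> P q" "?s q = (Transit, k, z)" "trdir ?s q \<noteq> h" "e = h"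
        using straight[OF assms] other unfolding e_def by metis
      note cs = credit_step[OF assms(2) tP cr refl q(1-5)]
      have "z h mod m + 3 \<le> m" using cs(1) other q(6) by simp
      then have md: "Suc (z h) mod m = Suc (z h mod m)" by (simp add: mod_Suc)
      then have tl: "tile m (inc h z) = tile m z" by (intro tile_inc_in) simp
      then have "credit (state (Suc t)) i h (inc h z) (Suc (z h mod m - 1))"
        using cs(2)[of t] other q(6) by simp
      \<comment> \<open>Only an inequality: right after a crossing the offset is 0 and the
        subtraction truncates.\<close>
      moreover have "z h mod m \<le> Suc (z h mod m - 1)" by simp
      ultimately have "credit (state (Suc t)) i h (inc h z) (z h mod m)"
        unfolding credit_def by (meson le_trans)
      then show ?thesis using tl tP q(6) md by simp
    qed
    then show "tile m (inc e z) \<in> P i" "e \<noteq> want i (tile m (inc e z)) \<Longrightarrow> credit (state (Suc t)) i e (inc e z) (inc e z e mod m - 1)"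
      by auto
  qed
  have leb: "inc e z l \<le> b i l" for l
  proof (cases "l = e")
    case True
    then show ?thesis using below_exit[OF assms(2), of l "inc e z"] P_le[OF assms(2) tP', of l] eT
      by (simp add: tile_def)
  qed (use zb in simp)
  have nT': "inc e z l = b i l" if "l \<notin> T i" for l using nT[OF that] that eT by (auto simp: inc_apply)
  have "tile m (inc e z) \<in> dst_box D m (b i)" if "tile m (inc e z) = lst i"
    using tile_pts[OF pts_inc[OF zp eD], of m] unfolding dst_box_def that by (auto simp: exit_tile_def)
  then show ?thesis using r pts_inc[OF zp eD] level_inc[OF eD, of z] lev st' tP' cr' leb nT' eT
      azi by (auto simp: good_def)
qed

lemma good_Outbound:
  assumes "safe t" "i \<in> I" and st: "state t i = (Outbound, h, z)"
  shows "good (Suc t) (state (Suc t)) i"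
proof -
  have g: "good t (state t) i" using assms by (simp add: safe_def)
  have r: "\<not> Suc t < r i" and zp: "z \<in> pts D" and az: "\<And>l. a i l \<le> z l" and zb: "\<And>l. z l \<le> b i l"
    and lev: "level D z = t + \<Lambda>" and db: "tile m z \<in> dst_box D m (b i)"
    using g st by (auto simp: good_def)
  show ?thesis
  proof (cases "z = b i")
    case True
    then show ?thesis using st r zp az zb lev by (auto simp: good_def step_def)
  next
    case False
    have ex: "\<exists>l<D. z l < b i l"
      using False pts_eqI[OF zp b_pts[OF assms(2)]] zb by (meson le_neq_implies_less)
    have azi: "a i l \<le> inc j z l" for j l using az[of l] inc_ge[of z l j] by simp
    let ?e = "towards D (b i) z"
    have eD: "?e < D" using towards[OF ex] by simp
    have le': "inc ?e z l \<le> b i l" for l by (rule inc_towards_le[OF ex zb])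
    have "tile m z l \<le> tile m (inc ?e z) l" "tile m (inc ?e z) l \<le> b i l div m" for l
      using le'[of l] inc_ge[of z l ?e] by (auto simp: tile_def intro: div_le_mono)
    then have "tile m (inc ?e z) \<in> dst_box D m (b i)"
      using db tile_pts[OF pts_inc[OF zp eD], of m] unfolding dst_box_def
      by (auto intro: le_trans[OF _ Suc_le_mono[THEN iffD2]])
    moreover have "state (Suc t) i = (Outbound, 0, inc ?e z)" using st False by (simp add: step_def)
    ultimately show ?thesis using r pts_inc[OF zp eD] level_inc[OF eD, of z] lev le'
      azi by (auto simp: good_def)
  qed
qed

lemma good_start: "i \<in> I \<Longrightarrow> s i = (Inbound, 0, a i) \<Longrightarrow> r i = t \<Longrightarrow> good t s i"
  using a_pts[of i] a_le_b[of i] birth[of i] a_le_ent[of i] by (auto simp: good_def)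

lemma good_Suc:
  assumes "safe t" "i \<in> I"
  shows "good (Suc t) (state (Suc t)) i"
proof -
  obtain ph h z where st: "state t i = (ph, h, z)" by (cases "state t i") auto
  have g: "good t (state t) i" using assms by (simp add: safe_def)
  show ?thesis
  proof (cases ph)
    case Unborn
    then show ?thesis using g st good_start[OF assms(2), of "state (Suc t)" "Suc t"]
      by (auto simp: good_def step_def)
  next
    case Done
    then show ?thesis using g st by (auto simp: good_def step_def)
  qed (use st assms good_Inbound good_Transit good_Outbound in metis)+
qed

lemma Transit_prev:
  assumes "safe t" "i \<in> I" "state (Suc t) i = (Transit, h, z')"
  obtains k z where "z' = inc h z" "state t i = (Transit, k, z)" "trdir (state t) i = h"
  | k z where "z' = inc h z" "state t i = (Inbound, k, z)" "\<forall>q\<in>occ (state t) z. trdir (state t) q \<noteq> h"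
proof -
  obtain ph k z where st: "state t i = (ph, k, z)" by (cases "state t i") auto
  show ?thesis
    using assms(3) st that by (cases ph) (auto simp: step_def split: if_splits)
qed

lemma one_local:
  assumes "safe t" "i \<in> I" "q \<in> I" "state t i = (ph, k, z)" "state t q = (ph', k', z)"
    "ph = Inbound \<or> ph = Outbound" "ph' = Inbound \<or> ph' = Outbound"
  shows "i = q"
proof (rule ccontr)
  assume "i \<noteq> q"
  have "good t (state t) i" "good t (state t) q" using assms(1-3) by (simp_all add: safe_def)
  then show False using box_tile[of i t "state t"] box_tile[of q t "state t"] disj[of i q] assms \<open>i \<noteq> q\<close> by blast
qed

text \<open>Two companions both go straight, so a common next direction would be a common last
  direction, against \<open>safe\<close>.\<close>

lemma one_transit:
  assumes "safe t" "i \<in> I" "q \<in> I" "state t i = (Transit, k, z)" "state t q = (Transit, k', z)"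
    "trdir (state t) i = trdir (state t) q"
  shows "i = q"
proof (rule ccontr)
  assume "i \<noteq> q"
  have "{i, q} \<subseteq> occ (state t) z" using assms by (auto simp: occ_def)
  then have "occ (state t) z \<noteq> {i}" "occ (state t) z \<noteq> {q}" using \<open>i \<noteq> q\<close> by auto
  then have "k = k'" using assms by (simp add: trdir_def)
  then show False using assms \<open>i \<noteq> q\<close> unfolding safe_def by metis
qed

text \<open>Two transit packets on one edge are excluded by \<open>one_transit\<close>, a joining
  packet finds the edge free, and two joining packets would share a local point.\<close>

lemma safe: "safe t"
proof (induction t)
  case 0
  have "good 0 (state 0) i" if "i \<in> I" for i
    using good_start[OF that, of "state 0" 0] by (cases "r i = 0") (auto simp: good_def)
  then show ?case by (auto simp: safe_def split: if_splits)
next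
  case (Suc t)
  have "i = q" if iq: "i \<in> I" "q \<in> I" "state (Suc t) i = (Transit, h, z)" "state (Suc t) q = (Transit, h, z)" for i q h z
  proof (rule Transit_prev[OF Suc iq(1,3)]; rule Transit_prev[OF Suc iq(2,4)])
    fix k y k' y'
    assume "z = inc h y" "state t i = (Transit, k, y)" "trdir (state t) i = h"
      "z = inc h y'" "state t q = (Transit, k', y')" "trdir (state t) q = h"
    then show "i = q" using one_transit[OF Suc iq(1,2)] inc_inj by metis
  next
    fix k y k' y'
    assume "z = inc h y" "state t i = (Transit, k, y)" "trdir (state t) i = h"
      "z = inc h y'" "state t q = (Inbound, k', y')" "\<forall>q\<in>occ (state t) y'. trdir (state t) q \<noteq> h"
    then show "i = q" using occI[OF iq(1)] inc_inj by metis
  next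
    fix k y k' y'
    assume "z = inc h y" "state t i = (Inbound, k, y)" "\<forall>q\<in>occ (state t) y. trdir (state t) q \<noteq> h"
      "z = inc h y'" "state t q = (Transit, k', y')" "trdir (state t) q = h"
    then show "i = q" using occI[OF iq(2)] inc_inj by metis
  next
    fix k y k' y'
    assume "z = inc h y" "state t i = (Inbound, k, y)" "z = inc h y'" "state t q = (Inbound, k', y')"
    then show "i = q" using one_local[OF Suc iq(1,2)] inc_inj by metis
  qed
  then show ?case using good_Suc[OF Suc] unfolding safe_def by blast
qed

section \<open>Timetable and edge load of transit packets\<close>

lemma arrival:
  assumes "i \<in> I"
  shows "level D (b i) = arrival i + \<Lambda>" "r i \<le> arrival i"
  using level_mono[of D "a i" "b i"] a_le_b[OF assms] birth[OF assms] by (auto simp: arrival_def)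

lemma pos_start: "pos (r i) i = a i"
proof (cases "r i")
  case (Suc t)
  then show ?thesis using unborn[of t i] by (simp add: pos_def step_def)
qed (simp add: pos_def)

lemma en_route:
  assumes "i \<in> I" "r i \<le> t" "t \<le> arrival i"
  shows "pos t i \<in> pts D" "level D (pos t i) = t + \<Lambda>" "a i l \<le> pos t i l" "pos t i l \<le> b i l"
    "fst (state t i) \<in> {Inbound, Transit, Outbound}"
proof -
  obtain ph h z where st: "state t i = (ph, h, z)" by (cases "state t i") auto
  have "good t (state t) i" using safe[of t] assms(1) by (simp add: safe_def)
  then show "pos t i \<in> pts D" "level D (pos t i) = t + \<Lambda>" "a i l \<le> pos t i l" "pos t i l \<le> b i l"
    "fst (state t i) \<in> {Inbound, Transit, Outbound}"
    using st assms arrival[OF assms(1)] by (cases ph; auto simp: good_def pos_def)+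
qed

lemma pos_arrival: "i \<in> I \<Longrightarrow> pos (arrival i) i = b i"
  using en_route[of i "arrival i"] arrival[of i] b_pts[of i] by (intro pts_level_eq[of _ D]) auto

lemma move:
  assumes "i \<in> I" "r i \<le> t" "t < arrival i"
  obtains e where "e < D" "pos (Suc t) i = inc e (pos t i)"
    "fst (state t i) = Transit \<Longrightarrow> e = trdir (state t) i"
proof -
  obtain ph h z where st: "state t i = (ph, h, z)" by (cases "state t i") auto
  have g: "good t (state t) i" using safe[of t] assms(1) by (simp add: safe_def)
  note en = en_route[OF assms(1,2) less_imp_le[OF assms(3)]]
  note d = dirs[OF assms(1)]
  show ?thesis
  proof (cases ph)
    case Inbound
    let ?e = "if \<exists>l<D. z l < ent i l then towards D (ent i) z
       else if \<exists>q\<in>occ (state t) z. trdir (state t) q = join_dir i then climb_dir i else join_dir i"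
    have "?e < D" using towards(1)[of D z "ent i"] d T_D by auto
    moreover have "pos (Suc t) i = inc ?e (pos t i)" using st Inbound by (auto simp: pos_def step_def)
    ultimately show ?thesis using that[of ?e] st Inbound by simp
  next
    case Transit
    have "trdir (state t) i < D" using trdir_T[OF safe assms(1), of t h z] st Transit T_D by simp
    then show ?thesis using that[of "trdir (state t) i"] st Transit by (simp add: pos_def step_def)
  next
    case Outbound
    have "z \<noteq> b i" using en(2) arrival[OF assms(1)] assms(3) st by (auto simp: pos_def)
    moreover have "z \<in> pts D" "\<And>l. z l \<le> b i l" using g st Outbound by (auto simp: good_def)
    ultimately have "\<exists>l<D. z l < b i l" using pts_eqI[of z D "b i"] b_pts[OF assms(1)] by (meson le_neq_implies_less)
    then have "towards D (b i) z < D" by (rule towards)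
    then show ?thesis using that[of "towards D (b i) z"] st Outbound \<open>z \<noteq> b i\<close> by (simp add: pos_def step_def)
  qed (use en st in auto)
qed

lemma state_eq: "state t i = (fst (state t i), fst (snd (state t i)), pos t i)"
  by (simp add: pos_def)

text \<open>The packets are split by their phase before the move, so a joining packet counts as
  local; each class contributes at most one.\<close>

lemma capacity:
  "card {i \<in> I. r i \<le> t \<and> t < arrival i \<and> pos t i = z \<and> pos (Suc t) i = inc e z} \<le> 2"
proof -
  let ?C = "{i \<in> I. r i \<le> t \<and> t < arrival i \<and> pos t i = z \<and> pos (Suc t) i = inc e z}"
  let ?A = "{i \<in> ?C. fst (state t i) = Transit}" and ?B = "{i \<in> ?C. fst (state t i) \<noteq> Transit}"
  have fin: "finite ?A" "finite ?B" using finI by simp_all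
  have A: "i = q" if "i \<in> ?A" "q \<in> ?A" for i q
  proof -
    have dir: "trdir (state t) j = e" if j: "j \<in> ?A" for j
    proof -
      have J: "j \<in> I" "r j \<le> t" "t < arrival j" "pos t j = z" "pos (Suc t) j = inc e z" using j by simp_all
      obtain e' where "pos (Suc t) j = inc e' (pos t j)" "fst (state t j) = Transit \<Longrightarrow> e' = trdir (state t) j"
        using move[OF J(1-3)] by blast
      then show ?thesis using j J inc_inj_dir[of e' z e] by simp
    qed
    have "i \<in> I" "q \<in> I" using that by simp_all
    moreover have "state t i = (Transit, fst (snd (state t i)), z)" "state t q = (Transit, fst (snd (state t q)), z)"
      using that state_eq[of t i] state_eq[of t q] by simp_all
    ultimately show ?thesis using one_transit[OF safe, of i q t] dir[OF that(1)] dir[OF that(2)] by simp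
  qed
  have B: "i = q" if "i \<in> ?B" "q \<in> ?B" for i q
  proof -
    have loc: "fst (state t j) = Inbound \<or> fst (state t j) = Outbound" if "j \<in> ?B" for j
      using en_route(5)[of j t] that by simp
    have "i \<in> I" "q \<in> I" using that by simp_all
    moreover have "state t i = (fst (state t i), fst (snd (state t i)), z)"
      "state t q = (fst (state t q), fst (snd (state t q)), z)"
      using that state_eq[of t i] state_eq[of t q] by simp_all
    ultimately show ?thesis using one_local[OF safe, of i q t] loc[OF that(1)] loc[OF that(2)] by blast
  qed
  have "card ?A \<le> 1" using A by (simp only: One_nat_def card_le_Suc0_iff_eq[OF fin(1)]) blast
  moreover have "card ?B \<le> 1" using B by (simp only: One_nat_def card_le_Suc0_iff_eq[OF fin(2)]) blast
  moreover have "card ?C = card (?A \<union> ?B)" by (rule arg_cong[of _ _ card]) blast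
  moreover have "card (?A \<union> ?B) \<le> card ?A + card ?B" by (rule card_Un_le)
  ultimately show ?thesis by linarith
qed

end

section \<open>Packets on straight lines\<close>

locale line_dyn =
  fixes D :: nat and J :: "nat set" and r :: "nat \<Rightarrow> nat"
    and a b :: "nat \<Rightarrow> nat \<Rightarrow> nat" and dir :: "nat \<Rightarrow> nat"
begin

text \<open>The main direction comes first, so that a packet far from its arrival is on a straight
  line; the small offsets are made up at the end.\<close>

definition heading :: "nat \<Rightarrow> (nat \<Rightarrow> nat) \<Rightarrow> nat" where
  "heading i z = (if z (dir i) < b i (dir i) then dir i else towards D (b i) z)"

primrec walk :: "nat \<Rightarrow> nat \<Rightarrow> nat \<Rightarrow> nat" where
  "walk i 0 = a i"
| "walk i (Suc n) = inc (heading i (walk i n)) (walk i n)"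

definition pos :: "nat \<Rightarrow> nat \<Rightarrow> nat \<Rightarrow> nat" where
  "pos t i = walk i (t - r i)"

definition arrival :: "nat \<Rightarrow> nat" where
  "arrival i = r i + (level D (b i) - level D (a i))"

definition contend :: "nat \<Rightarrow> nat \<Rightarrow> nat \<Rightarrow> bool" where
  "contend t i k \<longleftrightarrow> t < arrival k \<and> pos t k = pos t i \<and> heading k (pos t k) = heading i (pos t i)"

text \<open>Breaking ties by index makes the order on contenders total, so that a contest leaves a
  single winner.\<close>

primrec alive :: "nat \<Rightarrow> nat \<Rightarrow> bool" where
  "alive 0 = (\<lambda>i. i \<in> J \<and> r i = 0)"
| "alive (Suc t) = (\<lambda>i. i \<in> J \<and> (r i = Suc t \<or> alive t i \<and> t < arrival i \<and>
     (\<forall>k. alive t k \<longrightarrow> contend t i k \<longrightarrow> arrival i < arrival k \<or> arrival i = arrival k \<and> i \<le> k)))"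

lemma alive_J: "alive t i \<Longrightarrow> i \<in> J \<and> r i \<le> t"
  by (induction t) auto

lemma alive_start: "i \<in> J \<Longrightarrow> alive (r i) i"
  by (cases "r i") auto

lemma alive_pred: "alive (Suc t) i \<Longrightarrow> r i \<le> t \<Longrightarrow> alive t i \<and> t < arrival i"
  by auto

lemma pos_start: "pos (r i) i = a i"
  by (simp add: pos_def)

lemma pos_Suc: "r i \<le> t \<Longrightarrow> pos (Suc t) i = inc (heading i (pos t i)) (pos t i)"
  by (simp add: pos_def Suc_diff_le)

end

text \<open>Counterpart of \<open>transit_cong\<close>: a packet that is not yet released is not
  alive and eliminates nobody.\<close>

lemma line_cong:
  assumes eq: "\<And>i. i \<in> J \<and> r i \<le> N \<longleftrightarrow> i \<in> J' \<and> r' i \<le> N"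
    and eq2: "\<And>i. i \<in> J \<Longrightarrow> r i \<le> N \<Longrightarrow> r i = r' i \<and> a i = a' i \<and> b i = b' i \<and> dir i = dir' i"
  shows "t \<le> Suc N \<Longrightarrow> i \<in> J \<Longrightarrow> r i \<le> N \<Longrightarrow>
    line_dyn.alive D J r a b dir t i = line_dyn.alive D J' r' a' b' dir' t i"
proof (induction t arbitrary: i)
  case 0
  then show ?case using eq[of i] eq2[of i] by (simp add: line_dyn.alive.simps)
next
  case (Suc t)
  let ?al = "line_dyn.alive D J r a b dir t" and ?al' = "line_dyn.alive D J' r' a' b' dir' t"
  have tN: "t \<le> N" using Suc.prems by simp
  have al: "?al k = ?al' k" for k
  proof (cases "k \<in> J \<and> r k \<le> N")
    case True
    then show ?thesis using Suc.IH tN by simp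
  next
    case False
    then show ?thesis using line_dyn.alive_J[of D J r a b dir t k] line_dyn.alive_J[of D J' r' a' b' dir' t k]
        eq[of k] tN by (meson le_trans)
  qed
  have hd: "line_dyn.heading D b dir k z = line_dyn.heading D b' dir' k z" if "k \<in> J" "r k \<le> N" for k z
    using eq2[OF that] by (simp add: line_dyn.heading_def)
  have wk: "line_dyn.walk D a b dir k n = line_dyn.walk D a' b' dir' k n" if "k \<in> J" "r k \<le> N" for k n
    using hd[OF that] eq2[OF that] by (induction n) (simp_all add: line_dyn.walk.simps)
  have ps: "line_dyn.pos D r a b dir u k = line_dyn.pos D r' a' b' dir' u k" if "k \<in> J" "r k \<le> N" for k u
    using wk[OF that] eq2[OF that] by (simp add: line_dyn.pos_def)
  have ar: "line_dyn.arrival D r a b k = line_dyn.arrival D r' a' b' k" if "k \<in> J" "r k \<le> N" for k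
    using eq2[OF that] by (simp add: line_dyn.arrival_def)
  have ct: "line_dyn.contend D r a b dir t i k = line_dyn.contend D r' a' b' dir' t i k" if "?al k" for k
  proof -
    have k: "k \<in> J" "r k \<le> N" using line_dyn.alive_J[OF that] tN by auto
    show ?thesis unfolding line_dyn.contend_def
      using ps[OF k] ps[OF Suc.prems(2,3)] hd[OF k] hd[OF Suc.prems(2,3)] ar[OF k] by simp
  qed
  have all: "(\<forall>k. ?al k \<longrightarrow> line_dyn.contend D r a b dir t i k \<longrightarrow>
       line_dyn.arrival D r a b i < line_dyn.arrival D r a b k \<or>
       line_dyn.arrival D r a b i = line_dyn.arrival D r a b k \<and> i \<le> k) \<longleftrightarrow>
     (\<forall>k. ?al' k \<longrightarrow> line_dyn.contend D r' a' b' dir' t i k \<longrightarrow>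
       line_dyn.arrival D r' a' b' i < line_dyn.arrival D r' a' b' k \<or>
       line_dyn.arrival D r' a' b' i = line_dyn.arrival D r' a' b' k \<and> i \<le> k)"
  proof -
    have "line_dyn.arrival D r a b k = line_dyn.arrival D r' a' b' k" if "?al k" for k
      using line_dyn.alive_J[OF that] tN ar[of k] by simp
    then show ?thesis using ct al ar[OF Suc.prems(2,3)] by metis
  qed
  have "i \<in> J'" "r i = r' i" using eq[of i] eq2[of i] Suc.prems by auto
  then show ?case using all al[of i] ar[OF Suc.prems(2,3)] Suc.prems by (simp add: line_dyn.alive.simps)
qed

locale line = line_dyn +
  fixes \<Lambda> R :: nat
  assumes finJ: "finite J"
    and a_pts: "i \<in> J \<Longrightarrow> a i \<in> pts D" and b_pts: "i \<in> J \<Longrightarrow> b i \<in> pts D"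
    and a_le_b: "i \<in> J \<Longrightarrow> a i l \<le> b i l"
    and birth: "i \<in> J \<Longrightarrow> level D (a i) = r i + \<Lambda>"
    and dir_D: "i \<in> J \<Longrightarrow> dir i < D"
    and thin: "i \<in> J \<Longrightarrow> (\<Sum>l\<in>{..<D} - {dir i}. b i l - a i l) \<le> R"
begin

lemma level_diff: "(\<And>l. z l \<le> z' l) \<Longrightarrow> (\<Sum>l<D. z' l - z l) = level D z' - level D z"
  unfolding level_def by (rule sum_subtractf_nat) auto

lemma sum_split: "j < D \<Longrightarrow> (\<Sum>l<D. f l) = f j + (\<Sum>l\<in>{..<D} - {j}. f l :: nat)"
  by (simp add: sum.remove[of "{..<D}" j])

lemma walk:
  assumes "i \<in> J" "n \<le> level D (b i) - level D (a i)"
  shows "walk i n \<in> pts D \<and> (\<forall>l. a i l \<le> walk i n l \<and> walk i n l \<le> b i l) \<and>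
    level D (walk i n) = level D (a i) + n"
  using assms(2)
proof (induction n)
  case 0
  then show ?case using a_pts[OF assms(1)] a_le_b[OF assms(1)] by simp
next
  case (Suc n)
  let ?z = "walk i n"
  have IH: "?z \<in> pts D" "\<And>l. a i l \<le> ?z l" "\<And>l. ?z l \<le> b i l" "level D ?z = level D (a i) + n"
    using Suc by auto
  have "\<exists>l<D. ?z l < b i l"
  proof (rule ccontr)
    assume "\<not> ?thesis"
    then have "level D (b i) \<le> level D ?z" by (intro level_mono) (meson leI)
    then show False using IH Suc.prems by simp
  qed
  note tw = towards[OF this]
  have h: "heading i ?z < D" "?z (heading i ?z) < b i (heading i ?z)"
    using tw dir_D[OF assms(1)] by (auto simp: heading_def)
  have "inc (heading i ?z) ?z l \<le> b i l" for l using h IH(3)[of l] by (auto simp: inc_apply)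
  moreover have "a i l \<le> inc (heading i ?z) ?z l" for l
    using IH(2)[of l] inc_ge[of ?z l "heading i ?z"] by simp
  ultimately show ?case using IH pts_inc[OF IH(1) h(1)] level_inc[OF h(1), of ?z] by simp
qed

lemma arrival:
  assumes "i \<in> J"
  shows "level D (b i) = arrival i + \<Lambda>" "r i \<le> arrival i"
  using level_mono[of D "a i" "b i"] a_le_b[OF assms] birth[OF assms] by (auto simp: arrival_def)

lemma en_route:
  assumes "i \<in> J" "r i \<le> t" "t \<le> arrival i"
  shows "pos t i \<in> pts D" "level D (pos t i) = t + \<Lambda>" "a i l \<le> pos t i l" "pos t i l \<le> b i l"
proof -
  have "t - r i \<le> level D (b i) - level D (a i)" using assms by (auto simp: arrival_def)
  note w = walk[OF assms(1) this]
  then show "pos t i \<in> pts D" "level D (pos t i) = t + \<Lambda>" "a i l \<le> pos t i l" "pos t i l \<le> b i l"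
    using birth[OF assms(1)] assms by (simp_all add: pos_def)
qed

lemma pos_arrival: "i \<in> J \<Longrightarrow> pos (arrival i) i = b i"
  using en_route[of i "arrival i"] arrival[of i] b_pts[of i] by (intro pts_level_eq[of _ D]) auto

lemma heading_D:
  assumes "i \<in> J" "r i \<le> t" "t < arrival i"
  shows "heading i (pos t i) < D"
proof -
  note e = en_route[OF assms(1,2) less_imp_le[OF assms(3)]]
  have "\<exists>l<D. pos t i l < b i l"
  proof (rule ccontr)
    assume "\<not> ?thesis"
    then have "level D (b i) \<le> level D (pos t i)" by (intro level_mono) (meson leI)
    then show False using e(2) arrival(1)[OF assms(1)] assms by simp
  qed
  then show ?thesis using towards dir_D[OF assms(1)] by (simp add: heading_def)
qed

text \<open>Once the main direction is exhausted only the thin offsets remain, and these take at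
  most \<open>R\<close> steps.\<close>

lemma straight:
  assumes "i \<in> J" "r i \<le> t" "t + R < arrival i"
  shows "heading i (pos t i) = dir i"
proof (rule ccontr)
  assume "\<not> ?thesis"
  then have le: "b i (dir i) \<le> pos t i (dir i)" by (auto simp: heading_def split: if_splits)
  have t: "t \<le> arrival i" using assms by simp
  note e = en_route[OF assms(1,2) t]
  have "arrival i - t = (\<Sum>l<D. b i l - pos t i l)"
    using level_diff[of "pos t i" "b i"] e arrival(1)[OF assms(1)] by simp
  also have "\<dots> = (\<Sum>l\<in>{..<D} - {dir i}. b i l - pos t i l)"
    using sum_split[OF dir_D[OF assms(1)], of "\<lambda>l. b i l - pos t i l"] le by simp
  also have "\<dots> \<le> (\<Sum>l\<in>{..<D} - {dir i}. b i l - a i l)"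
    by (intro sum_mono diff_le_mono2 e)
  also have "\<dots> \<le> R" by (rule thin[OF assms(1)])
  finally show False using assms(3) by simp
qed

text \<open>The packet that eliminates \<open>i\<close> arrives no later than \<open>i\<close> would, and as long as more than \<open>R\<close>
  steps remain it runs along the same line; following the chain of eliminations therefore leads to
  a delivered packet whose destination is close to the walk of \<open>i\<close>.\<close>
lemma survivor:
  assumes "alive t i" "t \<le> arrival i"
  shows "\<exists>x\<in>J. alive (arrival x) x \<and> t \<le> arrival x \<and> arrival x \<le> arrival i \<and>
    (\<forall>l. pos t i l \<le> b x l) \<and> (\<Sum>l\<in>{..<D} - {dir i}. b x l - pos t i l) \<le> R"
  using assms
proof (induction "arrival i - t" arbitrary: i t rule: less_induct)
  case less
  note i = alive_J[OF less.prems(1)]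
  show ?case
  proof (cases "t = arrival i")
    case True
    then have "pos t i = b i" using pos_arrival i by simp
    then show ?thesis using less.prems True i by (intro bexI[of _ i]) auto
  next
    case False
    then have ti: "t < arrival i" using less.prems by simp
    let ?C = "{k. alive t k \<and> contend t i k}"
    have finC: "finite ?C" using finite_subset[of ?C J] finJ alive_J by auto
    have iC: "i \<in> ?C" using less.prems ti by (simp add: contend_def)
    \<comment> \<open>The winner \<open>k\<close> of the contest at this edge has the least arrival
      \<open>F\<close> and, among those, the least index.\<close>
    define F where "F = Min (arrival ` ?C)"
    have "F \<in> arrival ` ?C" unfolding F_def using finC iC by (intro Min_in) auto
    then have ne: "{k \<in> ?C. arrival k = F} \<noteq> {}" by auto
    have finG: "finite {k \<in> ?C. arrival k = F}" using finC by (rule rev_finite_subset) auto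
    define k where "k = Min {k \<in> ?C. arrival k = F}"
    have "k \<in> {k \<in> ?C. arrival k = F}" unfolding k_def using finG ne by (rule Min_in)
    then have k: "k \<in> ?C" "arrival k = F" by simp_all
    have minF: "F \<le> arrival x" if "x \<in> ?C" for x using that finC by (auto simp: F_def)
    have mink: "k \<le> x" if "x \<in> ?C" "arrival x = F" for x
      unfolding k_def using finG that by (intro Min_le) auto
    have kJ: "k \<in> J" "r k \<le> t" using alive_J k(1) by auto
    have pk: "pos t k = pos t i" "heading k (pos t k) = heading i (pos t i)" "t < arrival k"
      using k by (auto simp: contend_def)
    have "x \<in> ?C" if "alive t x" "contend t k x" for x
      using that pk by (auto simp: contend_def)
    then have "arrival k < arrival x \<or> arrival k = arrival x \<and> k \<le> x" if "alive t x" "contend t k x" for x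
      using that minF[of x] mink[of x] k(2) by (metis le_neq_implies_less)
    then have "alive (Suc t) k" using kJ k(1) pk(3) by simp
    moreover have ki: "arrival k \<le> arrival i" using minF[OF iC] k(2) by simp
    moreover have "arrival k - Suc t < arrival i - t" using ki pk(3) by simp
    ultimately have "\<exists>x\<in>J. alive (arrival x) x \<and> Suc t \<le> arrival x \<and> arrival x \<le> arrival k \<and>
        (\<forall>l. pos (Suc t) k l \<le> b x l) \<and> (\<Sum>l\<in>{..<D} - {dir k}. b x l - pos (Suc t) k l) \<le> R"
      using less.hyps[of k "Suc t"] pk(3) by simp
    then obtain x where x: "x \<in> J" "alive (arrival x) x" "Suc t \<le> arrival x" "arrival x \<le> arrival k"
      "\<And>l. pos (Suc t) k l \<le> b x l" "(\<Sum>l\<in>{..<D} - {dir k}. b x l - pos (Suc t) k l) \<le> R"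
      by blast
    define z where "z = pos t i"
    define e where "e = heading i z"
    have ps: "pos (Suc t) k = inc e z" using pos_Suc[OF kJ(2)] pk by (simp add: z_def e_def)
    have zx: "z l \<le> b x l" for l using x(5)[of l] inc_ge[of z l e] unfolding ps by simp
    have lz: "level D z = t + \<Lambda>" using en_route(2)[of i t] i ti by (simp add: z_def)
    have tot: "(\<Sum>l<D. b x l - z l) = arrival x - t"
      using level_diff[of z "b x"] zx lz arrival(1)[OF x(1)] by simp
    have "(\<Sum>l\<in>{..<D} - {dir i}. b x l - z l) \<le> R"
    \<comment> \<open>Close to the end the whole remaining distance is at most \<open>R\<close>.
      Otherwise \<open>i\<close> and \<open>k\<close> both still run along their main directions,
      which therefore agree, and a step in that direction does not change the sum.\<close>
    proof (cases "arrival k \<le> t + R")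
      case True
      have "(\<Sum>l\<in>{..<D} - {dir i}. b x l - z l) \<le> (\<Sum>l<D. b x l - z l)"
        by (intro sum_mono2) auto
      then show ?thesis using tot x(4) True by simp
    next
      case False
      have "e = dir i" using straight[of i t] i False ki by (simp add: e_def z_def)
      moreover have "e = dir k" using straight[of k t] kJ False pk by (simp add: e_def z_def)
      moreover have "(\<Sum>l\<in>{..<D} - {e}. b x l - z l) = (\<Sum>l\<in>{..<D} - {e}. b x l - inc e z l)"
        by (intro sum.cong) auto
      ultimately show ?thesis using x(6) unfolding ps by simp
    qed
    then show ?thesis using x zx ki by (intro bexI[of _ x]) (auto simp: z_def)
  qed
qed

text \<open>Off the main direction this is \<open>survivor\<close> at the release of
  \<open>i\<close>. Along it, lengths are compared: as \<open>x\<close> arrives no later than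
  \<open>i\<close> would, the way from the origin of \<open>i\<close> to the destination of
  \<open>x\<close> is no longer than the route of \<open>i\<close>.\<close>

lemma charge:
  assumes "i \<in> J"
  shows "\<exists>x\<in>J. alive (arrival x) x \<and> (\<forall>l<D. a i l \<le> b x l \<and>
    (if l = dir i then b x l \<le> b i l + R else b x l \<le> a i l + R))"
proof -
  obtain x where x: "x \<in> J" "alive (arrival x) x" "r i \<le> arrival x" "arrival x \<le> arrival i"
    "\<And>l. a i l \<le> b x l" "(\<Sum>l\<in>{..<D} - {dir i}. b x l - a i l) \<le> R"
    using survivor[OF alive_start[OF assms]] arrival(2)[OF assms] by (auto simp: pos_start)
  have off: "b x l \<le> a i l + R" if "l < D" "l \<noteq> dir i" for l
  proof -
    have "b x l - a i l \<le> (\<Sum>l\<in>{..<D} - {dir i}. b x l - a i l)"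
      using that by (intro member_le_sum) auto
    then show ?thesis using x(6) by simp
  qed
  have "b x (dir i) - a i (dir i) \<le> (\<Sum>l<D. b x l - a i l)"
    using dir_D[OF assms] by (intro member_le_sum) auto
  also have "\<dots> = level D (b x) - level D (a i)" using x(5) by (intro level_diff)
  also have "\<dots> = arrival x - r i" using arrival(1)[OF x(1)] birth[OF assms] by simp
  also have "\<dots> \<le> arrival i - r i" using x(4) by simp
  also have "\<dots> = (\<Sum>l<D. b i l - a i l)"
    using level_diff[of "a i" "b i"] a_le_b[OF assms] by (simp add: arrival_def)
  also have "\<dots> \<le> b i (dir i) - a i (dir i) + R"
    using sum_split[OF dir_D[OF assms], of "\<lambda>l. b i l - a i l"] thin[OF assms] by simp
  finally have "b x (dir i) \<le> b i (dir i) + R" using a_le_b[OF assms, of "dir i"] x(5)[of "dir i"] by linarith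
  then show ?thesis using off x by (intro bexI[of _ x]) auto
qed

text \<open>Two survivors on one edge contend with each other, so each precedes the other in the
  elimination order.\<close>

lemma capacity:
  "card {i \<in> J. r i \<le> t \<and> alive (Suc t) i \<and> pos t i = z \<and> pos (Suc t) i = inc e z} \<le> 1"
proof -
  let ?C = "{i \<in> J. r i \<le> t \<and> alive (Suc t) i \<and> pos t i = z \<and> pos (Suc t) i = inc e z}"
  have fin: "finite ?C" using finJ by simp
  have hd: "heading i z = e" if "i \<in> ?C" for i
  proof -
    have "pos t i = z" "pos (Suc t) i = inc e z" "r i \<le> t" using that by (simp_all del: alive.simps)
    then show ?thesis using pos_Suc[of i t] by (intro inc_inj_dir[of _ z]) metis
  qed
  have le: "arrival i < arrival k \<or> arrival i = arrival k \<and> i \<le> k" if ik: "i \<in> ?C" "k \<in> ?C" for i k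
  proof -
    have ik': "alive (Suc t) i" "alive (Suc t) k" "r i \<le> t" "r k \<le> t" "pos t i = z" "pos t k = z"
      using ik by (simp_all del: alive.simps)
    have k: "alive t k" "t < arrival k" using alive_pred ik' by blast+
    have "contend t i k" unfolding contend_def ik' using hd[OF ik(1)] hd[OF ik(2)] k(2) by simp
    moreover have "\<forall>k. alive t k \<longrightarrow> contend t i k \<longrightarrow> arrival i < arrival k \<or> arrival i = arrival k \<and> i \<le> k"
      using ik'(1,3) by auto
    ultimately show ?thesis using k(1) by blast
  qed
  have "i = k" if "i \<in> ?C" "k \<in> ?C" for i k
    using le[OF that] le[OF that(2,1)] by auto
  then show ?thesis by (simp only: One_nat_def card_le_Suc0_iff_eq[OF fin]) blast
qed

end

section \<open>Admission control\<close>

locale admission =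
  fixes p :: nat and cand :: "nat \<Rightarrow> 'c set" and path box :: "'c \<Rightarrow> 'u set"
begin

definition pick :: "nat \<Rightarrow> ('u \<Rightarrow> real) \<Rightarrow> 'c option" where
  "pick n w = (if \<exists>x\<in>cand n. sum w (path x \<union> box x) < 1
     then Some (SOME x. x \<in> cand n \<and> sum w (path x \<union> box x) < 1) else None)"

text \<open>Doubling plus \<open>1 / p\<close> lets weights grow exponentially from zero with the
  number of users. The full unit on the box closes it to all later candidates.\<close>

definition charge :: "'c option \<Rightarrow> ('u \<Rightarrow> real) \<Rightarrow> 'u \<Rightarrow> real" where
  "charge x w = (case x of None \<Rightarrow> w | Some x \<Rightarrow>
     (\<lambda>u. w u + (if u \<in> path x then w u + 1 / p else 0) + (if u \<in> box x then 1 else 0)))"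

primrec weight :: "nat \<Rightarrow> 'u \<Rightarrow> real" where
  "weight 0 = (\<lambda>_. 0)"
| "weight (Suc n) = charge (pick n (weight n)) (weight n)"

definition choice :: "nat \<Rightarrow> 'c option" where
  "choice n = pick n (weight n)"

end

lemma admission_cong:
  assumes "\<And>k. k \<le> n \<Longrightarrow> cand k = cand' k"
  shows "admission.choice p cand path box n = admission.choice p cand' path box n"
proof -
  have "k \<le> n \<Longrightarrow> admission.weight p cand path box k = admission.weight p cand' path box k" for k
    by (induction k) (simp_all add: admission.weight.simps admission.pick_def assms)
  then show ?thesis using assms by (simp add: admission.choice_def admission.pick_def)
qed

locale admission_bounded = admission p cand path box
  for p :: nat and cand :: "nat \<Rightarrow> 'c set" and path box :: "'c \<Rightarrow> 'u set" +
  fixes \<beta> :: nat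
  assumes p: "p > 0"
    and fin: "x \<in> cand n \<Longrightarrow> finite (path x) \<and> finite (box x)"
    and len: "x \<in> cand n \<Longrightarrow> card (path x) \<le> p"
    and box: "x \<in> cand n \<Longrightarrow> card (box x) \<le> \<beta>"
begin

lemma choice_Some:
  assumes "choice n = Some x"
  shows "x \<in> cand n" "sum (weight n) (path x \<union> box x) < 1"
proof -
  have ex: "\<exists>x. x \<in> cand n \<and> sum (weight n) (path x \<union> box x) < 1"
    and eq: "(SOME x. x \<in> cand n \<and> sum (weight n) (path x \<union> box x) < 1) = x"
    using assms by (auto simp: choice_def pick_def split: if_splits)
  have "x \<in> cand n \<and> sum (weight n) (path x \<union> box x) < 1" using someI_ex[OF ex] unfolding eq .
  then show "x \<in> cand n" "sum (weight n) (path x \<union> box x) < 1" by auto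
qed

lemma choice_None: "choice n = None \<Longrightarrow> x \<in> cand n \<Longrightarrow> 1 \<le> sum (weight n) (path x \<union> box x)"
  by (auto simp: choice_def pick_def split: if_splits intro: leI)

lemma weight_Suc: "weight (Suc n) = charge (choice n) (weight n)"
  by (simp add: choice_def)

declare weight.simps(2) [simp del]

lemma weight_nonneg: "0 \<le> weight n u"
proof (induction n)
  case (Suc n)
  then show ?case using p by (auto simp: weight_Suc charge_def split: option.splits)
qed simp

lemma weight_mono: "n \<le> n' \<Longrightarrow> weight n u \<le> weight n' u"
proof (induction n' rule: dec_induct)
  case (step n')
  have "weight n' u \<le> weight (Suc n') u"
    using p weight_nonneg[of n' u] by (auto simp: weight_Suc charge_def split: option.splits)
  then show ?case using step by simp
qed simp

lemma weight_less_one: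
  assumes "choice n = Some x" "u \<in> path x \<union> box x"
  shows "weight n u < 1"
proof -
  have "weight n u \<le> sum (weight n) (path x \<union> box x)"
    using assms(2) fin[OF choice_Some(1)[OF assms(1)]] weight_nonneg by (intro member_le_sum) auto
  then show ?thesis using choice_Some(2)[OF assms(1)] by simp
qed

definition accepted :: "nat \<Rightarrow> nat set" where
  "accepted n = {k. k < n \<and> choice k \<noteq> None}"

lemma accepted_Suc: "accepted (Suc n) = (if choice n = None then accepted n else insert n (accepted n))"
  by (auto simp: accepted_def less_Suc_eq)

lemma finite_accepted [simp]: "finite (accepted n)" and n_notin [simp]: "n \<notin> accepted n"
  by (auto simp: accepted_def)

text \<open>Per acceptance: the chain weighed less than one before and is doubled, the terms
  \<open>1 / p\<close> add up to at most one over \<open>p\<close> tiles, and the box adds its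
  size.\<close>

lemma total:
  assumes "finite F"
  shows "sum (weight n) F \<le> (2 + real \<beta>) * card (accepted n)"
proof (induction n)
  case (Suc n)
  show ?case
  proof (cases "choice n")
    case None
    then show ?thesis using Suc by (simp add: weight_Suc charge_def accepted_Suc)
  next
    case (Some x)
    note c = choice_Some[OF Some]
    note f = fin[OF c(1)]
    have "sum (weight (Suc n)) F = sum (weight n) F + sum (\<lambda>u. weight n u + 1 / p) (F \<inter> path x)
        + sum (\<lambda>_. 1) (F \<inter> box x)"
      unfolding sum.inter_restrict[OF assms] sum.distrib[symmetric]
      by (simp add: weight_Suc charge_def Some)
    also have "sum (\<lambda>u. weight n u + 1 / p) (F \<inter> path x) \<le> sum (\<lambda>u. weight n u + 1 / p) (path x)"
      using f weight_nonneg p by (intro sum_mono2) (auto intro: add_nonneg_nonneg)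
    also have "\<dots> = sum (weight n) (path x) + card (path x) / p" by (simp add: sum.distrib)
    also have "sum (weight n) (path x) \<le> sum (weight n) (path x \<union> box x)"
      using f weight_nonneg by (intro sum_mono2) auto
    also have "real (card (path x)) / p \<le> 1" using len[OF c(1)] p by simp
    also have "sum (\<lambda>_. 1 :: real) (F \<inter> box x) \<le> \<beta>"
      using card_mono[of "box x" "F \<inter> box x"] f box[OF c(1)] by simp
    finally have "sum (weight (Suc n)) F \<le> sum (weight n) F + 2 + \<beta>" using c(2) by simp
    then show ?thesis using Suc Some by (simp add: accepted_Suc algebra_simps)
  qed
qed simp

definition users :: "nat \<Rightarrow> 'u \<Rightarrow> nat set" where
  "users n u = {k. k < n \<and> (\<exists>x. choice k = Some x \<and> u \<in> path x)}"

lemma users_Suc: "users (Suc n) u =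
    (if \<exists>x. choice n = Some x \<and> u \<in> path x then insert n (users n u) else users n u)"
  by (auto simp: users_def less_Suc_eq)

lemma finite_users [simp]: "finite (users n u)" and n_notin_users [simp]: "n \<notin> users n u"
  by (auto simp: users_def)

text \<open>Scaled by \<open>p\<close>, each use maps a weight \<open>x\<close> to at least
  \<open>2 * x + 1\<close>, and \<open>2 ^ k - 1\<close> solves this recursion.\<close>

lemma weight_users: "2 ^ card (users n u) - 1 \<le> real p * weight n u"
proof (induction n)
  case (Suc n)
  show ?case
  proof (cases "\<exists>x. choice n = Some x \<and> u \<in> path x")
    case True
    then obtain x where x: "choice n = Some x" "u \<in> path x" by blast
    have "2 ^ card (users (Suc n) u) - 1 = 2 * (2 ^ card (users n u) - 1) + (1 :: real)"
      using True by (simp add: users_Suc)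
    also have "\<dots> \<le> 2 * (real p * weight n u) + 1" using Suc by simp
    also have "\<dots> \<le> p * (2 * weight n u + 1 / p)" using p by (simp add: distrib_left)
    also have "\<dots> \<le> p * weight (Suc n) u"
      using x p by (intro mult_left_mono) (auto simp: weight_Suc charge_def)
    finally show ?thesis .
  next
    case False
    then have "users (Suc n) u = users n u" by (simp only: users_Suc if_False)
    then have "2 ^ card (users (Suc n) u) - 1 \<le> real p * weight n u" using Suc by simp
    also have "\<dots> \<le> p * weight (Suc n) u" by (intro mult_left_mono weight_mono) auto
    finally show ?thesis .
  qed
qed (simp add: users_def)

text \<open>The last user still found a weight below one, so at most \<open>p\<close> bounded the
  power before it; this user doubles the power once.\<close>

lemma load: "2 ^ card (users n u) \<le> 2 * p"
proof (induction n)
  case 0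
  then show ?case using p by (simp add: users_def)
next
  case (Suc n)
  show ?case
  proof (cases "\<exists>x. choice n = Some x \<and> u \<in> path x")
    case True
    then obtain x where x: "choice n = Some x" "u \<in> path x" by blast
    have "weight n u < 1" using weight_less_one[OF x(1)] x(2) by simp
    then have "real p * weight n u < p" using p by simp
    then have "2 ^ card (users n u) < real p + 1" using weight_users[of n u] by linarith
    then have "real (2 ^ card (users n u)) < real (p + 1)" by simp
    then have "2 ^ card (users n u) < p + 1" by (simp only: of_nat_less_iff)
    then show ?thesis using True by (simp add: users_Suc)
  next
    case False
    then have "users (Suc n) u = users n u" by (simp only: users_Suc if_False)
    then show ?thesis using Suc by simp
  qed
qed

lemma box_disjoint:
  assumes "k < k'" "choice k = Some x" "choice k' = Some x'"
  shows "box x \<inter> box x' = {}"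
proof (rule ccontr)
  assume "\<not> ?thesis"
  then obtain u where u: "u \<in> box x" "u \<in> box x'" by blast
  have "1 \<le> weight (Suc k) u"
    using assms(2) u(1) weight_nonneg[of k u] p by (auto simp: weight_Suc charge_def)
  also have "\<dots> \<le> weight k' u" using assms(1) by (intro weight_mono) simp
  finally show False using weight_less_one[OF assms(3), of u] u by simp
qed

text \<open>Weights never decrease, so a rejection can be paid for with the final weights, whose
  total is bounded by \<open>total\<close>.\<close>

lemma reject:
  assumes "choice n = None" "x \<in> cand n" "n \<le> N"
  shows "1 \<le> sum (weight N) (path x \<union> box x)"
  using choice_None[OF assms(1,2)] sum_mono[of "path x \<union> box x" "weight n" "weight N"]
    weight_mono[OF assms(3)] by (meson order_trans)

end

section \<open>Trips and chains of tiles\<close>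

definition trip :: "nat \<Rightarrow> (nat \<Rightarrow> nat \<Rightarrow> nat) \<Rightarrow> nat \<Rightarrow> nat \<Rightarrow> bool" where
  "trip D z s t \<longleftrightarrow> s \<le> t \<and> (\<forall>u. s \<le> u \<longrightarrow> u < t \<longrightarrow> (\<exists>j<D. z (Suc u) = inc j (z u)))"

definition near :: "nat \<Rightarrow> nat \<Rightarrow> (nat \<Rightarrow> nat) \<Rightarrow> (nat \<Rightarrow> nat) \<Rightarrow> bool" where
  "near D k U V \<longleftrightarrow> U \<in> pts D \<and> V \<in> pts D \<and> (\<forall>l<D. U l \<le> V l + k \<and> V l \<le> U l + k)"

text \<open>Radius 2 covers the clamped chain of the trip as well as the boxes at its ends, and
  hence everything its plan is charged for.\<close>

definition trail :: "nat \<Rightarrow> nat \<Rightarrow> (nat \<Rightarrow> nat \<Rightarrow> nat) \<Rightarrow> nat \<Rightarrow> nat \<Rightarrow> (nat \<Rightarrow> nat) set" where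
  "trail D m z s t = {U. \<exists>u. s \<le> u \<and> u \<le> t \<and> near D 2 U (tile m (z u))}"

text \<open>The assumptions of \<open>transit\<close> that concern a single chain, together with the
  length bound of admission control.\<close>

definition is_plan :: "nat \<Rightarrow> nat \<Rightarrow> nat \<Rightarrow> (nat \<Rightarrow> nat) \<Rightarrow> (nat \<Rightarrow> nat) \<Rightarrow> (nat \<Rightarrow> nat) set \<Rightarrow> bool" where
  "is_plan D m p a b P \<longleftrightarrow> 2 \<le> card (thick D m a b) \<and> tile m (entry D m a b) \<in> P \<and>
     (\<forall>U\<in>P. \<forall>l. U l \<le> exit_tile D m a b l) \<and>
     (\<forall>U\<in>P. U \<noteq> exit_tile D m a b \<longrightarrow> (\<exists>j\<in>thick D m a b. inc j U \<in> P)) \<and>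
     finite P \<and> card P \<le> p"

section \<open>Trips\<close>

lemma near_commute: "near D k U V \<longleftrightarrow> near D k V U"
  by (auto simp: near_def)

lemma trip_refl: "trip D z s s"
  by (simp add: trip_def)

lemma trip_split: "trip D z s t \<Longrightarrow> s \<le> u \<Longrightarrow> u \<le> t \<Longrightarrow> trip D z s u \<and> trip D z u t"
  by (auto simp: trip_def)

lemma trip_Suc: "trip D z s (Suc t) \<Longrightarrow> s \<le> t \<Longrightarrow> trip D z s t \<and> (\<exists>j<D. z (Suc t) = inc j (z t))"
  by (auto simp: trip_def)

lemma trip_mono:
  assumes "trip D z s t"
  shows "z s l \<le> z t l"
proof -
  have "s \<le> t" using assms by (simp add: trip_def)
  then show ?thesis using assms
  proof (induction t rule: dec_induct)
    case (step t)
    then obtain j where "z (Suc t) = inc j (z t)" "trip D z s t" using trip_Suc[of D z s t] by auto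
    then show ?case using step inc_ge[of "z t" l j] by simp
  qed simp
qed

lemma trip_level:
  assumes "trip D z s t"
  shows "level D (z t) + s = level D (z s) + t"
proof -
  have "s \<le> t" using assms by (simp add: trip_def)
  then show ?thesis using assms
  proof (induction t rule: dec_induct)
    case (step t)
    then obtain j where "j < D" "z (Suc t) = inc j (z t)" "trip D z s t" using trip_Suc[of D z s t] by auto
    then show ?case using step level_inc[of j D "z t"] by simp
  qed simp
qed

lemma trip_pts:
  assumes "trip D z s t" "z s \<in> pts D"
  shows "z t \<in> pts D"
proof -
  have "s \<le> t" using assms by (simp add: trip_def)
  then show ?thesis using assms(1)
  proof (induction t rule: dec_induct)
    case (step t)
    then obtain j where "j < D" "z (Suc t) = inc j (z t)" "trip D z s t" using trip_Suc[of D z s t] by auto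
    then show ?case using step pts_inc by simp
  qed (use assms in simp)
qed

text \<open>A discrete intermediate value property: a coordinate never jumps by more than
  one.\<close>

lemma trip_visits:
  assumes "trip D z s t" "z s l \<le> x" "x \<le> z t l"
  shows "\<exists>u. s \<le> u \<and> u \<le> t \<and> z u l = x"
proof -
  have "s \<le> t" using assms by (simp add: trip_def)
  then show ?thesis using assms
  proof (induction t rule: dec_induct)
    case base
    then show ?case by (intro exI[of _ s]) simp
  next
    case (step t)
    then obtain j where j: "z (Suc t) = inc j (z t)" "trip D z s t" using trip_Suc[of D z s t] by auto
    show ?case
    proof (cases "x \<le> z t l")
      case True
      then show ?thesis using step j(2) by (meson le_SucI)
    next
      case False
      then have "z (Suc t) l = x" using j(1) step(6) by (auto simp: inc_apply split: if_splits)
      then show ?thesis using step(1) by (intro exI[of _ "Suc t"]) simp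
    qed
  qed
qed

lemma trip_exists:
  assumes "x \<in> pts D" "y \<in> pts D" "\<And>l. x l \<le> y l"
  shows "\<exists>z. trip D z s (s + (level D y - level D x)) \<and> z s = x \<and> z (s + (level D y - level D x)) = y"
  using assms
proof (induction "level D y - level D x" arbitrary: x s)
  case 0
  then have "level D x = level D y" using level_mono[of D x y] by simp
  then have "x = y" using 0 by (intro pts_level_eq) auto
  then show ?case by (intro exI[of _ "\<lambda>_. x"]) (simp add: trip_refl)
next
  case (Suc n)
  have ex: "\<exists>l<D. x l < y l"
  proof (rule ccontr)
    assume "\<not> ?thesis"
    then have "level D y \<le> level D x" by (intro level_mono) (meson leI)
    then show False using Suc(2) by simp
  qed
  let ?j = "towards D y x"
  note j = towards[OF ex]
  have lv: "level D (inc ?j x) = Suc (level D x)" using level_inc[OF j(1)] .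
  have n: "n = level D y - level D (inc ?j x)" using Suc(2) lv by linarith
  obtain z where z: "trip D z (Suc s) (Suc s + (level D y - level D (inc ?j x)))" "z (Suc s) = inc ?j x"
    "z (Suc s + (level D y - level D (inc ?j x))) = y"
    using Suc(1)[OF n pts_inc[OF Suc(3) j(1)] Suc(4) inc_towards_le[OF ex Suc(5)], of "Suc s"] by blast
  have e: "Suc s + (level D y - level D (inc ?j x)) = s + (level D y - level D x)" using lv Suc(2) by simp
  define z' where "z' = z(s := x)"
  have "\<exists>j<D. z' (Suc u) = inc j (z' u)" if "s \<le> u" "u < s + (level D y - level D x)" for u
  proof (cases "u = s")
    case True
    then show ?thesis using z(2) j(1) by (auto simp: z'_def)
  next
    case False
    then have "Suc s \<le> u" using that by simp
    then show ?thesis using z(1) that unfolding trip_def e z'_def by simp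
  qed
  then show ?case using z(3) Suc(2) unfolding e by (intro exI[of _ z']) (auto simp: trip_def z'_def)
qed

section \<open>Sizes of boxes, cells and trails\<close>

lemma finite_card_pts_box:
  assumes "\<And>l. l < D \<Longrightarrow> finite (A l)"
  shows "finite {z \<in> pts D. \<forall>l<D. z l \<in> A l}" "card {z \<in> pts D. \<forall>l<D. z l \<in> A l} \<le> (\<Prod>l<D. card (A l))"
proof -
  let ?S = "{z \<in> pts D. \<forall>l<D. z l \<in> A l}"
  have inj: "inj_on (\<lambda>z. restrict z {..<D}) ?S"
  proof (rule inj_onI)
    fix z z' assume zz: "z \<in> ?S" "z' \<in> ?S" "restrict z {..<D} = restrict z' {..<D}"
    have "z l = z' l" if "l < D" for l using fun_cong[OF zz(3), of l] that by simp
    then show "z = z'" using zz pts_eqI[of z D z'] by auto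
  qed
  have im: "(\<lambda>z. restrict z {..<D}) ` ?S \<subseteq> PiE {..<D} A"
    by (simp add: image_subset_iff restrict_PiE_iff)
  have fin: "finite (PiE {..<D} A)" using assms by (intro finite_PiE) auto
  show "finite ?S" using finite_imageD[OF finite_subset[OF im fin] inj] .
  have "card ?S = card ((\<lambda>z. restrict z {..<D}) ` ?S)" using card_image[OF inj] by simp
  also have "\<dots> \<le> card (PiE {..<D} A)" by (rule card_mono[OF fin im])
  finally show "card ?S \<le> (\<Prod>l<D. card (A l))" by (simp add: card_PiE)
qed

lemma finite_card_near:
  shows "finite {U. near D k U V}" "card {U. near D k U V} \<le> (2 * k + 1) ^ D"
proof -
  have sub: "{U. near D k U V} \<subseteq> {U \<in> pts D. \<forall>l<D. U l \<in> {V l - k..V l + k}}"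
    by (auto simp: near_def)
  note b = finite_card_pts_box[of D "\<lambda>l. {V l - k..V l + k}", OF finite_atLeastAtMost]
  show "finite {U. near D k U V}" by (rule finite_subset[OF sub b(1)])
  have "card {U. near D k U V} \<le> (\<Prod>l<D. card {V l - k..V l + k})"
    using card_mono[OF b(1) sub] b(2) by simp
  also have "\<dots> \<le> (\<Prod>l<D. 2 * k + 1)" by (intro prod_mono) auto
  finally show "card {U. near D k U V} \<le> (2 * k + 1) ^ D" by simp
qed

lemma finite_card_cell:
  assumes "m > 0"
  shows "finite {z \<in> pts D. tile m z = U}" "card {z \<in> pts D. tile m z = U} \<le> m ^ D"
proof -
  have cell: "z l \<in> {m * U l..<m * U l + m}" if "tile m z = U" for z l
    using that assms div_times_less_eq_dividend[of "z l" m] dividend_less_times_div[OF assms, of "z l"]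
    by (auto simp: tile_def mult.commute)
  have sub: "{z \<in> pts D. tile m z = U} \<subseteq> {z \<in> pts D. \<forall>l<D. z l \<in> {m * U l..<m * U l + m}}"
    using cell by blast
  note b = finite_card_pts_box[of D "\<lambda>l. {m * U l..<m * U l + m}", OF finite_atLeastLessThan]
  show "finite {z \<in> pts D. tile m z = U}" by (rule finite_subset[OF sub b(1)])
  show "card {z \<in> pts D. tile m z = U} \<le> m ^ D"
    using card_mono[OF b(1) sub] b(2) by simp
qed

lemma card_boxes:
  "finite (src_box D m a \<union> dst_box D m b)" "card (src_box D m a \<union> dst_box D m b) \<le> 3 ^ D + 2 ^ D"
proof -
  let ?A = "\<lambda>l. {a l div m..a l div m + 2}" and ?B = "\<lambda>l. {b l div m - 1..b l div m}"
  have s: "src_box D m a = {z \<in> pts D. \<forall>l<D. z l \<in> ?A l}" by (auto simp: src_box_def)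
  have t: "dst_box D m b = {z \<in> pts D. \<forall>l<D. z l \<in> ?B l}" by (auto simp: dst_box_def)
  note bA = finite_card_pts_box[of D ?A, OF finite_atLeastAtMost]
  note bB = finite_card_pts_box[of D ?B, OF finite_atLeastAtMost]
  have "card (src_box D m a) \<le> 3 ^ D" using bA(2) unfolding s by simp
  moreover have "card (dst_box D m b) \<le> 2 ^ D"
  proof -
    have "(\<Prod>l<D. card (?B l)) \<le> (\<Prod>l<D. 2)" by (intro prod_mono) auto
    then show ?thesis using bB(2) unfolding t by simp
  qed
  ultimately show "card (src_box D m a \<union> dst_box D m b) \<le> 3 ^ D + 2 ^ D"
    using card_Un_le[of "src_box D m a" "dst_box D m b"] by linarith
  show "finite (src_box D m a \<union> dst_box D m b)" using bA(1) bB(1) by (simp add: s t)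
qed

lemma finite_trail: "finite (trail D m z s t)"
proof -
  have "trail D m z s t = (\<Union>u\<in>{s..t}. {U. near D 2 U (tile m (z u))})"
    by (auto simp: trail_def)
  then show ?thesis by (simp add: finite_card_near)
qed

lemma thick_bound:
  assumes "m > 0" "l < D" "l \<notin> thick D m x y"
  shows "y l \<le> x l + 3 * m"
proof -
  have "y l div m < x l div m + 3" using assms by (simp add: thick_def)
  then have "y l < (x l div m + 3) * m" by (simp add: div_less_iff_less_mult assms(1))
  also have "\<dots> \<le> x l + 3 * m" by (simp add: distrib_right)
  finally show ?thesis by simp
qed

text \<open>The tiles met by a trip, clamped away from the tiles of its end points in the thick
  directions and moved to the final coordinate in the others.\<close>
lemma plan_of_trip:
  assumes tr: "trip D z s t" and pts: "z s \<in> pts D" and T2: "2 \<le> card (thick D m (z s) (z t))"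
    and len: "t - s < p"
  obtains P where "is_plan D m p (z s) (z t) P"
    "P \<union> (src_box D m (z s) \<union> dst_box D m (z t)) \<subseteq> trail D m z s t"
proof -
  define T where "T = thick D m (z s) (z t)"
  have st: "s \<le> t" using tr by (simp add: trip_def)
  have tp: "z t \<in> pts D" using trip_pts[OF tr pts] .
  define cl where "cl y = (\<lambda>l. if l \<in> T then max (z s l div m + 1) (min (y l div m) (z t l div m - 1)) else z t l div m)" for y
  define P where "P = (\<lambda>u. cl (z u)) ` {s..t}"
  have TD: "l < D" "z s l div m + 3 \<le> z t l div m" if "l \<in> T" for l using that by (auto simp: T_def thick_def)
  obtain l0 where l0: "l0 \<in> T" using T2 unfolding T_def by fastforce
  have m: "m > 0" using TD(2)[OF l0] by (cases "m = 0") auto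
  have cl_s: "cl (z s) = tile m (entry D m (z s) (z t))"
    using m TD(2) by (intro ext) (auto simp: cl_def tile_def entry_def T_def[symmetric])
  have cl_t: "cl (z t) = exit_tile D m (z s) (z t)"
    using TD(2) by (intro ext) (fastforce simp: cl_def exit_tile_def T_def[symmetric])
  have cl_le: "cl y l \<le> exit_tile D m (z s) (z t) l" for y l
    using TD(2)[of l] by (auto simp: cl_def exit_tile_def T_def[symmetric])
  \<comment> \<open>Clamping is monotone, and constant in thin directions, so one step of the trip
    moves the clamped tile by at most one step in a thick direction.\<close>
  have cl_step: "cl (inc j y) = cl y \<or> j \<in> T \<and> cl (inc j y) = inc j (cl y)" for j y
  proof (cases "j \<in> T \<and> cl (inc j y) j \<noteq> cl y j")
    case True
    have "Suc (y j) div m = y j div m \<or> Suc (y j) div m = Suc (y j div m)" by (simp add: div_Suc)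
    then have "cl (inc j y) j = Suc (cl y j)" using True by (auto simp: cl_def split: if_splits)
    then have "cl (inc j y) = inc j (cl y)" by (intro ext) (auto simp: inc_apply cl_def)
    then show ?thesis using True by simp
  next
    case False
    then have "cl (inc j y) = cl y" by (intro ext) (auto simp: inc_apply cl_def)
    then show ?thesis by simp
  qed
  have step: "\<exists>j\<in>T. inc j U \<in> P" if U: "U \<in> P" "U \<noteq> exit_tile D m (z s) (z t)" for U
  proof -
    obtain u where u: "s \<le> u" "u \<le> t" "U = cl (z u)" using U(1) by (auto simp: P_def)
    \<comment> \<open>The first moment after \<open>u\<close> at which the clamped tile changes; it
      exists because the trip ends in the exit tile.\<close>
    define v where "v = (LEAST v. u \<le> v \<and> cl (z v) \<noteq> U)"
    have ex: "u \<le> t \<and> cl (z t) \<noteq> U" using u U(2) cl_t by simp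
    have v: "u \<le> v" "cl (z v) \<noteq> U" "v \<le> t"
      using LeastI[of "\<lambda>v. u \<le> v \<and> cl (z v) \<noteq> U", OF ex] Least_le[of "\<lambda>v. u \<le> v \<and> cl (z v) \<noteq> U", OF ex]
      by (auto simp: v_def)
    then have "v \<noteq> u" using u by auto
    then obtain v' where v': "v = Suc v'" "u \<le> v'" using v(1) by (cases v) auto
    have "cl (z v') = U" using not_less_Least[of v' "\<lambda>v. u \<le> v \<and> cl (z v) \<noteq> U"] v' by (auto simp: v_def)
    moreover have "s \<le> v'" "v' < t" using u(1) v' v(3) by simp_all
    then obtain j where "z v = inc j (z v')" using tr unfolding trip_def v'(1) by blast
    ultimately have "j \<in> T \<and> cl (z v) = inc j U" using cl_step[of j "z v'"] v(2) by auto
    moreover have "cl (z v) \<in> P" using v u by (auto simp: P_def)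
    ultimately show ?thesis by auto
  qed
  have "card P \<le> card {s..t}" unfolding P_def by (intro card_image_le) simp
  then have "card P \<le> p" using len st by simp
  moreover have "cl (z s) \<in> P" using st by (auto simp: P_def)
  moreover have "finite P" by (simp add: P_def)
  moreover have "\<forall>U\<in>P. \<forall>l. U l \<le> exit_tile D m (z s) (z t) l" using cl_le by (auto simp: P_def)
  ultimately have plan: "is_plan D m p (z s) (z t) P"
    unfolding is_plan_def T_def[symmetric] using step T2 cl_s by (auto simp: T_def)
  have cl_pts: "cl y \<in> pts D" for y using tp TD(1) by (auto simp: cl_def pts_def dest: leD)
  have zu: "z u \<in> pts D" "z s l \<le> z u l" "z u l \<le> z t l" if "s \<le> u" "u \<le> t" for u l
    using trip_split[OF tr that] trip_pts pts trip_mono by blast+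
  \<comment> \<open>Clamping shifts a thick index by at most one, and in a thin direction the whole
    trip stays within two tiles of its end.\<close>
  have cl_near: "near D 2 (cl (z u)) (tile m (z u))" if u: "s \<le> u" "u \<le> t" for u
  proof -
    have "cl (z u) l \<le> tile m (z u) l + 2 \<and> tile m (z u) l \<le> cl (z u) l + 2" if l: "l < D" for l
    proof -
      have le: "z s l div m \<le> z u l div m" "z u l div m \<le> z t l div m" using zu[OF u] by (auto intro: div_le_mono)
      show ?thesis
      proof (cases "l \<in> T")
        case True
        then show ?thesis using le TD(2)[OF True] by (simp add: cl_def tile_def) linarith
      next
        case False
        then have "z t l div m < z s l div m + 3" using l by (simp add: T_def thick_def)
        then show ?thesis using le False by (simp add: cl_def tile_def)
      qed
    qed
    then show ?thesis using cl_pts tile_pts[OF zu(1)[OF u]] by (simp add: near_def)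
  qed
  have "P \<subseteq> trail D m z s t" using cl_near by (auto simp: P_def trail_def)
  moreover have "src_box D m (z s) \<subseteq> trail D m z s t"
  proof
    fix U assume "U \<in> src_box D m (z s)"
    then have "near D 2 U (tile m (z s))"
      using tile_pts[OF pts, of m] by (auto simp: src_box_def near_def tile_def intro: trans_le_add1)
    then show "U \<in> trail D m z s t" using st by (auto simp: trail_def)
  qed
  moreover have "dst_box D m (z t) \<subseteq> trail D m z s t"
  proof
    fix U assume "U \<in> dst_box D m (z t)"
    then have "near D 2 U (tile m (z t))"
      using tile_pts[OF tp, of m] by (auto simp: dst_box_def near_def tile_def intro: trans_le_add1)
    then show "U \<in> trail D m z s t" using st by (auto simp: trail_def)
  qed
  ultimately show ?thesis using that[OF plan] by blast
qed

lemma sum_double_count: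
  fixes w :: "'u \<Rightarrow> real"
  assumes "finite X" "finite F" "\<And>x. x \<in> X \<Longrightarrow> N x \<subseteq> F" "\<And>u. u \<in> F \<Longrightarrow> card {x \<in> X. u \<in> N x} \<le> k"
    "\<And>u. 0 \<le> w u"
  shows "(\<Sum>x\<in>X. sum w (N x)) \<le> real k * sum w F"
proof -
  have "(\<Sum>x\<in>X. sum w (N x)) = (\<Sum>x\<in>X. \<Sum>u\<in>F. if u \<in> N x then w u else 0)"
  proof (rule sum.cong[OF refl])
    fix x assume "x \<in> X"
    then have "N x = F \<inter> N x" using assms(3) by blast
    then show "sum w (N x) = (\<Sum>u\<in>F. if u \<in> N x then w u else 0)"
      using sum.inter_restrict[OF assms(2), of w "N x"] by metis
  qed
  also have "\<dots> = (\<Sum>u\<in>F. \<Sum>x\<in>X. if u \<in> N x then w u else 0)" by (rule sum.swap)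
  also have "\<dots> = (\<Sum>u\<in>F. real (card {x \<in> X. u \<in> N x}) * w u)"
    by (intro sum.cong refl) (simp add: sum.If_cases[OF assms(1)] Int_def)
  also have "\<dots> \<le> (\<Sum>u\<in>F. real k * w u)"
    using assms(4,5) by (intro sum_mono mult_right_mono) auto
  finally show ?thesis by (simp add: sum_distrib_left)
qed

lemma card_UN_le_mult:
  assumes "finite Y" "\<And>y. y \<in> Y \<Longrightarrow> card (f y) \<le> k" "card Y \<le> n"
  shows "card (\<Union>y\<in>Y. f y) \<le> n * k"
proof -
  have "card (\<Union>y\<in>Y. f y) \<le> (\<Sum>y\<in>Y. card (f y))" using assms(1) by (rule card_UN_le)
  also have "\<dots> \<le> (\<Sum>y\<in>Y. k)" using assms(2) by (intro sum_mono)
  also have "\<dots> \<le> n * k" using assms(3) by simp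
  finally show ?thesis .
qed

section \<open>Charging the routes of an offline schedule\<close>

text \<open>\<open>z i\<close> is the route of packet \<open>i\<close> in a fixed offline schedule, from time \<open>r i\<close> to time \<open>e i\<close>.\<close>
locale routes =
  fixes d m \<Lambda> K N :: nat and X :: "nat set" and r e :: "nat \<Rightarrow> nat" and z :: "nat \<Rightarrow> nat \<Rightarrow> nat \<Rightarrow> nat"
  assumes finX: "finite X" and m: "m > 0"
    and trip: "i \<in> X \<Longrightarrow> trip (Suc d) (z i) (r i) (e i)"
    and start: "i \<in> X \<Longrightarrow> z i (r i) \<in> pts (Suc d)"
    and lev: "i \<in> X \<Longrightarrow> level (Suc d) (z i (r i)) = r i + \<Lambda>"
    and occupancy: "card {i \<in> X. r i \<le> t \<and> t \<le> e i \<and> z i t = x} \<le> 2 * K"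
    and active: "card {i \<in> X. r i \<le> t \<and> t < e i} \<le> N"
begin

abbreviation "D \<equiv> Suc d"

lemma route:
  assumes "i \<in> X" "r i \<le> t" "t \<le> e i"
  shows "z i t \<in> pts D" "level D (z i t) = t + \<Lambda>" "z i (r i) l \<le> z i t l" "z i t l \<le> z i (e i) l"
proof -
  note sp = trip_split[OF trip[OF assms(1)] assms(2,3)]
  show "z i t \<in> pts D" using trip_pts sp start[OF assms(1)] by blast
  show "level D (z i t) = t + \<Lambda>" using trip_level[OF conjunct1[OF sp]] lev[OF assms(1)] by simp
  show "z i (r i) l \<le> z i t l" "z i t l \<le> z i (e i) l" using trip_mono sp by blast+
qed

text \<open>The level of a point fixes the only time at which it can be visited, so the occupancy at
  one moment bounds all visits.\<close>

lemma visits: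
  assumes "finite Y" "card Y \<le> n"
  shows "card {i \<in> X. \<exists>t. r i \<le> t \<and> t \<le> e i \<and> z i t \<in> Y} \<le> n * (2 * K)"
proof -
  have "{i \<in> X. \<exists>t. r i \<le> t \<and> t \<le> e i \<and> z i t \<in> Y} \<subseteq>
      (\<Union>x\<in>Y. {i \<in> X. r i \<le> level D x - \<Lambda> \<and> level D x - \<Lambda> \<le> e i \<and> z i (level D x - \<Lambda>) = x})"
  proof clarify
    fix i t assume "i \<in> X" "r i \<le> t" "t \<le> e i" "z i t \<in> Y"
    moreover have "level D (z i t) - \<Lambda> = t" using route(2) calculation by simp
    ultimately show "i \<in> (\<Union>x\<in>Y. {i \<in> X. r i \<le> level D x - \<Lambda> \<and> level D x - \<Lambda> \<le> e i \<and> z i (level D x - \<Lambda>) = x})"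
      by (intro UN_I[of "z i t"]) simp_all
  qed
  then have "card {i \<in> X. \<exists>t. r i \<le> t \<and> t \<le> e i \<and> z i t \<in> Y} \<le>
      card (\<Union>x\<in>Y. {i \<in> X. r i \<le> level D x - \<Lambda> \<and> level D x - \<Lambda> \<le> e i \<and> z i (level D x - \<Lambda>) = x})"
    using finX assms(1) by (intro card_mono) auto
  also have "\<dots> \<le> n * (2 * K)" by (rule card_UN_le_mult[OF assms(1) occupancy assms(2)])
  finally show ?thesis .
qed

text \<open>There are at most \<open>5 ^ D\<close> tiles within distance 2, each with at most
  \<open>m ^ D\<close> points.\<close>

lemma trail_visits: "card {i \<in> X. U \<in> trail D m (z i) (r i) (e i)} \<le> 5 ^ D * (m ^ D * (2 * K))"
proof -
  let ?N = "{V. near D 2 U V}"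
  have N: "finite ?N" "card ?N \<le> 5 ^ D"
    using finite_card_near[of D 2 U] by (simp_all add: near_commute[of D 2 U])
  have eq: "{i \<in> X. U \<in> trail D m (z i) (r i) (e i)} \<subseteq>
      (\<Union>V\<in>?N. {i \<in> X. \<exists>t. r i \<le> t \<and> t \<le> e i \<and> z i t \<in> {x \<in> pts D. tile m x = V}})"
    using route(1) by (fastforce simp: trail_def)
  have "card {i \<in> X. U \<in> trail D m (z i) (r i) (e i)} \<le>
      card (\<Union>V\<in>?N. {i \<in> X. \<exists>t. r i \<le> t \<and> t \<le> e i \<and> z i t \<in> {x \<in> pts D. tile m x = V}})"
    using finX N(1) by (intro card_mono[OF _ eq]) auto
  also have "\<dots> \<le> 5 ^ D * (m ^ D * (2 * K))"
    by (rule card_UN_le_mult[OF N(1) visits[OF finite_card_cell[OF m]] N(2)])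
  finally show ?thesis .
qed

lemma trail_weight:
  assumes "Y \<subseteq> X" "\<And>U. 0 \<le> w U" "finite F" "\<And>i. i \<in> Y \<Longrightarrow> trail D m (z i) (r i) (e i) \<subseteq> F"
  shows "(\<Sum>i\<in>Y. sum w (trail D m (z i) (r i) (e i))) \<le> real (5 ^ D * (m ^ D * (2 * K))) * sum w F"
proof (rule sum_double_count[OF _ assms(3,4) _ assms(2)])
  show "finite Y" using assms(1) finX finite_subset by blast
  fix U
  have "card {i \<in> Y. U \<in> trail D m (z i) (r i) (e i)} \<le> card {i \<in> X. U \<in> trail D m (z i) (r i) (e i)}"
    using assms(1) finX by (intro card_mono) auto
  then show "card {i \<in> Y. U \<in> trail D m (z i) (r i) (e i)} \<le> 5 ^ D * (m ^ D * (2 * K))"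
    using trail_visits[of U] by linarith
qed auto

text \<open>Packets with at most one thick spatial direction are charged to the packet that survives
  at the end of their elimination chain.\<close>
lemma line_bound:
  assumes "Y \<subseteq> X" "finite L"
    and ch: "\<And>i. i \<in> Y \<Longrightarrow> \<exists>x\<in>L. y x \<in> pts D \<and> j i < d \<and> (\<forall>l<D. z i (r i) l \<le> y x l \<and>
        (if l = j i then y x l \<le> z i (e i) l + R else y x l \<le> z i (r i) l + R))"
    and thin: "\<And>i. i \<in> Y \<Longrightarrow> thick D m (z i (r i)) (z i (e i)) \<subseteq> {j i} \<or>
        j i \<notin> thick D m (z i (r i)) (z i (e i))"
  shows "card Y \<le> card L * ((2 * (R + 3 * m) + 1) ^ D * (2 * K))"
proof -
  let ?k = "R + 3 * m"
  let ?V = "\<lambda>x. {i \<in> X. \<exists>t. r i \<le> t \<and> t \<le> e i \<and> z i t \<in> {p. near D ?k p (y x)}}"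
  have "Y \<subseteq> (\<Union>x\<in>L. ?V x)"
  proof
    fix i assume i: "i \<in> Y"
    then have iX: "i \<in> X" using assms(1) by blast
    obtain x where x: "x \<in> L" "y x \<in> pts D" "j i < d" "\<And>l. l < D \<Longrightarrow> z i (r i) l \<le> y x l"
      "\<And>l. l < D \<Longrightarrow> l \<noteq> j i \<Longrightarrow> y x l \<le> z i (r i) l + R" "y x (j i) \<le> z i (e i) (j i) + R"
      using ch[OF i] by (metis less_Suc_eq)
    have re: "r i \<le> e i" using trip[OF iX] by (simp add: trip_def)
    have "\<exists>t. r i \<le> t \<and> t \<le> e i \<and> near D ?k (z i t) (y x)"
    \<comment> \<open>If the route is thin along \<open>j i\<close>, then \<open>y x\<close> lies
      near its start, even when the packet waits for long. If not, all other directions, waiting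
      included, are thin and the route passes close to \<open>y x\<close>.\<close>
    proof (cases "j i \<in> thick D m (z i (r i)) (z i (e i))")
      case False
      have "y x l \<le> z i (r i) l + ?k" if l: "l < D" for l
      proof (cases "l = j i")
        case True
        then show ?thesis using x(6) thick_bound[OF m l, of "z i (r i)" "z i (e i)"] False by simp
      qed (use x(5)[OF l] in simp)
      moreover have "z i (r i) l \<le> y x l + ?k" if l: "l < D" for l using x(4)[OF l] by simp
      ultimately have "near D ?k (z i (r i)) (y x)"
        unfolding near_def using x(2) start[OF iX] by blast
      then show ?thesis using re by blast
    next
      case True
      then have th: "thick D m (z i (r i)) (z i (e i)) \<subseteq> {j i}" using thin[OF i] by blast
      \<comment> \<open>The route reaches the coordinate of \<open>y x\<close> unless this lies
        beyond its end, and then by at most \<open>R\<close>.\<close>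
      define c where "c = min (y x (j i)) (z i (e i) (j i))"
      obtain t where t: "r i \<le> t" "t \<le> e i" "z i t (j i) = c"
        using trip_visits[OF trip[OF iX], of "j i" c] x(3,4) route(4)[OF iX order_refl re, of "j i"]
        by (auto simp: c_def)
      note rt = route[OF iX t(1,2)]
      have "z i t l \<le> y x l + ?k \<and> y x l \<le> z i t l + ?k" if l: "l < D" for l
      proof (cases "l = j i")
        case True
        then show ?thesis using t(3) x(6) by (auto simp: c_def min_def)
      next
        case False
        then have "l \<notin> thick D m (z i (r i)) (z i (e i))" using th by blast
        then show ?thesis using thick_bound[OF m l] x(4)[OF l] x(5)[OF l False] rt(3,4)[of l] by fastforce
      qed
      then show ?thesis using t x(2) rt(1) by (auto simp: near_def)
    qed
    then show "i \<in> (\<Union>x\<in>L. ?V x)" using x(1) iX by blast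
  qed
  then have "card Y \<le> card (\<Union>x\<in>L. ?V x)" using finX assms(2) by (intro card_mono) auto
  also have "\<dots> \<le> card L * ((2 * ?k + 1) ^ D * (2 * K))"
    by (rule card_UN_le_mult[OF assms(2) visits[OF finite_card_near] order_refl])
  finally show ?thesis .
qed

text \<open>A packet that is under way for at least \<open>2W\<close> steps pays on average over the routes that follow
  its own route up to some time \<open>s\<close> and then go straight to the destination without waiting.
  As the starting times are spread out, few of these direct parts meet a given tile.\<close>
lemma transit_bound:
  assumes w: "\<And>U. 0 \<le> w U" and Y: "Y \<subseteq> X"
    and W: "(D * m + \<Lambda>) * N \<le> W" "\<Lambda> + 3 * m \<le> W" and p: "2 * W + \<Lambda> < p"
    and dst: "\<And>i. i \<in> Y \<Longrightarrow> (\<Sum>l<d. z i (e i) l) \<le> \<Lambda>"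
    and T2: "\<And>i. i \<in> Y \<Longrightarrow> 2 \<le> card (thick D m (z i (r i)) (z i (e i)))"
    and pay: "\<And>i u t. i \<in> Y \<Longrightarrow> u (r i) = z i (r i) \<Longrightarrow> trip D u (r i) t \<Longrightarrow> t \<le> e i \<Longrightarrow>
      (\<And>l. l < d \<Longrightarrow> u t l = z i (e i) l) \<Longrightarrow> t - r i < p \<Longrightarrow>
      2 \<le> card (thick D m (u (r i)) (u t)) \<Longrightarrow> 1 \<le> sum w (trail D m u (r i) t)"
  shows "\<exists>F. finite F \<and> real (card Y) \<le> real (5 ^ D * (m ^ D * (2 * K) + 1)) * sum w F"
proof -
  have finY: "finite Y" using Y finX finite_subset by blast
  have D_m: "D * m > 0" using m by simp
  have W0: "W > 0" using W(2) m by simp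
  let ?N = "\<lambda>i. trail D m (z i) (r i) (e i)"
  define L where "L = {i \<in> Y. r i + 2 * W \<le> e i}"
  \<comment> \<open>Departing no earlier than \<open>W\<close> steps after release makes the waiting
    direction thick; departing before \<open>2 * W\<close> keeps the shortcut shorter than
    \<open>p\<close>.\<close>
  define A where "A = (SIGMA i:L. {r i + W..<r i + 2 * W})"
  \<comment> \<open>The goal of the shortcut: the destination, with the waiting coordinate frozen at
    time \<open>s\<close>.\<close>
  define c where "c i s = (\<lambda>l. if l < d then z i (e i) l else if l = d then z i s d else 0)" for i s
  define t where "t i s = s + (level D (c i s) - level D (z i s))" for i s
  have L: "i \<in> X" "i \<in> Y" "r i + 2 * W \<le> e i" if "i \<in> L" for i using that Y by (auto simp: L_def)
  have c_pts: "c i s \<in> pts D" for i s by (auto simp: c_def pts_def)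
  have z_le_c: "z i s l \<le> c i s l" if "i \<in> X" "r i \<le> s" "s \<le> e i" for i s l
    using route(1)[OF that] route(4)[OF that, of l] by (cases "D \<le> l") (auto simp: c_def pts_def not_le less_Suc_eq)
  have "\<exists>u. trip D u s (t i s) \<and> u s = z i s \<and> u (t i s) = c i s" if "i \<in> X" "r i \<le> s" "s \<le> e i" for i s
    unfolding t_def using trip_exists[OF route(1)[OF that] c_pts z_le_c[OF that]] .
  then obtain u where u: "\<And>i s. i \<in> X \<Longrightarrow> r i \<le> s \<Longrightarrow> s \<le> e i \<Longrightarrow>
      trip D (u i s) s (t i s) \<and> u i s s = z i s \<and> u i s (t i s) = c i s" by metis
  have t_le: "t i s \<le> s + \<Lambda>" if "i \<in> Y" for i s
  proof -
    have "level D (c i s) = (\<Sum>l<d. z i (e i) l) + z i s d"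
      unfolding level_def by (simp add: c_def)
    moreover have "z i s d \<le> level D (z i s)" unfolding level_def by simp
    ultimately show ?thesis using dst[OF that] by (simp add: t_def)
  qed
  have t_le_e: "t i s \<le> e i" if "i \<in> X" "r i \<le> s" "s \<le> e i" for i s
  proof -
    have "level D (c i s) \<le> level D (z i (e i))"
      using route(4)[OF that] by (intro level_mono) (auto simp: c_def less_Suc_eq)
    then show ?thesis using route(2)[OF that] route(2)[of i "e i"] that by (simp add: t_def)
  qed
  let ?M = "\<lambda>(i, s). trail D m (u i s) s (t i s)"
  define F where "F = (\<Union>i\<in>Y. ?N i) \<union> (\<Union>a\<in>A. ?M a)"
  have finA: "finite A" unfolding A_def L_def using finY by auto
  have finF: "finite F" unfolding F_def using finY finA finite_trail by auto
  have short: "1 \<le> sum w (?N i)" if i: "i \<in> Y - L" for i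
    using pay[of i "z i" "e i"] trip[of i] T2[of i] i Y p by (auto simp: L_def)
  have long: "1 \<le> sum w (?N i) + sum w (?M (i, s))" if a: "(i, s) \<in> A" for i s
  proof -
    have i: "i \<in> X" "i \<in> Y" "r i + W \<le> s" "s < r i + 2 * W" "r i + 2 * W \<le> e i" "r i \<le> s" "s \<le> e i"
    proof -
      have "i \<in> L" "r i + W \<le> s" "s < r i + 2 * W" using a by (auto simp: A_def)
      then show "i \<in> X" "i \<in> Y" "r i + W \<le> s" "s < r i + 2 * W" "r i + 2 * W \<le> e i" "r i \<le> s" "s \<le> e i"
        using L[of i] by linarith+
    qed
    note us = u[OF i(1,6,7)]
    define v where "v = (\<lambda>\<tau>. if \<tau> \<le> s then z i \<tau> else u i s \<tau>)"
    have st: "s \<le> t i s" by (simp add: t_def)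
    have vt: "v (t i s) = c i s" using us st by (cases "t i s = s") (auto simp: v_def)
    have vr: "v (r i) = z i (r i)" using i by (simp add: v_def)
    have tr: "trip D v (r i) (t i s)"
      unfolding trip_def
    proof (intro conjI allI impI)
      show "r i \<le> t i s" using i st by simp
      fix \<tau> assume \<tau>: "r i \<le> \<tau>" "\<tau> < t i s"
      show "\<exists>j<D. v (Suc \<tau>) = inc j (v \<tau>)"
      proof (cases "\<tau> < s")
        case True
        then show ?thesis using trip[OF i(1)] \<tau> i by (auto simp: trip_def v_def)
      next
        case False
        then have "\<exists>j<D. u i s (Suc \<tau>) = inc j (u i s \<tau>)" using us \<tau> by (auto simp: trip_def)
        then show ?thesis using False us by (cases "\<tau> = s") (auto simp: v_def)
      qed
    qed
    have thick: "2 \<le> card (thick D m (v (r i)) (v (t i s)))"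
    proof -
      let ?T = "thick D m (z i (r i)) (z i (e i))" and ?T' = "thick D m (z i (r i)) (c i s)"
      \<comment> \<open>The full route has a thick direction other than waiting; the shortcut
        inherits it because both end at the same node.\<close>
      have "?T \<noteq> {d}" using T2[OF i(2)] by auto
      moreover have "?T \<noteq> {}" using T2[OF i(2)] by auto
      ultimately obtain l where l: "l \<in> ?T" "l \<noteq> d" by blast
      then have "l < d" by (auto simp: thick_def)
      then have "l \<in> ?T'" using l by (auto simp: thick_def c_def)
      \<comment> \<open>By time \<open>s\<close> at least \<open>W\<close> steps have been made, of
        which at most \<Lambda> are hops. The remaining \<open>3 * m\<close> or more are waiting
        steps and cross three boundaries.\<close>
      moreover have "d \<in> ?T'"
      proof -
        have "(\<Sum>l<d. z i s l) \<le> (\<Sum>l<d. z i (e i) l)" using route(4)[OF i(1,6,7)] by (intro sum_mono)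
        then have "(\<Sum>l<d. z i s l) \<le> \<Lambda>" using dst[OF i(2)] by simp
        moreover have "(\<Sum>l<d. z i s l) + z i s d = s + \<Lambda>" using route(2)[OF i(1,6,7)] by (simp add: level_def)
        moreover have "(\<Sum>l<d. z i (r i) l) + z i (r i) d = r i + \<Lambda>" using lev[OF i(1)] by (simp add: level_def)
        ultimately have "z i (r i) d + 3 * m \<le> z i s d" using i(3) W(2) by linarith
        then have "(z i (r i) d + 3 * m) div m \<le> z i s d div m" by (rule div_le_mono)
        then show ?thesis using m by (simp add: thick_def c_def)
      qed
      ultimately have "{l, d} \<subseteq> ?T'" by simp
      then have "card {l, d} \<le> card ?T'" by (intro card_mono) auto
      then show ?thesis using l(2) vr vt by simp
    qed
    have "t i s - r i < p" using t_le[OF i(2), of s] i(4) p by simp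
    then have "1 \<le> sum w (trail D m v (r i) (t i s))"
      using pay[OF i(2) vr tr t_le_e[OF i(1,6,7)]] thick vt by (auto simp: c_def)
    also have "trail D m v (r i) (t i s) \<subseteq> ?N i \<union> ?M (i, s)"
    proof
      fix U assume "U \<in> trail D m v (r i) (t i s)"
      then obtain \<tau> where \<tau>: "r i \<le> \<tau>" "\<tau> \<le> t i s" "near D 2 U (tile m (v \<tau>))" by (auto simp: trail_def)
      show "U \<in> ?N i \<union> ?M (i, s)"
      proof (cases "\<tau> \<le> s")
        case True
        then have "U \<in> ?N i" using \<tau> i by (auto simp: trail_def v_def intro!: exI[of _ \<tau>])
        then show ?thesis by simp
      next
        case False
        then have "U \<in> ?M (i, s)" using \<tau> by (auto simp: trail_def v_def intro!: exI[of _ \<tau>])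
        then show ?thesis by simp
      qed
    qed
    then have "sum w (trail D m v (r i) (t i s)) \<le> sum w (?N i \<union> ?M (i, s))"
      using w finite_trail by (intro sum_mono2) auto
    also have "\<dots> \<le> sum w (?N i) + sum w (?M (i, s))"
      using w finite_trail by (simp add: sum_Un sum_nonneg)
    finally show ?thesis .
  qed
  have meet: "card {a \<in> A. U \<in> ?M a} \<le> 5 ^ D * W" for U
  proof -
    let ?B = "{V. near D 2 U V}"
    have B: "finite ?B" "card ?B \<le> 5 ^ D"
      using finite_card_near[of D 2 U] by (simp_all add: near_commute[of D 2 U])
    have cell: "card {a \<in> A. \<exists>\<tau>. snd a \<le> \<tau> \<and> \<tau> \<le> t (fst a) (snd a) \<and> tile m (u (fst a) (snd a) \<tau>) = V} \<le> W" for V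
    proof -
      let ?C = "{a \<in> A. \<exists>\<tau>. snd a \<le> \<tau> \<and> \<tau> \<le> t (fst a) (snd a) \<and> tile m (u (fst a) (snd a) \<tau>) = V}"
      let ?q = "m * level D V"
      \<comment> \<open>The direct part meets the tile at some time between \<open>s\<close> and
        \<open>s + \<Lambda>\<close>, and levels within a tile differ by less than
        \<open>D * m\<close>; so \<open>s\<close> lies in a window of length
        \<open>D * m + \<Lambda>\<close>.\<close>
      let ?S = "{s. ?q \<le> s + 2 * \<Lambda> \<and> s + \<Lambda> < ?q + D * m}"
      have S: "finite ?S" "card ?S \<le> D * m + \<Lambda>"
      proof -
        have sub: "?S \<subseteq> {?q - 2 * \<Lambda>..<?q + D * m - \<Lambda>}" by auto
        show "finite ?S" by (rule finite_subset[OF sub]) simp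
        have "card ?S \<le> ?q + D * m - \<Lambda> - (?q - 2 * \<Lambda>)" using card_mono[OF _ sub] by simp
        then show "card ?S \<le> D * m + \<Lambda>" by linarith
      qed
      have "?C \<subseteq> (\<Union>s\<in>?S. (\<lambda>i. (i, s)) ` {i \<in> X. r i \<le> s \<and> s < e i})"
      proof
        fix a' assume "a' \<in> ?C"
        then obtain i s \<tau> where a: "a' = (i, s)" "(i, s) \<in> A" and \<tau>: "s \<le> \<tau>" "\<tau> \<le> t i s"
          and V: "V = tile m (u i s \<tau>)" by (cases a') auto
        have "i \<in> L" "r i + W \<le> s" "s < r i + 2 * W" using a by (auto simp: A_def)
        then have i: "i \<in> X" "i \<in> Y" "r i \<le> s" "s < e i" using L[of i] by linarith+
        have us: "trip D (u i s) s (t i s)" "u i s s = z i s" using u[OF i(1,3)] i(4) by auto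
        define x where "x = u i s \<tau>"
        have "level D x + s = level D (z i s) + \<tau>"
          using trip_level[of D "u i s" s \<tau>] trip_split[OF us(1), of \<tau>] \<tau> us(2) by (simp add: x_def)
        then have lx: "level D x = \<tau> + \<Lambda>" using route(2)[OF i(1,3)] i(4) by simp
        have Vl: "V l = x l div m" for l using V by (simp add: tile_def x_def)
        have mq: "?q = (\<Sum>l<D. m * V l)" unfolding level_def by (rule sum_distrib_left)
        also have "\<dots> \<le> level D x" unfolding level_def Vl by (intro sum_mono) simp
        finally have 1: "?q \<le> \<tau> + \<Lambda>" using lx by simp
        have "level D x < (\<Sum>l<D. m * V l + m)"
          unfolding level_def Vl using dividend_less_times_div[OF m]
          by (intro sum_strict_mono) (auto simp: add.commute)
        also have "\<dots> = ?q + D * m" unfolding mq sum.distrib by simp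
        finally have 2: "\<tau> + \<Lambda> < ?q + D * m" using lx by simp
        have "s \<in> ?S" using 1 2 \<tau> t_le[OF i(2), of s] by simp
        then show "a' \<in> (\<Union>s\<in>?S. (\<lambda>i. (i, s)) ` {i \<in> X. r i \<le> s \<and> s < e i})" using i a(1) by blast
      qed
      then have "card ?C \<le> card (\<Union>s\<in>?S. (\<lambda>i. (i, s)) ` {i \<in> X. r i \<le> s \<and> s < e i})"
        using S(1) finX by (intro card_mono) auto
      also have "\<dots> \<le> (D * m + \<Lambda>) * N"
      proof (rule card_UN_le_mult[OF S(1) _ S(2)])
        fix s show "card ((\<lambda>i. (i, s)) ` {i \<in> X. r i \<le> s \<and> s < e i}) \<le> N"
          using card_image_le[of "{i \<in> X. r i \<le> s \<and> s < e i}" "\<lambda>i. (i, s)"] active[of s] finX by simp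
      qed
      finally show ?thesis using W(1) by simp
    qed
    have "{a \<in> A. U \<in> ?M a} \<subseteq>
      (\<Union>V\<in>?B. {a \<in> A. \<exists>\<tau>. snd a \<le> \<tau> \<and> \<tau> \<le> t (fst a) (snd a) \<and> tile m (u (fst a) (snd a) \<tau>) = V})"
      by (fastforce simp: trail_def)
    then have "card {a \<in> A. U \<in> ?M a} \<le>
      card (\<Union>V\<in>?B. {a \<in> A. \<exists>\<tau>. snd a \<le> \<tau> \<and> \<tau> \<le> t (fst a) (snd a) \<and> tile m (u (fst a) (snd a) \<tau>) = V})"
      using B(1) finA by (intro card_mono) auto
    also have "\<dots> \<le> 5 ^ D * W" by (rule card_UN_le_mult[OF B(1) cell B(2)])
    finally show ?thesis .
  qed
  have finL: "finite L" using finY by (simp add: L_def)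
  have sumM: "(\<Sum>a\<in>A. sum w (?M a)) \<le> real (5 ^ D * W) * sum w F"
    using finA finF meet w by (intro sum_double_count) (auto simp: F_def)
  \<comment> \<open>Summed over the \<open>W\<close> departures, the own trail is counted
    \<open>W\<close> times, while the direct parts meet each tile at most \<open>5 ^ D * W\<close>
    times; dividing by \<open>W\<close> leaves a constant share for them.\<close>
  have "W * card L = (\<Sum>i\<in>L. \<Sum>s\<in>{r i + W..<r i + 2 * W}. 1)" by simp
  then have "real W * card L = (\<Sum>i\<in>L. \<Sum>s\<in>{r i + W..<r i + 2 * W}. (1::real))" by simp
  also have "\<dots> \<le> (\<Sum>i\<in>L. \<Sum>s\<in>{r i + W..<r i + 2 * W}. sum w (?N i) + sum w (?M (i, s)))"
    by (intro sum_mono long) (auto simp: A_def)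
  also have "\<dots> = W * (\<Sum>i\<in>L. sum w (?N i)) + (\<Sum>i\<in>L. \<Sum>s\<in>{r i + W..<r i + 2 * W}. sum w (?M (i, s)))"
    by (simp add: sum.distrib sum_distrib_left)
  also have "(\<Sum>i\<in>L. \<Sum>s\<in>{r i + W..<r i + 2 * W}. sum w (?M (i, s))) = (\<Sum>a\<in>A. sum w (?M a))"
    unfolding A_def using finL by (subst sum.Sigma) (auto simp: split_def)
  finally have "real W * card L \<le> W * (\<Sum>i\<in>L. sum w (?N i)) + real W * (5 ^ D * sum w F)"
    using sumM by (simp add: mult_ac)
  then have "real W * card L \<le> real W * ((\<Sum>i\<in>L. sum w (?N i)) + 5 ^ D * sum w F)" by (simp add: distrib_left)
  then have cL: "real (card L) \<le> (\<Sum>i\<in>L. sum w (?N i)) + 5 ^ D * sum w F" using W0 by simp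
  have "real (card (Y - L)) = (\<Sum>i\<in>Y - L. 1)" by simp
  also have "\<dots> \<le> (\<Sum>i\<in>Y - L. sum w (?N i))" by (intro sum_mono short)
  finally have cS: "real (card (Y - L)) \<le> (\<Sum>i\<in>Y - L. sum w (?N i))" .
  have LY: "L \<subseteq> Y" by (auto simp: L_def)
  have "real (card Y) = card L + card (Y - L)"
    using card_Diff_subset[OF finL LY] card_mono[OF finY LY] by simp
  also have "\<dots> \<le> (\<Sum>i\<in>Y. sum w (?N i)) + 5 ^ D * sum w F"
    using cL cS sum.subset_diff[OF LY finY, of "\<lambda>i. sum w (?N i)"] by simp
  also have "(\<Sum>i\<in>Y. sum w (?N i)) \<le> real (5 ^ D * (m ^ D * (2 * K))) * sum w F"
    by (rule trail_weight[OF Y w finF]) (auto simp: F_def)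
  finally have "real (card Y) \<le> real (5 ^ D * (m ^ D * (2 * K))) * sum w F + 5 ^ D * sum w F" by simp
  also have "\<dots> = real (5 ^ D * (m ^ D * (2 * K) + 1)) * sum w F" by (simp add: algebra_simps)
  finally show ?thesis using finF by blast
qed

end

section \<open>Space-time of the grid\<close>

lemma filter_takeWhile_sorted:
  "sorted (map f xs) \<Longrightarrow> filter (\<lambda>x. f x \<le> T) xs = takeWhile (\<lambda>x. f x \<le> (T::nat)) xs"
proof (induction xs)
  case (Cons x xs)
  show ?case
  proof (cases "f x \<le> T")
    case False
    then have "\<forall>y\<in>set xs. \<not> f y \<le> T" using Cons.prems by force
    then show ?thesis using False by (simp add: filter_empty_conv)
  qed (use Cons in simp)
qed simp

text \<open>As release times are sorted, the revealed requests form a prefix, so indices agree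
  between inputs with the same revealed part.\<close>

lemma nth_le_sorted:
  assumes "sorted (map f xs)"
  shows "i < length xs \<and> f (xs ! i) \<le> (T::nat) \<longleftrightarrow> i < length (filter (\<lambda>x. f x \<le> T) xs)"
proof
  assume i: "i < length xs \<and> f (xs ! i) \<le> T"
  have "f (xs ! k) \<le> T" if "k \<le> i" for k
    using sorted_nth_mono[OF assms, of k i] i that by simp
  then have "i < length (takeWhile (\<lambda>x. f x \<le> T) xs)"
    using i by (metis length_takeWhile_less_P_nth Suc_leI le_neq_implies_less length_takeWhile_le less_Suc_eq_le nth_length_takeWhile leI)
  then show "i < length (filter (\<lambda>x. f x \<le> T) xs)" by (simp add: filter_takeWhile_sorted[OF assms])
next
  assume "i < length (filter (\<lambda>x. f x \<le> T) xs)"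
  then have i: "i < length (takeWhile (\<lambda>x. f x \<le> T) xs)" by (simp add: filter_takeWhile_sorted[OF assms])
  have "xs ! i \<in> set (takeWhile (\<lambda>x. f x \<le> T) xs)" using nth_mem[OF i] takeWhile_nth[OF i] by simp
  then show "i < length xs \<and> f (xs ! i) \<le> T"
    using i length_takeWhile_le[of "\<lambda>x. f x \<le> T" xs] by (auto dest: set_takeWhileD)
qed

lemma filter_nth_sorted:
  assumes "sorted (map f xs)" "i < length (filter (\<lambda>x. f x \<le> (T::nat)) xs)"
  shows "filter (\<lambda>x. f x \<le> T) xs ! i = xs ! i"
  using assms by (simp add: filter_takeWhile_sorted takeWhile_nth)

locale grid =
  fixes l :: "nat list"
begin

abbreviation "d \<equiv> length l"
abbreviation "D \<equiv> Suc (length l)"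
abbreviation "\<Lambda> \<equiv> sum_list l"
abbreviation "V \<equiv> grid_vertices l"
abbreviation "E \<equiv> grid_edges l"

text \<open>Space-time in sheared coordinates: a hop and a time step spent in a buffer both increase
  exactly one coordinate. The summand \<open>\<Lambda>\<close> keeps the last coordinate nonnegative.\<close>
definition point :: "nat list \<Rightarrow> nat \<Rightarrow> nat \<Rightarrow> nat" where
  "point v t = (\<lambda>j. if j < d then v ! j else if j = d then t + \<Lambda> - sum_list v else 0)"

definition node :: "(nat \<Rightarrow> nat) \<Rightarrow> nat list" where
  "node z = map z [0..<d]"

lemma V_D: "v \<in> V \<Longrightarrow> length v = d" "v \<in> V \<Longrightarrow> j < d \<Longrightarrow> v ! j < l ! j"
  by (auto simp: grid_vertices_def)

lemma sum_le: "length v = d \<Longrightarrow> (\<And>j. j < d \<Longrightarrow> v ! j \<le> l ! j) \<Longrightarrow> sum_list v \<le> \<Lambda>"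
  unfolding sum_list_sum_nth by (auto intro: sum_mono)

lemma V_sum: "v \<in> V \<Longrightarrow> sum_list v \<le> \<Lambda>"
  using V_D by (intro sum_le) (auto intro: less_imp_le)

lemma point_pts: "point v t \<in> pts D"
  by (auto simp: point_def pts_def)

lemma sum_point: "length v = d \<Longrightarrow> (\<Sum>j<d. point v t j) = sum_list v"
  unfolding sum_list_sum_nth by (auto simp: point_def atLeast0LessThan)

lemma level_point: "v \<in> V \<Longrightarrow> level D (point v t) = t + \<Lambda>"
  using V_sum[of v] sum_point[OF V_D(1), of v t] by (simp add: level_def) (simp add: point_def)

lemma node_point: "length v = d \<Longrightarrow> node (point v t) = v"
  by (intro nth_equalityI) (auto simp: node_def point_def)

lemma point_node:
  assumes "z \<in> pts D" "level D z = t + \<Lambda>"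
  shows "point (node z) t = z"
proof (rule pts_eqI[OF point_pts assms(1)])
  fix j assume "j < D"
  have "sum_list (node z) = (\<Sum>j<d. z j)"
    by (simp add: node_def sum_list_sum_nth atLeast0LessThan)
  then show "point (node z) t j = z j"
    using assms(2) \<open>j < D\<close> by (auto simp: point_def level_def node_def less_Suc_eq)
qed

lemma edge_D: "(v, w) \<in> E \<Longrightarrow> \<exists>j<d. w = v[j := Suc (v ! j)] \<and> v \<in> V \<and> w \<in> V"
  unfolding grid_edges_def by (auto simp: grid_vertices_def nth_list_update)

lemma point_stay: "v \<in> V \<Longrightarrow> point v (Suc t) = inc d (point v t)"
  using V_sum[of v] by (intro ext) (auto simp: point_def inc_apply)

lemma point_edge:
  assumes "v \<in> V" "j < d"
  shows "point (v[j := Suc (v ! j)]) (Suc t) = inc j (point v t)"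
proof (rule ext)
  fix k
  have "sum_list (v[j := Suc (v ! j)]) = Suc (sum_list v)"
    using assms V_D(1)[OF assms(1)] elem_le_sum_list[of j v] by (simp add: sum_list_update)
  then show "point (v[j := Suc (v ! j)]) (Suc t) k = inc j (point v t) k"
    using assms V_D(1)[OF assms(1)] by (auto simp: point_def inc_apply nth_list_update)
qed

lemma node_inc:
  assumes "node z \<in> V" "e < D" "\<And>j. j < d \<Longrightarrow> inc e z j < l ! j"
  shows "node (inc e z) = node z \<or> (node z, node (inc e z)) \<in> E"
proof (cases "e = d")
  case True
  then show ?thesis by (auto simp: node_def)
next
  case False
  then have e: "e < d" using assms(2) by simp
  have "node (inc e z) = (node z)[e := Suc (node z ! e)]"
    using e by (intro nth_equalityI) (auto simp: node_def inc_apply nth_list_update)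
  moreover have "Suc (node z ! e) < l ! e" using assms(3)[OF e] e by (simp add: node_def)
  ultimately show ?thesis using assms(1) e unfolding grid_edges_def by blast
qed

lemma finite_V: "finite V" and card_V: "card V \<le> prod_list l"
proof -
  let ?f = "\<lambda>v. restrict ((!) v) {..<d}"
  have inj: "inj_on ?f V"
  proof (rule inj_onI)
    fix v w assume vw: "v \<in> V" "w \<in> V" "?f v = ?f w"
    have "v ! j = w ! j" if "j < d" for j using fun_cong[OF vw(3), of j] that by simp
    then show "v = w" using V_D(1) vw by (intro nth_equalityI) auto
  qed
  have im: "?f ` V \<subseteq> PiE {..<d} (\<lambda>j. {..<l ! j})"
    using V_D(2) by (simp add: image_subset_iff restrict_PiE_iff)
  have fin: "finite (PiE {..<d} (\<lambda>j. {..<l ! j}))" by (intro finite_PiE) auto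
  show "finite V" using finite_imageD[OF finite_subset[OF im fin] inj] .
  have "card V \<le> card (PiE {..<d} (\<lambda>j. {..<l ! j}))"
    using card_image[OF inj] card_mono[OF fin im] by simp
  also have "\<dots> = prod_list l" by (simp add: card_PiE prod.list_conv_set_nth atLeast0LessThan)
  finally show "card V \<le> prod_list l" .
qed

end

locale offline = grid +
  fixes B c :: nat and \<sigma> :: "nat list request list" and S :: "nat list schedule"
  assumes feas: "feasible_schedule E c B \<sigma> S" and valid: "\<And>q. q \<in> set \<sigma> \<Longrightarrow> grid_request l q"
begin

abbreviation "K \<equiv> B + d * c"

section \<open>Traffic through a node in the offline schedule\<close>

lemma before: "i < length \<sigma> \<Longrightarrow> t < rtime (\<sigma> ! i) \<Longrightarrow> S i t = None"
  using feas unfolding feasible_schedule_def by blast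

lemma start: "i < length \<sigma> \<Longrightarrow> S i (rtime (\<sigma> ! i)) = Some (src (\<sigma> ! i))"
  using feas unfolding feasible_schedule_def by blast

lemma hop: "i < length \<sigma> \<Longrightarrow> rtime (\<sigma> ! i) \<le> t \<Longrightarrow> S i (Suc t) = Some w \<Longrightarrow>
    \<exists>v. S i t = Some v \<and> v \<noteq> dst (\<sigma> ! i) \<and> (w = v \<or> (v, w) \<in> E)"
  using feas unfolding feasible_schedule_def by blast

lemma capacities:
  "card {i. i < length \<sigma> \<and> S i t = Some v \<and> S i (Suc t) = Some w} \<le> (if v = w then B else c)"
  using feas unfolding feasible_schedule_def by simp

lemma present:
  assumes "i < length \<sigma>" "rtime (\<sigma> ! i) \<le> s" "s \<le> t" "S i t \<noteq> None"
  shows "\<exists>v\<in>V. S i s = Some v"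
proof -
  have "S i s \<noteq> None" using assms(3,4)
  proof (induction rule: inc_induct)
    case (step n)
    then show ?case using hop[of i n] assms(1,2) by (metis le_trans not_None_eq)
  qed
  moreover have "rtime (\<sigma> ! i) \<le> s \<Longrightarrow> S i s = Some v \<Longrightarrow> v \<in> V" for v
  proof (induction s arbitrary: v rule: dec_induct)
    case base
    then show ?case using start[OF assms(1)] valid assms(1) by (auto simp: grid_request_def)
  next
    case (step n)
    then show ?case using hop[OF assms(1) step(1,4)] edge_D by metis
  qed
  ultimately show ?thesis using assms(2) by auto
qed

lemma card_out: "card {i. i < length \<sigma> \<and> rtime (\<sigma> ! i) \<le> t \<and> S i t = Some v \<and> S i (Suc t) \<noteq> None} \<le> K"
proof -
  let ?A = "\<lambda>w. {i. i < length \<sigma> \<and> S i t = Some v \<and> S i (Suc t) = Some w}"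
  \<comment> \<open>The condition on \<open>j\<close> matters for a list \<open>v\<close> that is
    too short: there the update returns \<open>v\<close> itself, whose capacity is that of the
    buffer.\<close>
  have "{i. i < length \<sigma> \<and> rtime (\<sigma> ! i) \<le> t \<and> S i t = Some v \<and> S i (Suc t) \<noteq> None} \<subseteq>
      ?A v \<union> (\<Union>j\<in>{j. j < d \<and> v[j := Suc (v ! j)] \<noteq> v}. ?A (v[j := Suc (v ! j)]))"
  proof
    fix i assume i: "i \<in> {i. i < length \<sigma> \<and> rtime (\<sigma> ! i) \<le> t \<and> S i t = Some v \<and> S i (Suc t) \<noteq> None}"
    then obtain w where w: "S i (Suc t) = Some w" by auto
    then have "w = v \<or> (v, w) \<in> E" using hop[of i t w] i by auto
    then consider "w = v" | j where "j < d" "w = v[j := Suc (v ! j)]" "w \<noteq> v" using edge_D by metis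
    then show "i \<in> ?A v \<union> (\<Union>j\<in>{j. j < d \<and> v[j := Suc (v ! j)] \<noteq> v}. ?A (v[j := Suc (v ! j)]))"
      using i w by cases auto
  qed
  then have "card {i. i < length \<sigma> \<and> rtime (\<sigma> ! i) \<le> t \<and> S i t = Some v \<and> S i (Suc t) \<noteq> None} \<le>
      card (?A v \<union> (\<Union>j\<in>{j. j < d \<and> v[j := Suc (v ! j)] \<noteq> v}. ?A (v[j := Suc (v ! j)])))"
    by (intro card_mono) auto
  also have "\<dots> \<le> card (?A v) + card (\<Union>j\<in>{j. j < d \<and> v[j := Suc (v ! j)] \<noteq> v}. ?A (v[j := Suc (v ! j)]))"
    by (rule card_Un_le)
  also have "card (?A v) \<le> B" using capacities[of t v v] by simp
  also have "card (\<Union>j\<in>{j. j < d \<and> v[j := Suc (v ! j)] \<noteq> v}. ?A (v[j := Suc (v ! j)])) \<le> d * c"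
  proof (rule card_UN_le_mult)
    show "card {j. j < d \<and> v[j := Suc (v ! j)] \<noteq> v} \<le> d"
      using card_mono[of "{..<d}" "{j. j < d \<and> v[j := Suc (v ! j)] \<noteq> v}"] by auto
    fix j assume "j \<in> {j. j < d \<and> v[j := Suc (v ! j)] \<noteq> v}"
    then show "card (?A (v[j := Suc (v ! j)])) \<le> c"
      using capacities[of t v "v[j := Suc (v ! j)]"] by (simp split: if_splits)
  qed simp
  finally show ?thesis by simp
qed

lemma card_in: "card {i. i < length \<sigma> \<and> rtime (\<sigma> ! i) \<le> t \<and> S i (Suc t) = Some w} \<le> K"
proof -
  let ?A = "\<lambda>v. {i. i < length \<sigma> \<and> S i t = Some v \<and> S i (Suc t) = Some w}"
  \<comment> \<open>At coordinate 0 the subtraction truncates and there is no incoming edge; the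
    condition drops this case.\<close>
  let ?J = "{j. j < d \<and> w[j := w ! j - 1] \<noteq> w}"
  have "{i. i < length \<sigma> \<and> rtime (\<sigma> ! i) \<le> t \<and> S i (Suc t) = Some w} \<subseteq>
      ?A w \<union> (\<Union>j\<in>?J. ?A (w[j := w ! j - 1]))"
  proof
    fix i assume i: "i \<in> {i. i < length \<sigma> \<and> rtime (\<sigma> ! i) \<le> t \<and> S i (Suc t) = Some w}"
    then obtain v where v: "S i t = Some v" "w = v \<or> (v, w) \<in> E" using hop[of i t w] by auto
    show "i \<in> ?A w \<union> (\<Union>j\<in>?J. ?A (w[j := w ! j - 1]))"
    proof (cases "w = v")
      case False
      then obtain j where j: "j < d" "w = v[j := Suc (v ! j)]" "v \<in> V" using v edge_D by blast
      then have "w[j := w ! j - 1] = v" using V_D(1)[OF j(3)] by simp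
      then show ?thesis using i j(1) v False by auto
    qed (use i v in auto)
  qed
  then have "card {i. i < length \<sigma> \<and> rtime (\<sigma> ! i) \<le> t \<and> S i (Suc t) = Some w} \<le>
      card (?A w \<union> (\<Union>j\<in>?J. ?A (w[j := w ! j - 1])))"
    by (intro card_mono) auto
  also have "\<dots> \<le> card (?A w) + card (\<Union>j\<in>?J. ?A (w[j := w ! j - 1]))"
    by (rule card_Un_le)
  also have "card (?A w) \<le> B" using capacities[of t w w] by simp
  also have "card (\<Union>j\<in>?J. ?A (w[j := w ! j - 1])) \<le> d * c"
  proof (rule card_UN_le_mult)
    show "card ?J \<le> d" using card_mono[of "{..<d}" ?J] by auto
    fix j assume "j \<in> ?J"
    then show "card (?A (w[j := w ! j - 1])) \<le> c"
      using capacities[of t "w[j := w ! j - 1]" w] by (simp split: if_splits)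
  qed simp
  finally show ?thesis by simp
qed

text \<open>Requests with equal end points are excluded, since any number of them may be input at
  one point. Any other packet on its route either remains in the network for the next step or has
  just come in over an edge or from the buffer; this is the factor 2.\<close>

lemma routes:
  assumes m: "m > 0"
    and X: "X \<subseteq> {i. i < length \<sigma> \<and> src (\<sigma> ! i) \<noteq> dst (\<sigma> ! i) \<and> S i (e i) = Some (dst (\<sigma> ! i))}"
  shows "routes d m \<Lambda> K (prod_list l * K) X (\<lambda>i. rtime (\<sigma> ! i)) e (\<lambda>i t. point (the (S i t)) t)"
proof
  let ?r = "\<lambda>i. rtime (\<sigma> ! i)"
  have X': "i < length \<sigma>" "src (\<sigma> ! i) \<noteq> dst (\<sigma> ! i)" "S i (e i) = Some (dst (\<sigma> ! i))"
    "?r i < e i" if "i \<in> X" for i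
  proof -
    show i: "i < length \<sigma>" "src (\<sigma> ! i) \<noteq> dst (\<sigma> ! i)" "S i (e i) = Some (dst (\<sigma> ! i))"
      using X that by auto
    show "?r i < e i" using before[OF i(1), of "e i"] start[OF i(1)] i(2,3)
      by (metis linorder_neqE_nat option.distinct(1) option.inject)
  qed
  have pr: "\<exists>v\<in>V. S i t = Some v" if "i \<in> X" "?r i \<le> t" "t \<le> e i" for i t
    using present[OF X'(1)[OF that(1)] that(2,3)] X'(3)[OF that(1)] by simp
  show "finite X" by (rule finite_subset[OF X]) simp
  show "m > 0" by (rule m)
  fix i assume i: "i \<in> X"
  show "trip D (\<lambda>t. point (the (S i t)) t) (?r i) (e i)"
    unfolding trip_def
  proof (intro conjI allI impI)
    show "?r i \<le> e i" using X'(4)[OF i] by simp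
    fix u assume u: "?r i \<le> u" "u < e i"
    obtain v w where v: "v \<in> V" "S i u = Some v" and w: "w \<in> V" "S i (Suc u) = Some w"
      using pr[OF i] u by (metis Suc_leI le_SucI less_imp_le)
    then have "w = v \<or> (v, w) \<in> E" using hop[OF X'(1)[OF i] u(1) w(2)] by auto
    then show "\<exists>j<D. point (the (S i (Suc u))) (Suc u) = inc j (point (the (S i u)) u)"
    proof
      assume "w = v"
      then show ?thesis using point_stay[OF v(1), of u] v w by auto
    next
      assume "(v, w) \<in> E"
      then obtain j where j: "j < d" "w = v[j := Suc (v ! j)]" using edge_D by blast
      then show ?thesis using point_edge[OF v(1) j(1), of u] v w by (intro exI[of _ j]) simp
    qed
  qed
  show "point (the (S i (?r i))) (?r i) \<in> pts D" by (rule point_pts)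
  show "level D (point (the (S i (?r i))) (?r i)) = ?r i + \<Lambda>"
    using pr[OF i order_refl] X'(4)[OF i] level_point by auto
next
  let ?r = "\<lambda>i. rtime (\<sigma> ! i)"
  have X': "i < length \<sigma>" "src (\<sigma> ! i) \<noteq> dst (\<sigma> ! i)" "S i (e i) = Some (dst (\<sigma> ! i))" if "i \<in> X" for i
    using X that by auto
  have pr: "\<exists>v\<in>V. S i t = Some v" if "i \<in> X" "?r i \<le> t" "t \<le> e i" for i t
    using present[OF X'(1)[OF that(1)] that(2,3)] X'(3)[OF that(1)] by simp
  have fX: "finite X" by (rule finite_subset[OF X]) simp
  fix t
  show "card {i \<in> X. ?r i \<le> t \<and> t < e i} \<le> prod_list l * K"
  proof -
    have "{i \<in> X. ?r i \<le> t \<and> t < e i} \<subseteq>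
        (\<Union>v\<in>V. {i. i < length \<sigma> \<and> ?r i \<le> t \<and> S i t = Some v \<and> S i (Suc t) \<noteq> None})"
    proof
      fix i assume i: "i \<in> {i \<in> X. ?r i \<le> t \<and> t < e i}"
      then show "i \<in> (\<Union>v\<in>V. {i. i < length \<sigma> \<and> ?r i \<le> t \<and> S i t = Some v \<and> S i (Suc t) \<noteq> None})"
        using pr[of i t] pr[of i "Suc t"] X' by auto
    qed
    then have "card {i \<in> X. ?r i \<le> t \<and> t < e i} \<le>
        card (\<Union>v\<in>V. {i. i < length \<sigma> \<and> ?r i \<le> t \<and> S i t = Some v \<and> S i (Suc t) \<noteq> None})"
      using finite_V by (intro card_mono) auto
    also have "\<dots> \<le> prod_list l * K" by (rule card_UN_le_mult[OF finite_V card_out card_V])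
    finally show ?thesis .
  qed
  fix x
  show "card {i \<in> X. ?r i \<le> t \<and> t \<le> e i \<and> point (the (S i t)) t = x} \<le> 2 * K"
  proof -
    let ?O = "{i. i < length \<sigma> \<and> ?r i \<le> t \<and> S i t = Some (node x) \<and> S i (Suc t) \<noteq> None}"
    let ?I = "{i. i < length \<sigma> \<and> ?r i \<le> t - 1 \<and> S i (Suc (t - 1)) = Some (node x)}"
    have "{i \<in> X. ?r i \<le> t \<and> t \<le> e i \<and> point (the (S i t)) t = x} \<subseteq> ?O \<union> ?I"
    proof
      fix i assume "i \<in> {i \<in> X. ?r i \<le> t \<and> t \<le> e i \<and> point (the (S i t)) t = x}"
      then have i: "i \<in> X" "?r i \<le> t" "t \<le> e i" "point (the (S i t)) t = x" by auto
      obtain v where v: "v \<in> V" "S i t = Some v" using pr[OF i(1-3)] by blast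
      have nx: "node x = v" using i(4) v node_point[OF V_D(1)[OF v(1)], of t] by auto
      show "i \<in> ?O \<union> ?I"
      proof (cases "t = e i")
        case True
        have "?r i \<noteq> t" using start[OF X'(1)[OF i(1)]] X'(2,3)[OF i(1)] True by auto
        then have "?r i \<le> t - 1" "Suc (t - 1) = t" using i(2) by simp_all
        then show ?thesis using v nx X'(1)[OF i(1)] by simp
      next
        case False
        then show ?thesis using pr[OF i(1), of "Suc t"] i v nx X'(1)[OF i(1)] by auto
      qed
    qed
    then have "card {i \<in> X. ?r i \<le> t \<and> t \<le> e i \<and> point (the (S i t)) t = x} \<le> card (?O \<union> ?I)"
      by (intro card_mono) auto
    also have "\<dots> \<le> card ?O + card ?I" by (rule card_Un_le)
    also have "\<dots> \<le> 2 * K" using card_out[of t "node x"] card_in[of "t - 1" "node x"] by simp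
    finally show ?thesis .
  qed
qed

end

section \<open>The algorithm\<close>

locale router = grid +
  fixes m p :: nat
begin

definition origin :: "nat list request list \<Rightarrow> nat \<Rightarrow> nat \<Rightarrow> nat" where
  "origin \<sigma> i = point (src (\<sigma> ! i)) (rtime (\<sigma> ! i))"

text \<open>The goal of a route without waiting: the last coordinate keeps its initial
  value.\<close>

definition direct :: "nat list request list \<Rightarrow> nat \<Rightarrow> nat \<Rightarrow> nat" where
  "direct \<sigma> i = (\<lambda>j. if j < d then dst (\<sigma> ! i) ! j else if j = d then origin \<sigma> i d else 0)"

text \<open>A candidate also fixes an arrival time: the last coordinate of \<open>z\<close> may be
  any value from that of the origin up to what the deadline permits.\<close>

definition plans :: "nat list request list \<Rightarrow> nat \<Rightarrow> ((nat \<Rightarrow> nat) \<times> (nat \<Rightarrow> nat) \<times> (nat \<Rightarrow> nat) set) set" where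
  "plans \<sigma> i = {(a, z, P). i < length \<sigma> \<and> a = origin \<sigma> i \<and> z \<in> pts D \<and> (\<forall>j<d. z j = dst (\<sigma> ! i) ! j) \<and>
     a d \<le> z d \<and> enat (level D z - \<Lambda>) \<le> deadline (\<sigma> ! i) \<and> is_plan D m p a z P}"

definition area :: "(nat \<Rightarrow> nat) \<times> (nat \<Rightarrow> nat) \<times> (nat \<Rightarrow> nat) set \<Rightarrow> (nat \<Rightarrow> nat) set" where
  "area x = src_box D m (fst x) \<union> dst_box D m (fst (snd x))"

definition choice :: "nat list request list \<Rightarrow> nat \<Rightarrow> ((nat \<Rightarrow> nat) \<times> (nat \<Rightarrow> nat) \<times> (nat \<Rightarrow> nat) set) option" where
  "choice \<sigma> = admission.choice p (plans \<sigma>) (\<lambda>x. snd (snd x)) area"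

definition through :: "nat list request list \<Rightarrow> nat set" where
  "through \<sigma> = {i. i < length \<sigma> \<and> choice \<sigma> i \<noteq> None}"

definition goal :: "nat list request list \<Rightarrow> nat \<Rightarrow> nat \<Rightarrow> nat" where
  "goal \<sigma> i = fst (snd (the (choice \<sigma> i)))"

definition corridor :: "nat list request list \<Rightarrow> nat \<Rightarrow> (nat \<Rightarrow> nat) set" where
  "corridor \<sigma> i = snd (snd (the (choice \<sigma> i)))"

definition straight :: "nat list request list \<Rightarrow> nat set" where
  "straight \<sigma> = {i. i < length \<sigma> \<and> choice \<sigma> i = None \<and> card (thick D m (origin \<sigma> i) (direct \<sigma> i)) \<le> 1 \<and>
     enat (level D (direct \<sigma> i) - \<Lambda>) \<le> deadline (\<sigma> ! i)}"

text \<open>If no direction is thick, any spatial one can serve as the axis; 0 is the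
  default.\<close>

definition axis :: "nat list request list \<Rightarrow> nat \<Rightarrow> nat" where
  "axis \<sigma> i = (let T = thick D m (origin \<sigma> i) (direct \<sigma> i) in if T = {} then 0 else SOME j. j \<in> T)"

abbreviation "release \<sigma> i \<equiv> rtime (\<sigma> ! i)"
abbreviation "tpos \<sigma> \<equiv> transit_dyn.pos D m (through \<sigma>) (release \<sigma>) (origin \<sigma>) (goal \<sigma>) (corridor \<sigma>)"
abbreviation "tarr \<sigma> \<equiv> transit_dyn.arrival D (goal \<sigma>) \<Lambda>"
abbreviation "lpos \<sigma> \<equiv> line_dyn.pos D (release \<sigma>) (origin \<sigma>) (direct \<sigma>) (axis \<sigma>)"
abbreviation "lalive \<sigma> \<equiv> line_dyn.alive D (straight \<sigma>) (release \<sigma>) (origin \<sigma>) (direct \<sigma>) (axis \<sigma>)"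
abbreviation "larr \<sigma> \<equiv> line_dyn.arrival D (release \<sigma>) (origin \<sigma>) (direct \<sigma>)"

text \<open>The way to a space-time goal may visit the destination node early, and the packet is
  removed there; hence the condition on earlier times. The last branch records a rejected packet at
  its release, where every schedule must place it.\<close>

definition alg :: "nat list request list \<Rightarrow> nat list schedule" where
  "alg \<sigma> i t =
     (if t < release \<sigma> i then None
      else if i \<in> through \<sigma> then
        (if t \<le> tarr \<sigma> i \<and> (\<forall>s. release \<sigma> i \<le> s \<longrightarrow> s < t \<longrightarrow> node (tpos \<sigma> s i) \<noteq> dst (\<sigma> ! i))
         then Some (node (tpos \<sigma> t i)) else None)
      else if lalive \<sigma> t i then Some (node (lpos \<sigma> t i))
      else if t = release \<sigma> i then Some (src (\<sigma> ! i)) else None)"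

lemma alg_online: "online alg"
  unfolding online_def
proof (intro allI impI)
  fix \<sigma> \<sigma>' :: "nat list request list" and T i t
  assume s: "sorted (map rtime \<sigma>)" "sorted (map rtime \<sigma>')"
    and eq: "filter (\<lambda>r. rtime r \<le> T) \<sigma> = filter (\<lambda>r. rtime r \<le> T) \<sigma>'"
    and i: "i < length \<sigma>" "rtime (\<sigma> ! i) \<le> T" and t: "t \<le> Suc T"
  note n1 = nth_le_sorted[OF s(1), of _ T] and n2 = nth_le_sorted[OF s(2), of _ T]
  have iff: "k < length \<sigma> \<and> release \<sigma> k \<le> T \<longleftrightarrow> k < length \<sigma>' \<and> release \<sigma>' k \<le> T" for k
    using n1 n2 eq by simp
  have same: "\<sigma> ! k = \<sigma>' ! k" if "k < length \<sigma>" "release \<sigma> k \<le> T" for k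
    using filter_nth_sorted[OF s(1), of k T] filter_nth_sorted[OF s(2), of k T] n1 n2 eq that by metis
  have org: "origin \<sigma> k = origin \<sigma>' k \<and> direct \<sigma> k = direct \<sigma>' k \<and> axis \<sigma> k = axis \<sigma>' k"
    if "k < length \<sigma>" "release \<sigma> k \<le> T" for k
  proof -
    have o: "origin \<sigma> k = origin \<sigma>' k" using same[OF that] by (simp add: origin_def)
    then have "direct \<sigma> k = direct \<sigma>' k" by (simp only: direct_def same[OF that] o)
    then show ?thesis using o by (simp add: axis_def)
  qed
  have pl: "plans \<sigma> k = plans \<sigma>' k" if "k < length \<sigma>" "release \<sigma> k \<le> T" for k
    using same[OF that] org[OF that] iff[of k] that by (simp add: plans_def)
  have ch: "choice \<sigma> k = choice \<sigma>' k" if k: "k < length \<sigma>" "release \<sigma> k \<le> T" for k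
    unfolding choice_def
  proof (rule admission_cong)
    fix k' assume "k' \<le> k"
    then show "plans \<sigma> k' = plans \<sigma>' k'"
      using pl[of k'] k sorted_nth_mono[OF s(1), of k' k] by simp
  qed
  have th: "k \<in> through \<sigma> \<and> release \<sigma> k \<le> T \<longleftrightarrow> k \<in> through \<sigma>' \<and> release \<sigma>' k \<le> T" for k
    unfolding through_def mem_Collect_eq using iff[of k] ch[of k] by metis
  have sp: "k \<in> straight \<sigma> \<and> release \<sigma> k \<le> T \<longleftrightarrow> k \<in> straight \<sigma>' \<and> release \<sigma>' k \<le> T" for k
    using iff[of k] ch[of k] org[of k] same[of k] by (auto simp: straight_def)
  have gl: "goal \<sigma> k = goal \<sigma>' k \<and> corridor \<sigma> k = corridor \<sigma>' k" if "k < length \<sigma>" "release \<sigma> k \<le> T" for k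
    using ch[OF that] by (simp add: goal_def corridor_def)
  have tp: "tpos \<sigma> u i = tpos \<sigma>' u i" if "i \<in> through \<sigma>" "u \<le> t" for u
  proof -
    have "transit_dyn.state D m (through \<sigma>) (release \<sigma>) (origin \<sigma>) (goal \<sigma>) (corridor \<sigma>) u i =
       transit_dyn.state D m (through \<sigma>') (release \<sigma>') (origin \<sigma>') (goal \<sigma>') (corridor \<sigma>') u i"
    proof (rule transit_cong[where N = T])
      fix k assume "k \<in> through \<sigma>" "release \<sigma> k \<le> T"
      then show "release \<sigma> k = release \<sigma>' k \<and> origin \<sigma> k = origin \<sigma>' k \<and> goal \<sigma> k = goal \<sigma>' k \<and> corridor \<sigma> k = corridor \<sigma>' k"
        using same[of k] org[of k] gl[of k] by (auto simp: through_def)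
    qed (use th that t i in auto)
    then show ?thesis by (simp add: transit_dyn.pos_def)
  qed
  have la: "lalive \<sigma> t i = lalive \<sigma>' t i"
  proof (cases "i \<in> straight \<sigma>")
    case True
    show ?thesis
    proof (rule line_cong[where N = T])
      fix k assume "k \<in> straight \<sigma>" "release \<sigma> k \<le> T"
      then show "release \<sigma> k = release \<sigma>' k \<and> origin \<sigma> k = origin \<sigma>' k \<and> direct \<sigma> k = direct \<sigma>' k \<and> axis \<sigma> k = axis \<sigma>' k"
        using same[of k] org[of k] by (auto simp: straight_def)
    qed (use sp True t i in auto)
  next
    case False
    then have "i \<notin> straight \<sigma>'" using sp[of i] iff[of i] i by auto
    then show ?thesis using False line_dyn.alive_J by blast
  qed
  have hd: "line_dyn.heading D (direct \<sigma>) (axis \<sigma>) i = line_dyn.heading D (direct \<sigma>') (axis \<sigma>') i"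
    using org[OF i] by (intro ext) (simp add: line_dyn.heading_def)
  have wk: "line_dyn.walk D (origin \<sigma>) (direct \<sigma>) (axis \<sigma>) i n = line_dyn.walk D (origin \<sigma>') (direct \<sigma>') (axis \<sigma>') i n" for n
    using hd org[OF i] by (induction n) (simp_all add: line_dyn.walk.simps)
  have lp: "lpos \<sigma> t i = lpos \<sigma>' t i" using wk same[OF i] by (simp add: line_dyn.pos_def)
  have ta: "tarr \<sigma> i = tarr \<sigma>' i" using gl[OF i] by (simp add: transit_dyn.arrival_def)
  have ti: "i \<in> through \<sigma> \<longleftrightarrow> i \<in> through \<sigma>'" using th[of i] iff[of i] i by auto
  show "alg \<sigma> i t = alg \<sigma>' i t"
    unfolding alg_def using same[OF i] la lp ta ti tp by (auto cong: if_cong)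
qed

end

text \<open>The bound on \<open>2 * p\<close> turns \<open>A.load\<close>, which limits the users of
  a tile logarithmically, into the assumption \<open>load\<close> of \<open>transit\<close>.\<close>

locale router_run = router +
  fixes \<sigma> :: "nat list request list"
  assumes d: "d \<ge> 1" and m: "2 * p < 2 ^ (m - 1)" and p: "p > 0"
    and valid: "\<And>q. q \<in> set \<sigma> \<Longrightarrow> grid_request l q"
begin

lemma m0: "m > 0" using m p by (cases m) auto

lemma request:
  assumes "i < length \<sigma>"
  shows "src (\<sigma> ! i) \<in> V" "dst (\<sigma> ! i) \<in> V" "\<And>j. j < d \<Longrightarrow> src (\<sigma> ! i) ! j \<le> dst (\<sigma> ! i) ! j"
proof -
  have "grid_request l (\<sigma> ! i)" using valid assms by simp
  then show "src (\<sigma> ! i) \<in> V" "dst (\<sigma> ! i) \<in> V" "\<And>j. j < d \<Longrightarrow> src (\<sigma> ! i) ! j \<le> dst (\<sigma> ! i) ! j"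
    using V_D(1) by (auto simp: grid_request_def list_all2_conv_all_nth)
qed

lemma origin: "origin \<sigma> i \<in> pts D" "i < length \<sigma> \<Longrightarrow> level D (origin \<sigma> i) = release \<sigma> i + \<Lambda>"
  "j < d \<Longrightarrow> origin \<sigma> i j = src (\<sigma> ! i) ! j"
  using point_pts level_point request(1) by (auto simp: origin_def) (simp add: point_def)

lemma direct: "direct \<sigma> i \<in> pts D" "i < length \<sigma> \<Longrightarrow> origin \<sigma> i j \<le> direct \<sigma> i j"
proof -
  show "direct \<sigma> i \<in> pts D" by (auto simp: direct_def pts_def)
  show "i < length \<sigma> \<Longrightarrow> origin \<sigma> i j \<le> direct \<sigma> i j"
    using request(3)[of i j] origin(1)[of i] origin(3)[of j i] by (auto simp: direct_def pts_def)
qed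

lemma thick_direct: "thick D m (origin \<sigma> i) (direct \<sigma> i) \<subseteq> {..<d}"
proof
  fix j assume "j \<in> thick D m (origin \<sigma> i) (direct \<sigma> i)"
  then show "j \<in> {..<d}" by (cases "j = d") (auto simp: thick_def direct_def)
qed

section \<open>The three mechanisms as instances\<close>

sublocale A: admission_bounded p "plans \<sigma>" "\<lambda>x. snd (snd x)" area "3 ^ D + 2 ^ D"
proof
  show "p > 0" by (rule p)
  show "finite (snd (snd x)) \<and> finite (area x)" if "x \<in> plans \<sigma> n" for x n
    using that card_boxes(1) by (auto simp: plans_def is_plan_def area_def)
  show "card (snd (snd x)) \<le> p" if "x \<in> plans \<sigma> n" for x n
    using that by (auto simp: plans_def is_plan_def)
  show "card (area x) \<le> 3 ^ D + 2 ^ D" for x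
    unfolding area_def by (rule card_boxes(2))
qed

lemma choice: "choice \<sigma> = A.choice"
  by (simp add: choice_def)

lemma through:
  assumes "i \<in> through \<sigma>"
  shows "choice \<sigma> i = Some (origin \<sigma> i, goal \<sigma> i, corridor \<sigma> i)" "i < length \<sigma>" "goal \<sigma> i \<in> pts D"
    "\<And>j. j < d \<Longrightarrow> goal \<sigma> i j = dst (\<sigma> ! i) ! j" "origin \<sigma> i d \<le> goal \<sigma> i d"
    "enat (level D (goal \<sigma> i) - \<Lambda>) \<le> deadline (\<sigma> ! i)"
    "is_plan D m p (origin \<sigma> i) (goal \<sigma> i) (corridor \<sigma> i)"
proof -
  obtain x where x: "choice \<sigma> i = Some x" using assms by (auto simp: through_def)
  obtain a z P where azP: "x = (a, z, P)" by (cases x)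
  have "(a, z, P) \<in> plans \<sigma> i" using A.choice_Some(1)[of i x] x azP by (simp add: choice)
  moreover have "goal \<sigma> i = z" "corridor \<sigma> i = P" using x azP by (simp_all add: goal_def corridor_def)
  ultimately show "choice \<sigma> i = Some (origin \<sigma> i, goal \<sigma> i, corridor \<sigma> i)" "i < length \<sigma>" "goal \<sigma> i \<in> pts D"
    "\<And>j. j < d \<Longrightarrow> goal \<sigma> i j = dst (\<sigma> ! i) ! j" "origin \<sigma> i d \<le> goal \<sigma> i d"
    "enat (level D (goal \<sigma> i) - \<Lambda>) \<le> deadline (\<sigma> ! i)"
    "is_plan D m p (origin \<sigma> i) (goal \<sigma> i) (corridor \<sigma> i)"
    using x azP by (auto simp: plans_def)
qed

lemma origin_le_goal: "i \<in> through \<sigma> \<Longrightarrow> origin \<sigma> i j \<le> goal \<sigma> i j"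
  using through(2,4,5)[of i] request(3)[of i j] origin(1)[of i] origin(3)[of j i]
  by (cases "j < d"; cases "j = d") (auto simp: pts_def)

sublocale T: transit D m "through \<sigma>" "release \<sigma>" "origin \<sigma>" "goal \<sigma>" "corridor \<sigma>" \<Lambda>
proof
  show "finite (through \<sigma>)" by (simp add: through_def)
  fix U
  have "{q \<in> through \<sigma>. U \<in> corridor \<sigma> q} \<subseteq> A.users (length \<sigma>) U"
    using through(1,2) by (auto simp: A.users_def choice)
  then have "card {q \<in> through \<sigma>. U \<in> corridor \<sigma> q} \<le> card (A.users (length \<sigma>) U)"
    by (intro card_mono) auto
  moreover have "(2::nat) ^ card (A.users (length \<sigma>) U) < 2 ^ (m - 1)" by (rule le_less_trans[OF A.load m])
  then have "card (A.users (length \<sigma>) U) < m - 1" by (rule power_less_imp_less_exp[rotated]) simp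
  ultimately show "card {q \<in> through \<sigma>. U \<in> corridor \<sigma> q} + 2 \<le> m" by simp
next
  fix i assume i: "i \<in> through \<sigma>"
  note t = through[OF i]
  show "origin \<sigma> i \<in> pts D" by (rule origin)
  show "goal \<sigma> i \<in> pts D" by (rule t(3))
  show "origin \<sigma> i j \<le> goal \<sigma> i j" for j by (rule origin_le_goal[OF i])
  show "level D (origin \<sigma> i) = release \<sigma> i + \<Lambda>" by (rule origin(2)[OF t(2)])
  show "2 \<le> card (thick D m (origin \<sigma> i) (goal \<sigma> i))"
    "tile m (entry D m (origin \<sigma> i) (goal \<sigma> i)) \<in> corridor \<sigma> i"
    using t(7) by (auto simp: is_plan_def)
  show "U j \<le> exit_tile D m (origin \<sigma> i) (goal \<sigma> i) j" if "U \<in> corridor \<sigma> i" for U j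
    using t(7) that by (auto simp: is_plan_def)
  show "\<exists>j\<in>thick D m (origin \<sigma> i) (goal \<sigma> i). inc j U \<in> corridor \<sigma> i"
    if "U \<in> corridor \<sigma> i" "U \<noteq> exit_tile D m (origin \<sigma> i) (goal \<sigma> i)" for U
    using t(7) that by (auto simp: is_plan_def)
  fix q assume q: "q \<in> through \<sigma>" "i \<noteq> q"
  show "(src_box D m (origin \<sigma> i) \<union> dst_box D m (goal \<sigma> i)) \<inter>
      (src_box D m (origin \<sigma> q) \<union> dst_box D m (goal \<sigma> q)) = {}"
  proof (cases "i < q")
    case True
    show ?thesis
      using A.box_disjoint[OF True t(1)[unfolded choice] through(1)[OF q(1), unfolded choice]]
      by (simp only: area_def fst_conv snd_conv)
  next
    case False
    then have "q < i" using q(2) by simp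
    then have "area (origin \<sigma> q, goal \<sigma> q, corridor \<sigma> q) \<inter> area (origin \<sigma> i, goal \<sigma> i, corridor \<sigma> i) = {}"
      by (rule A.box_disjoint[OF _ through(1)[OF q(1), unfolded choice] t(1)[unfolded choice]])
    then show ?thesis by (simp only: area_def fst_conv snd_conv Int_commute)
  qed
qed

lemma straight:
  assumes "i \<in> straight \<sigma>"
  shows "i < length \<sigma>" "i \<notin> through \<sigma>" "axis \<sigma> i < d" "thick D m (origin \<sigma> i) (direct \<sigma> i) \<subseteq> {axis \<sigma> i}"
    "enat (level D (direct \<sigma> i) - \<Lambda>) \<le> deadline (\<sigma> ! i)"
proof -
  let ?T = "thick D m (origin \<sigma> i) (direct \<sigma> i)"
  show "i < length \<sigma>" "i \<notin> through \<sigma>" "enat (level D (direct \<sigma> i) - \<Lambda>) \<le> deadline (\<sigma> ! i)"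
    using assms by (auto simp: straight_def through_def)
  have "card ?T \<le> 1" using assms by (simp add: straight_def)
  then have one: "j = k" if "j \<in> ?T" "k \<in> ?T" for j k
    using that card_le_Suc0_iff_eq[of ?T] by auto
  have ax: "axis \<sigma> i \<in> ?T" if "?T \<noteq> {}"
    using that some_in_eq[of ?T] by (simp add: axis_def)
  show "?T \<subseteq> {axis \<sigma> i}" using ax one by blast
  show "axis \<sigma> i < d"
  proof (cases "?T = {}")
    case True
    then have "axis \<sigma> i = 0" by (simp add: axis_def)
    then show ?thesis using d by linarith
  next
    case False
    then show ?thesis using ax thick_direct[of i] by blast
  qed
qed

text \<open>Each of the \<open>d\<close> directions other than the axis is thin and spans at most
  \<open>3 * m\<close>.\<close>

sublocale L: line D "straight \<sigma>" "release \<sigma>" "origin \<sigma>" "direct \<sigma>" "axis \<sigma>" \<Lambda> "d * (3 * m)"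
proof
  show "finite (straight \<sigma>)" by (simp add: straight_def)
  fix i assume i: "i \<in> straight \<sigma>"
  note s = straight[OF i]
  show "origin \<sigma> i \<in> pts D" by (rule origin)
  show "direct \<sigma> i \<in> pts D" by (rule direct)
  show "origin \<sigma> i j \<le> direct \<sigma> i j" for j by (rule direct(2)[OF s(1)])
  show "level D (origin \<sigma> i) = release \<sigma> i + \<Lambda>" by (rule origin(2)[OF s(1)])
  show "axis \<sigma> i < D" using s(3) by simp
  have "direct \<sigma> i j - origin \<sigma> i j \<le> 3 * m" if "j \<in> {..<D} - {axis \<sigma> i}" for j
  proof -
    have "j \<notin> thick D m (origin \<sigma> i) (direct \<sigma> i)" using that s(4) by blast
    then show ?thesis using thick_bound[OF m0, of j D "origin \<sigma> i" "direct \<sigma> i"] that by simp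
  qed
  then have "(\<Sum>j\<in>{..<D} - {axis \<sigma> i}. direct \<sigma> i j - origin \<sigma> i j) \<le> (\<Sum>j\<in>{..<D} - {axis \<sigma> i}. 3 * m)"
    by (rule sum_mono)
  also have "\<dots> = d * (3 * m)" using s(3) by simp
  finally show "(\<Sum>j\<in>{..<D} - {axis \<sigma> i}. direct \<sigma> i j - origin \<sigma> i j) \<le> d * (3 * m)" .
qed

lemma node_eq_dst: "i < length \<sigma> \<Longrightarrow> (\<And>j. j < d \<Longrightarrow> z j = dst (\<sigma> ! i) ! j) \<Longrightarrow> node z = dst (\<sigma> ! i)"
  using V_D(1)[OF request(2)] by (intro nth_equalityI) (auto simp: node_def)

lemma node_V:
  assumes "i < length \<sigma>" "\<And>j. j < d \<Longrightarrow> z j \<le> dst (\<sigma> ! i) ! j"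
  shows "node z \<in> V"
proof -
  have "z j < l ! j" if "j < d" for j
    using assms(2)[OF that] V_D(2)[OF request(2)[OF assms(1)] that] by simp
  then show ?thesis by (simp add: grid_vertices_def node_def)
qed

section \<open>Feasibility\<close>

lemma t_route:
  assumes "i \<in> through \<sigma>" "release \<sigma> i \<le> t" "t \<le> tarr \<sigma> i"
  shows "point (node (tpos \<sigma> t i)) t = tpos \<sigma> t i" "\<And>j. j < d \<Longrightarrow> tpos \<sigma> t i j \<le> dst (\<sigma> ! i) ! j"
  using T.en_route[OF assms] point_node through(4)[OF assms(1)] by metis+

lemma l_route:
  assumes "lalive \<sigma> t i"
  shows "i \<in> straight \<sigma>" "release \<sigma> i \<le> t" "t \<le> larr \<sigma> i"
    "point (node (lpos \<sigma> t i)) t = lpos \<sigma> t i" "\<And>j. j < d \<Longrightarrow> lpos \<sigma> t i j \<le> dst (\<sigma> ! i) ! j"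
    "lpos \<sigma> t i d = direct \<sigma> i d"
proof -
  show s: "i \<in> straight \<sigma>" "release \<sigma> i \<le> t" using L.alive_J[OF assms] by auto
  show e: "t \<le> larr \<sigma> i"
  proof (cases t)
    case (Suc u)
    then show ?thesis using assms L.arrival(2)[OF s(1)] by (auto simp: Suc_le_eq)
  qed simp
  note r = L.en_route[OF s e]
  show "point (node (lpos \<sigma> t i)) t = lpos \<sigma> t i" by (rule point_node[OF r(1,2)])
  show "lpos \<sigma> t i j \<le> dst (\<sigma> ! i) ! j" if "j < d" for j using r(4)[of j] that by (simp add: direct_def)
  show "lpos \<sigma> t i d = direct \<sigma> i d" using r(3,4)[of d] by (simp add: direct_def)
qed

lemma alg_Some:
  assumes "release \<sigma> i \<le> t" "alg \<sigma> i t = Some v"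
  shows "i \<in> through \<sigma> \<and> t \<le> tarr \<sigma> i \<and> v = node (tpos \<sigma> t i) \<and>
       (\<forall>s. release \<sigma> i \<le> s \<longrightarrow> s < t \<longrightarrow> node (tpos \<sigma> s i) \<noteq> dst (\<sigma> ! i)) \<or>
     i \<notin> through \<sigma> \<and> lalive \<sigma> t i \<and> v = node (lpos \<sigma> t i) \<or>
     i \<notin> through \<sigma> \<and> t = release \<sigma> i"
  using assms by (auto simp: alg_def split: if_splits)

lemma alg_move:
  assumes "i < length \<sigma>" "release \<sigma> i \<le> t" "alg \<sigma> i (Suc t) = Some w"
  obtains (through) "i \<in> through \<sigma>" "t < tarr \<sigma> i" "alg \<sigma> i t = Some (node (tpos \<sigma> t i))"
      "node (tpos \<sigma> t i) \<noteq> dst (\<sigma> ! i)" "w = node (tpos \<sigma> (Suc t) i)"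
  | (straight) "i \<in> straight \<sigma>" "lalive \<sigma> (Suc t) i" "lalive \<sigma> t i" "t < larr \<sigma> i"
      "alg \<sigma> i t = Some (node (lpos \<sigma> t i))" "w = node (lpos \<sigma> (Suc t) i)"
proof -
  have r: "release \<sigma> i \<le> Suc t" using assms(2) by simp
  show ?thesis
  proof (cases "i \<in> through \<sigma>")
    case True
    then have h: "Suc t \<le> tarr \<sigma> i" "w = node (tpos \<sigma> (Suc t) i)"
      "\<And>s. release \<sigma> i \<le> s \<Longrightarrow> s < Suc t \<Longrightarrow> node (tpos \<sigma> s i) \<noteq> dst (\<sigma> ! i)"
      using alg_Some[OF r assms(3)] by auto
    then have "alg \<sigma> i t = Some (node (tpos \<sigma> t i))" using True assms(2) by (simp add: alg_def)
    then show ?thesis using through True h assms(2) by (simp add: Suc_le_eq)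
  next
    case False
    then have h: "lalive \<sigma> (Suc t) i" "w = node (lpos \<sigma> (Suc t) i)"
      using alg_Some[OF r assms(3)] assms(2) by (auto simp del: line_dyn.alive.simps)
    have "lalive \<sigma> t i \<and> t < larr \<sigma> i" using L.alive_pred[OF h(1) assms(2)] .
    moreover have "alg \<sigma> i t = Some (node (lpos \<sigma> t i))" using calculation False assms(2) by (simp add: alg_def)
    moreover have "i \<in> straight \<sigma>" using L.alive_J[OF h(1)] by simp
    ultimately show ?thesis using straight h by blast
  qed
qed

text \<open>A buffer is an edge in the waiting direction, so one bound 2 + 1 serves links and
  buffers: two packets of the transit mechanism and one straight packet.\<close>

lemma alg_feasible:
  assumes "3 \<le> B" "3 \<le> c"
  shows "feasible_schedule E c B \<sigma> (alg \<sigma>)"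
proof -
  have start: "alg \<sigma> i (release \<sigma> i) = Some (src (\<sigma> ! i))" if i: "i < length \<sigma>" for i
  proof -
    have n: "node (origin \<sigma> i) = src (\<sigma> ! i)"
      unfolding origin_def by (rule node_point[OF V_D(1)[OF request(1)[OF i]]])
    then show ?thesis
      using T.pos_start[of i] T.arrival(2)[of i] L.pos_start[of i] by (auto simp: alg_def)
  qed
  have hop: "\<exists>v. alg \<sigma> i t = Some v \<and> v \<noteq> dst (\<sigma> ! i) \<and> (w = v \<or> (v, w) \<in> E)"
    if i: "i < length \<sigma>" "release \<sigma> i \<le> t" "alg \<sigma> i (Suc t) = Some w" for i t w
    using i
  proof (cases rule: alg_move)
    case through
    obtain e where e: "e < D" "tpos \<sigma> (Suc t) i = inc e (tpos \<sigma> t i)"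
      using T.move[OF through(1) i(2) through(2)] by blast
    have "inc e (tpos \<sigma> t i) j < l ! j" if "j < d" for j
      using t_route(2)[OF through(1), of "Suc t" j] i(2) through(2) that e(2)
        V_D(2)[OF request(2)[OF i(1)] that] by simp
    moreover have "node (tpos \<sigma> t i) \<in> V"
      using t_route(2)[OF through(1) i(2)] through(2) i(1) by (intro node_V[of i]) auto
    ultimately show ?thesis using node_inc[OF _ e(1)] through e(2) by auto
  next
    case straight
    define e where "e = L.heading i (lpos \<sigma> t i)"
    have e: "e < D" "lpos \<sigma> (Suc t) i = inc e (lpos \<sigma> t i)"
      using L.heading_D[OF straight(1) i(2) straight(4)] L.pos_Suc[OF i(2)] by (simp_all add: e_def)
    have "inc e (lpos \<sigma> t i) j < l ! j" if "j < d" for j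
      using l_route(5)[OF straight(2) that] e(2) V_D(2)[OF request(2)[OF i(1)] that] by simp
    moreover have "node (lpos \<sigma> t i) \<in> V"
      using l_route(5)[OF straight(3)] i(1) by (intro node_V[of i]) auto
    \<comment> \<open>A straight packet never waits, so at its destination node it is at its
      space-time goal and has arrived.\<close>
    moreover have "node (lpos \<sigma> t i) \<noteq> dst (\<sigma> ! i)"
    proof
      assume eq: "node (lpos \<sigma> t i) = dst (\<sigma> ! i)"
      note r = L.en_route[OF straight(1) i(2) less_imp_le[OF straight(4)]]
      have "lpos \<sigma> t i j = direct \<sigma> i j" if "j < D" for j
      proof (cases "j = d")
        case True
        then show ?thesis using l_route(6)[OF straight(3)] by simp
      next
        case False
        then have "j < d" using that by simp
        then show ?thesis using arg_cong[OF eq, of "\<lambda>v. v ! j"] by (simp add: node_def direct_def)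
      qed
      then have "lpos \<sigma> t i = direct \<sigma> i" by (rule pts_eqI[OF r(1) direct(1)])
      then show False using r(2) L.arrival(1)[OF straight(1)] straight(4) by simp
    qed
    ultimately show ?thesis using node_inc[OF _ e(1)] straight e(2) by auto
  qed
  have cap: "card {i. i < length \<sigma> \<and> alg \<sigma> i t = Some v \<and> alg \<sigma> i (Suc t) = Some w} \<le> 3" for t v w
  proof -
    let ?x = "point v t" and ?y = "point w (Suc t)"
    let ?S = "{i. i < length \<sigma> \<and> alg \<sigma> i t = Some v \<and> alg \<sigma> i (Suc t) = Some w}"
    let ?T = "{i \<in> through \<sigma>. release \<sigma> i \<le> t \<and> t < tarr \<sigma> i \<and> tpos \<sigma> t i = ?x \<and> tpos \<sigma> (Suc t) i = ?y}"
    let ?L = "{i \<in> straight \<sigma>. release \<sigma> i \<le> t \<and> lalive \<sigma> (Suc t) i \<and> lpos \<sigma> t i = ?x \<and> lpos \<sigma> (Suc t) i = ?y}"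
    have sub: "i \<in> ?T \<union> ?L \<and> (\<exists>e. ?y = inc e ?x)" if S: "i \<in> ?S" for i
    proof -
      have i: "i < length \<sigma>" "alg \<sigma> i (Suc t) = Some w" "alg \<sigma> i t = Some v" using S by auto
      have r: "release \<sigma> i \<le> t"
      proof (rule ccontr)
        assume "\<not> ?thesis"
        then show False using i(3) by (simp add: alg_def)
      qed
      show ?thesis
        using i(1) r i(2)
      proof (cases rule: alg_move)
        case through
        have "v = node (tpos \<sigma> t i)" using through(3) i(3) by simp
        then have "tpos \<sigma> t i = ?x" "tpos \<sigma> (Suc t) i = ?y"
          using t_route(1)[OF through(1) r] t_route(1)[OF through(1), of "Suc t"] r through(2,5) by auto
        moreover obtain e where "tpos \<sigma> (Suc t) i = inc e (tpos \<sigma> t i)"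
          using T.move[OF through(1) r through(2)] by blast
        ultimately have "?y = inc e ?x" "i \<in> ?T" using through(1,2) r by simp_all
        then show ?thesis by blast
      next
        case straight
        have "v = node (lpos \<sigma> t i)" using straight(5) i(3) by simp
        then have xy: "lpos \<sigma> t i = ?x" "lpos \<sigma> (Suc t) i = ?y"
          using l_route(4)[OF straight(3)] l_route(4)[OF straight(2)] straight(6) by auto
        have "?y = inc (L.heading i ?x) ?x" using L.pos_Suc[OF r] xy by simp
        moreover have "i \<in> ?L" using xy straight(1,2) r by (simp del: line_dyn.alive.simps)
        ultimately show ?thesis by blast
      qed
    qed
    show ?thesis
    \<comment> \<open>The capacity lemmas speak of points one step apart; a packet making the move
      shows that these are.\<close>
    proof (cases "?S = {}")
      case False
      then obtain e where e: "?y = inc e ?x" using sub by blast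
      have "card ?S \<le> card (?T \<union> ?L)"
        using sub T.finI L.finJ by (intro card_mono) auto
      also have "\<dots> \<le> card ?T + card ?L" by (rule card_Un_le)
      also have "\<dots> \<le> 2 + 1" unfolding e by (rule add_mono[OF T.capacity L.capacity])
      finally show ?thesis by simp
    next
      case True
      show ?thesis unfolding True by simp
    qed
  qed
  have cap': "card {i. i < length \<sigma> \<and> alg \<sigma> i t = Some v \<and> alg \<sigma> i (Suc t) = Some w} \<le> k"
    if "3 \<le> k" for t v w k
    using cap[of t v w] that by linarith
  show ?thesis
    unfolding feasible_schedule_def
  proof (intro conjI allI impI)
    show "alg \<sigma> i t = None" if "t < release \<sigma> i" for i t using that by (simp add: alg_def)
  qed (use start hop cap' assms in blast)+
qed

section \<open>Deliveries and losses\<close>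

lemma through_delivered:
  assumes i: "i \<in> through \<sigma>"
  shows "delivered \<sigma> (alg \<sigma>) i"
proof -
  note t = through[OF i]
  let ?Q = "\<lambda>s. release \<sigma> i \<le> s \<and> s \<le> tarr \<sigma> i \<and> node (tpos \<sigma> s i) = dst (\<sigma> ! i)"
  have "?Q (tarr \<sigma> i)"
    using T.arrival(2)[OF i] T.pos_arrival[OF i] t(2,4) by (auto intro!: node_eq_dst)
  then have "\<exists>s. ?Q s \<and> (\<forall>u<s. \<not> ?Q u)" using exists_least_iff[of ?Q] by blast
  then obtain s where s: "release \<sigma> i \<le> s" "s \<le> tarr \<sigma> i" "node (tpos \<sigma> s i) = dst (\<sigma> ! i)"
    "\<forall>u<s. \<not> ?Q u" by blast
  have "\<forall>u. release \<sigma> i \<le> u \<longrightarrow> u < s \<longrightarrow> node (tpos \<sigma> u i) \<noteq> dst (\<sigma> ! i)"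
    using s(2,4) by (meson less_imp_le less_le_trans)
  then have "alg \<sigma> i s = Some (dst (\<sigma> ! i))"
    using s(1-3) i by (simp add: alg_def)
  moreover have "enat s \<le> enat (tarr \<sigma> i)" using s(2) by simp
  then have "enat s \<le> deadline (\<sigma> ! i)"
    using t(6) unfolding T.arrival_def by (rule order_trans)
  ultimately show ?thesis by (auto simp: delivered_def)
qed

lemma straight_delivered:
  assumes "lalive \<sigma> (larr \<sigma> i) i"
  shows "delivered \<sigma> (alg \<sigma>) i"
proof -
  note i = l_route[OF assms]
  note s = straight[OF i(1)]
  have "node (lpos \<sigma> (larr \<sigma> i) i) = dst (\<sigma> ! i)"
    using L.pos_arrival[OF i(1)] s(1) by (intro node_eq_dst) (auto simp: direct_def)
  then have "alg \<sigma> i (larr \<sigma> i) = Some (dst (\<sigma> ! i))"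
    using assms s(2) i(2) by (simp add: alg_def)
  moreover have "enat (larr \<sigma> i) \<le> deadline (\<sigma> ! i)"
    using s(5) L.arrival(1)[OF i(1)] by simp
  ultimately show ?thesis by (auto simp: delivered_def)
qed

text \<open>The summands of the factor stand for packets that the algorithm delivers too, for lost
  thin ones charged to survivors of elimination, and for lost thick ones paid for by the weights of
  accepted chains.\<close>

lemma alg_throughput_le:
  assumes W: "(D * m + \<Lambda>) * (prod_list l * (B + d * c)) \<le> W" "\<Lambda> + 3 * m \<le> W" "2 * W + \<Lambda> < p"
    and S: "feasible_schedule E c B \<sigma> S"
  shows "throughput \<sigma> S \<le> (1 + (2 * (d * (3 * m) + 3 * m) + 1) ^ D * (2 * (B + d * c)) +
    5 ^ D * (m ^ D * (2 * (B + d * c)) + 1) * (2 + (3 ^ D + 2 ^ D))) * throughput \<sigma> (alg \<sigma>)"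
proof -
  interpret off: offline l B c \<sigma> S using S valid by unfold_locales auto
  let ?Del = "{i. i < length \<sigma> \<and> delivered \<sigma> (alg \<sigma>) i}"
  define e where "e i = (SOME t. S i t = Some (dst (\<sigma> ! i)) \<and> enat t \<le> deadline (\<sigma> ! i))" for i
  define X where "X = {i. i < length \<sigma> \<and> delivered \<sigma> S i \<and> \<not> delivered \<sigma> (alg \<sigma>) i}"
  define z where "z i t = point (the (S i t)) t" for i t
  have e: "S i (e i) = Some (dst (\<sigma> ! i))" "enat (e i) \<le> deadline (\<sigma> ! i)" if "delivered \<sigma> S i" for i
    using someI_ex[of "\<lambda>t. S i t = Some (dst (\<sigma> ! i)) \<and> enat t \<le> deadline (\<sigma> ! i)"] that
    by (auto simp: e_def delivered_def)
  have re: "release \<sigma> i \<le> e i" if "i \<in> X" for i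
    using off.before[of i "e i"] e(1)[of i] that by (fastforce simp: X_def)
  have ne: "src (\<sigma> ! i) \<noteq> dst (\<sigma> ! i)" if i: "i \<in> X" for i
  proof
    assume eq: "src (\<sigma> ! i) = dst (\<sigma> ! i)"
    \<comment> \<open>The algorithm is independent of \<open>B\<close> and \<open>c\<close>, so its
      initial positions can be read off from feasibility at capacity 3.\<close>
    have "3 \<le> (3::nat)" by simp
    note f = alg_feasible[OF this this]
    have "alg \<sigma> i (release \<sigma> i) = Some (dst (\<sigma> ! i))"
      using f i eq unfolding feasible_schedule_def X_def by auto
    moreover have "enat (release \<sigma> i) \<le> deadline (\<sigma> ! i)"
      using re[OF i] e(2)[of i] i by (auto simp: X_def intro: order_trans[OF _ e(2)])
    ultimately have "delivered \<sigma> (alg \<sigma>) i" by (auto simp: delivered_def)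
    then show False using i by (simp add: X_def)
  qed
  interpret R: routes d m \<Lambda> "B + d * c" "prod_list l * (B + d * c)" X "release \<sigma>" e z
    unfolding z_def using m0 ne e(1) by (intro off.routes) (auto simp: X_def)
  have X: "i < length \<sigma>" "S i (e i) = Some (dst (\<sigma> ! i))" "enat (e i) \<le> deadline (\<sigma> ! i)" "i \<notin> through \<sigma>"
    if "i \<in> X" for i
    using that e through_delivered by (auto simp: X_def)
  have zr: "z i (release \<sigma> i) = origin \<sigma> i" if "i \<in> X" for i
    using off.start[OF X(1)[OF that]] by (simp add: z_def origin_def)
  have ze: "z i (e i) j = dst (\<sigma> ! i) ! j" if "i \<in> X" "j < d" for i j
    using X(2)[OF that(1)] that(2) by (simp add: z_def point_def)
  let ?T = "\<lambda>i. thick D m (z i (release \<sigma> i)) (z i (e i))"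
  define XL where "XL = {i \<in> X. card (?T i) \<le> 1}"
  define XT where "XT = {i \<in> X. 2 \<le> card (?T i)}"
  define L where "L = {x \<in> straight \<sigma>. lalive \<sigma> (larr \<sigma> x) x}"
  have Tsub: "thick D m (origin \<sigma> i) (direct \<sigma> i) \<subseteq> ?T i" if "i \<in> X" for i
  proof
    fix j assume j: "j \<in> thick D m (origin \<sigma> i) (direct \<sigma> i)"
    then have "j < d" using thick_direct by blast
    then show "j \<in> ?T i" using j zr[OF that] ze[OF that] by (simp add: thick_def direct_def)
  qed
  \<comment> \<open>Going without waiting, a packet arrives no later than in the offline schedule,
    so its direct route meets the deadline.\<close>
  have XLs: "i \<in> straight \<sigma>" if i: "i \<in> XL" for i
  proof -
    have iX: "i \<in> X" and c1: "card (?T i) \<le> 1" using i by (auto simp: XL_def)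
    have "card (thick D m (origin \<sigma> i) (direct \<sigma> i)) \<le> card (?T i)" by (rule card_mono[OF finite_thick Tsub[OF iX]])
    moreover have "enat (level D (direct \<sigma> i) - \<Lambda>) \<le> deadline (\<sigma> ! i)"
    proof -
      have "direct \<sigma> i j \<le> z i (e i) j" if "j < D" for j
        using that ze[OF iX] R.route(4)[OF iX order_refl re[OF iX], of d] zr[OF iX] by (auto simp: direct_def less_Suc_eq)
      then have "level D (direct \<sigma> i) \<le> e i + \<Lambda>"
        using level_mono[of D "direct \<sigma> i" "z i (e i)"] R.route(2)[OF iX re[OF iX] order_refl] by simp
      then have "enat (level D (direct \<sigma> i) - \<Lambda>) \<le> enat (e i)" by simp
      then show ?thesis using X(3)[OF iX] by (rule order_trans)
    qed
    moreover have "choice \<sigma> i = None" using X(1,4)[OF iX] unfolding through_def by blast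
    ultimately show ?thesis using X(1)[OF iX] c1 by (simp add: straight_def)
  qed
  have boundL: "card XL \<le> card L * ((2 * (d * (3 * m) + 3 * m) + 1) ^ D * (2 * (B + d * c)))"
  proof (rule R.line_bound)
    show "XL \<subseteq> X" by (auto simp: XL_def)
    show "finite L" by (simp add: L_def straight_def)
    fix i assume i: "i \<in> XL"
    then have iX: "i \<in> X" by (simp add: XL_def)
    note s = XLs[OF i]
    obtain x where x: "x \<in> straight \<sigma>" "lalive \<sigma> (larr \<sigma> x) x"
      "\<And>j. j < D \<Longrightarrow> origin \<sigma> i j \<le> direct \<sigma> x j \<and>
       (if j = axis \<sigma> i then direct \<sigma> x j \<le> direct \<sigma> i j + d * (3 * m) else direct \<sigma> x j \<le> origin \<sigma> i j + d * (3 * m))"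
      using L.charge[OF s] by blast
    have "direct \<sigma> i (axis \<sigma> i) = z i (e i) (axis \<sigma> i)" using ze[OF iX] straight(3)[OF s] by (simp add: direct_def)
    then have "\<forall>j<D. z i (release \<sigma> i) j \<le> direct \<sigma> x j \<and> (if j = axis \<sigma> i then direct \<sigma> x j \<le> z i (e i) j + d * (3 * m)
        else direct \<sigma> x j \<le> z i (release \<sigma> i) j + d * (3 * m))"
      using x(3) zr[OF iX] by (metis (full_types))
    moreover have "x \<in> L" using x(1,2) by (simp add: L_def)
    ultimately show "\<exists>x\<in>L. direct \<sigma> x \<in> pts D \<and> axis \<sigma> i < d \<and> (\<forall>j<D. z i (release \<sigma> i) j \<le> direct \<sigma> x j \<and>
        (if j = axis \<sigma> i then direct \<sigma> x j \<le> z i (e i) j + d * (3 * m)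
        else direct \<sigma> x j \<le> z i (release \<sigma> i) j + d * (3 * m)))"
      using direct(1) straight(3)[OF s] by blast
    show "?T i \<subseteq> {axis \<sigma> i} \<or> axis \<sigma> i \<notin> ?T i"
    proof -
      have "card (?T i) \<le> 1" using i by (simp add: XL_def)
      then have "j = k" if "j \<in> ?T i" "k \<in> ?T i" for j k
        using that card_le_Suc0_iff_eq[of "?T i"] by auto
      then show ?thesis by blast
    qed
  qed
  have boundT: "card XT \<le> 5 ^ D * (m ^ D * (2 * (B + d * c)) + 1) * ((2 + (3 ^ D + 2 ^ D)) * card (through \<sigma>))"
  proof -
    have "\<exists>F. finite F \<and> real (card XT) \<le> real (5 ^ D * (m ^ D * (2 * (B + d * c)) + 1)) * sum (A.weight (length \<sigma>)) F"
    proof (rule R.transit_bound[OF A.weight_nonneg _ W])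
      show "XT \<subseteq> X" by (auto simp: XT_def)
      fix i assume i: "i \<in> XT"
      then have iX: "i \<in> X" and T2: "2 \<le> card (?T i)" by (auto simp: XT_def)
      show "2 \<le> card (?T i)" by (rule T2)
      have "(\<Sum>j<d. z i (e i) j) = sum_list (dst (\<sigma> ! i))"
        unfolding z_def X(2)[OF iX] option.sel by (rule sum_point[OF V_D(1)[OF request(2)[OF X(1)[OF iX]]]])
      then show "(\<Sum>j<d. z i (e i) j) \<le> \<Lambda>" using V_sum[OF request(2)[OF X(1)[OF iX]]] by simp
      fix u t assume u: "u (release \<sigma> i) = z i (release \<sigma> i)" and tr: "trip D u (release \<sigma> i) t" and te: "t \<le> e i"
        and ud: "\<And>j. j < d \<Longrightarrow> u t j = z i (e i) j" and tp: "t - release \<sigma> i < p"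
        and th: "2 \<le> card (thick D m (u (release \<sigma> i)) (u t))"
      have u0: "u (release \<sigma> i) = origin \<sigma> i" using u zr[OF iX] by simp
      have up: "u (release \<sigma> i) \<in> pts D" unfolding u0 by (rule origin)
      obtain P where P: "is_plan D m p (u (release \<sigma> i)) (u t) P"
        "P \<union> (src_box D m (u (release \<sigma> i)) \<union> dst_box D m (u t)) \<subseteq> trail D m u (release \<sigma> i) t"
        by (rule plan_of_trip[OF tr up th tp])
      have "level D (u t) = t + \<Lambda>" using trip_level[OF tr] origin(2)[OF X(1)[OF iX]] by (simp add: u0)
      then have "enat (level D (u t) - \<Lambda>) \<le> enat (e i)" using te by simp
      then have dl: "enat (level D (u t) - \<Lambda>) \<le> deadline (\<sigma> ! i)" using X(3)[OF iX] by (rule order_trans)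
      have pl: "(origin \<sigma> i, u t, P) \<in> plans \<sigma> i"
        unfolding plans_def using X(1)[OF iX] trip_pts[OF tr up] ud ze[OF iX] dl P(1) trip_mono[OF tr, of d]
        by (simp add: u0)
      have "A.choice i = None" using X(1,4)[OF iX] unfolding through_def choice by blast
      then have "1 \<le> sum (A.weight (length \<sigma>)) (P \<union> area (origin \<sigma> i, u t, P))"
        using A.reject[OF _ pl, of "length \<sigma>"] X(1)[OF iX] by simp
      also have "\<dots> \<le> sum (A.weight (length \<sigma>)) (trail D m u (release \<sigma> i) t)"
        using P(2) A.weight_nonneg finite_trail by (intro sum_mono2) (auto simp: area_def u0)
      finally show "1 \<le> sum (A.weight (length \<sigma>)) (trail D m u (release \<sigma> i) t)" .
    qed
    then obtain F where F: "finite F"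
      "real (card XT) \<le> real (5 ^ D * (m ^ D * (2 * (B + d * c)) + 1)) * sum (A.weight (length \<sigma>)) F" by blast
    have "A.accepted (length \<sigma>) = through \<sigma>" by (auto simp: A.accepted_def through_def choice)
    then have "sum (A.weight (length \<sigma>)) F \<le> (2 + (3 ^ D + 2 ^ D)) * card (through \<sigma>)"
      using A.total[OF F(1), of "length \<sigma>"] by (simp only: of_nat_add of_nat_power of_nat_numeral of_nat_mult)
    then have "real (card XT) \<le> real (5 ^ D * (m ^ D * (2 * (B + d * c)) + 1)) * real ((2 + (3 ^ D + 2 ^ D)) * card (through \<sigma>))"
      using F(2) by (meson mult_left_mono of_nat_0_le_iff order_trans)
    then show ?thesis by (simp only: of_nat_mult[symmetric] of_nat_le_iff)
  qed
  have LD: "card L \<le> card ?Del"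
    using straight_delivered straight(1) by (intro card_mono) (auto simp: L_def)
  have TD: "card (through \<sigma>) \<le> card ?Del"
    using through_delivered through(2) by (intro card_mono) auto
  have "{i. i < length \<sigma> \<and> delivered \<sigma> S i} \<subseteq> ?Del \<union> (XL \<union> XT)"
    by (auto simp: X_def XL_def XT_def)
  then have "throughput \<sigma> S \<le> card (?Del \<union> (XL \<union> XT))"
    unfolding throughput_def by (intro card_mono) (auto simp: X_def XL_def XT_def)
  also have "\<dots> \<le> card ?Del + (card XL + card XT)"
    using card_Un_le[of ?Del "XL \<union> XT"] card_Un_le[of XL XT] by linarith
  also have "card XL \<le> card ?Del * ((2 * (d * (3 * m) + 3 * m) + 1) ^ D * (2 * (B + d * c)))"
    using boundL mult_le_mono1[OF LD] by (rule le_trans)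
  also have "card XT \<le> 5 ^ D * (m ^ D * (2 * (B + d * c)) + 1) * ((2 + (3 ^ D + 2 ^ D)) * card ?Del)"
    using boundT mult_le_mono2[OF mult_le_mono2[OF TD]] by (rule le_trans)
  finally have "throughput \<sigma> S \<le> card ?Del + (card ?Del * ((2 * (d * (3 * m) + 3 * m) + 1) ^ D * (2 * (B + d * c))) +
      5 ^ D * (m ^ D * (2 * (B + d * c)) + 1) * ((2 + (3 ^ D + 2 ^ D)) * card ?Del))" by simp
  moreover have "n + (n * x + y * (w * n)) = (1 + x + y * w) * n" for n x y w :: nat
    by (simp add: algebra_simps)
  ultimately show ?thesis unfolding throughput_def by (simp only:)
qed

lemma alg_competitive:
  assumes "(D * m + \<Lambda>) * (prod_list l * (B + d * c)) \<le> W" "\<Lambda> + 3 * m \<le> W" "2 * W + \<Lambda> < p"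
    and "3 \<le> B" "3 \<le> c"
  shows "opt_throughput E c B \<sigma> \<le> (1 + (2 * (d * (3 * m) + 3 * m) + 1) ^ D * (2 * (B + d * c)) +
    5 ^ D * (m ^ D * (2 * (B + d * c)) + 1) * (2 + (3 ^ D + 2 ^ D))) * throughput \<sigma> (alg \<sigma>)"
proof -
  let ?M = "{throughput \<sigma> S |S. feasible_schedule E c B \<sigma> S}"
  have "throughput \<sigma> S \<le> length \<sigma>" for S
  proof -
    have "card {i. i < length \<sigma> \<and> delivered \<sigma> S i} \<le> card {..<length \<sigma>}" by (intro card_mono) auto
    then show ?thesis by (simp add: throughput_def)
  qed
  then have "finite ?M" by (intro finite_subset[of ?M "{..length \<sigma>}"]) auto
  moreover have "?M \<noteq> {}" using alg_feasible[OF assms(4,5)] by blast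
  ultimately have "opt_throughput E c B \<sigma> \<in> ?M" unfolding opt_throughput_def by (rule Max_in)
  then show ?thesis using alg_throughput_le[OF assms(1-3)] by auto
qed

end

section \<open>Choice of the parameters\<close>

lemma sum_list_le_prod_list:
  "(\<And>x. x \<in> set xs \<Longrightarrow> 1 \<le> x) \<Longrightarrow> sum_list xs \<le> length xs * prod_list xs \<and> 1 \<le> (prod_list xs :: nat)"
proof (induction xs)
  case (Cons x xs)
  then have IH: "sum_list xs \<le> length xs * prod_list xs" "1 \<le> prod_list xs" and x: "1 \<le> x" by auto
  have "length xs * prod_list xs \<le> length xs * (x * prod_list xs)"
    using x by (intro mult_le_mono2) simp
  moreover have "x * 1 \<le> x * prod_list xs" using IH by (intro mult_le_mono2)
  ultimately have "x + sum_list xs \<le> x * prod_list xs + length xs * (x * prod_list xs)"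
    using IH by linarith
  then show ?case using IH x by simp
qed simp

text \<open>Ensures that \<open>pmax\<close> is at least \<open>n\<close>, and hence that
  \<open>k\<close> is at least \<open>log 2 n\<close>.\<close>

lemma diameter_pos:
  assumes "1 < prod_list l" and pos: "\<forall>j<length l. 1 \<le> l ! j"
  shows "1 \<le> diameter (grid_vertices l) (grid_edges l)"
proof -
  interpret grid l .
  have "\<exists>j<d. 2 \<le> l ! j"
  proof (rule ccontr)
    assume "\<not> ?thesis"
    then have "l ! j = 1" if "j < d" for j using pos that by (metis One_nat_def Suc_1 le_antisym not_less_eq_eq)
    then have "prod_list l = 1" by (simp add: prod.list_conv_set_nth)
    then show False using assms(1) by simp
  qed
  then obtain j where j: "j < d" "2 \<le> l ! j" by blast
  define x where "x = replicate d (0::nat)"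
  define y where "y = x[j := Suc (x ! j)]"
  have xV: "x \<in> V" using pos by (auto simp: x_def grid_vertices_def Suc_le_eq)
  have xy: "(x, y) \<in> E" unfolding grid_edges_def y_def using xV j
    by (intro CollectI exI[of _ x] exI[of _ j]) (simp add: x_def)
  then have yV: "y \<in> V" using edge_D by blast
  have "x \<noteq> y" using j unfolding y_def by (metis length_replicate n_not_Suc_n nth_list_update_eq x_def)
  let ?M = "{(LEAST k. (x, y) \<in> E ^^ k) |x y. x \<in> V \<and> y \<in> V \<and> (x, y) \<in> E\<^sup>*}"
  have "?M \<subseteq> (\<lambda>(x, y). LEAST k. (x, y) \<in> E ^^ k) ` (V \<times> V)" by auto
  then have fin: "finite ?M" by (rule finite_subset) (simp add: finite_V)
  have "(LEAST k. (x, y) \<in> E ^^ k) \<in> ?M" using xV yV xy by blast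
  then have "(LEAST k. (x, y) \<in> E ^^ k) \<le> diameter V E" unfolding diameter_def by (rule Max_ge[OF fin])
  moreover have "(LEAST k. (x, y) \<in> E ^^ k) \<noteq> 0"
  proof
    have "(x, y) \<in> E ^^ 1" using xy by simp
    then have "(x, y) \<in> E ^^ (LEAST k. (x, y) \<in> E ^^ k)" by (rule LeastI)
    moreover assume "(LEAST k. (x, y) \<in> E ^^ k) = 0"
    ultimately have "(x, y) \<in> E ^^ 0" by (simp only:)
    then show False using \<open>x \<noteq> y\<close> by simp
  qed
  ultimately show ?thesis by linarith
qed

text \<open>With \<open>N = 2 ^ q\<close>, the chain bound is at most a constant times
  \<open>D ^ 3 * N ^ 3\<close>, because \<open>D * m + \<Lambda>\<close> is of order
  \<open>D ^ 2 * N\<close> and \<open>n * K\<close> at most \<open>D * N ^ 2\<close>. The side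
  \<open>16 * D * q\<close> exceeds the logarithm of this, although it enters the bound
  itself.\<close>

lemma tile_side_large:
  fixes D q n \<Lambda> K :: nat
  assumes D: "2 \<le> D" and q: "3 \<le> q" and n: "n \<le> 2 ^ q" and \<Lambda>: "\<Lambda> \<le> D * n" and K: "K \<le> D * q"
    and m_def: "m = 16 * D * q" and W_def: "W = (D * m + \<Lambda>) * (n * K)"
  shows "2 * (2 * W + \<Lambda> + 1) < 2 ^ (m - 1)"
proof -
  define N :: nat where "N = 2 ^ q"
  have qN: "q \<le> N" and N1: "1 \<le> N" by (simp_all add: N_def less_imp_le)
  have D2: "D \<le> D * D * D" using D by (metis le_square le_trans mult_le_mono1)
  have "D * m = 16 * (D * D * q)" by (simp add: m_def)
  then have "D * m \<le> 16 * (D * D * N)" using mult_le_mono2[OF qN, of "D * D"] by linarith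
  moreover have "\<Lambda> \<le> D * D * N"
  proof -
    have "\<Lambda> \<le> D * N" using \<Lambda> n by (metis N_def le_trans mult_le_mono2)
    also have "\<dots> \<le> D * D * N" by (intro mult_le_mono1 le_square)
    finally show ?thesis .
  qed
  ultimately have A: "D * m + \<Lambda> \<le> 17 * (D * D * N)" by linarith
  have nK: "n * K \<le> N * (D * N)"
  proof (rule mult_le_mono)
    show "n \<le> N" using n by (simp add: N_def)
    show "K \<le> D * N" using K mult_le_mono2[OF qN] by (rule le_trans)
  qed
  have "W \<le> 17 * (D * D * N) * (N * (D * N))" unfolding W_def by (rule mult_le_mono[OF A nK])
  then have W: "W \<le> 17 * (D * D * D * (N * N * N))" by (simp add: mult_ac)
  have "\<Lambda> \<le> D * N" using \<Lambda> n by (metis N_def le_trans mult_le_mono2)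
  also have "\<dots> \<le> (D * D * D) * (N * N * N)"
    using N1 by (intro mult_le_mono D2) (metis le_square le_trans mult_le_mono1)
  finally have L: "\<Lambda> \<le> D * D * D * (N * N * N)" .
  have one: "1 \<le> D * D * D * (N * N * N)" using D N1 by (simp add: Suc_le_eq)
  \<comment> \<open>72 is \<open>2 * (2 * 17 + 1 + 1)\<close>, and it is below
    \<open>2 ^ 7\<close>.\<close>
  have "2 * (2 * W + \<Lambda> + 1) \<le> 72 * (D * D * D * (N * N * N))"
  proof -
    have "2 * (2 * w + k + 1) \<le> 72 * x" if "w \<le> 17 * x" "k \<le> x" "1 \<le> x" for w k x :: nat
      using that by simp
    then show ?thesis using W L one by blast
  qed
  also have "\<dots> \<le> 2 ^ 7 * (2 ^ D * 2 ^ D * 2 ^ D * (N * N * N))"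
    by (intro mult_le_mono) (auto simp: less_imp_le)
  also have "\<dots> = 2 ^ (7 + (D + D + D) + (q + q + q))"
    by (simp only: N_def power_add mult_ac)
  also have "\<dots> < 2 ^ (m - 1)"
  proof (rule power_strict_increasing)
    have "3 * D \<le> D * q" using q by simp
    moreover have "2 * q \<le> D * q" using D by simp
    moreover have "2 * 3 \<le> D * q" using D q by (rule mult_le_mono)
    ultimately show "7 + (D + D + D) + (q + q + q) < m - 1" unfolding m_def by linarith
  qed simp
  finally show ?thesis .
qed

text \<open>Each summand is at most a constant multiple of \<open>m ^ Suc d * K\<close>; replacing
  \<open>m\<close> by \<open>q\<close> costs another constant.\<close>

lemma ratio_le:
  fixes d q K m :: nat
  assumes "m = 16 * Suc d * q" "1 \<le> q" "1 \<le> K"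
  shows "1 + (2 * (d * (3 * m) + 3 * m) + 1) ^ Suc d * (2 * K) +
      5 ^ Suc d * (m ^ Suc d * (2 * K) + 1) * (2 + (3 ^ Suc d + 2 ^ Suc d))
    \<le> (1 + 2 * (7 * Suc d) ^ Suc d + 3 * 5 ^ Suc d * (2 + (3 ^ Suc d + 2 ^ Suc d))) * (16 * Suc d) ^ Suc d *
      (q ^ Suc d * K)"
proof -
  let ?D = "Suc d"
  have m1: "1 \<le> m" using assms by simp
  have mK: "1 \<le> m ^ ?D * K" using m1 assms(3) by (simp add: Suc_le_eq del: power_Suc)
  have "7 * ?D * m = 7 * (d * m) + 7 * m" "2 * (d * (3 * m) + 3 * m) + 1 = 6 * (d * m) + 6 * m + 1"
    by (simp_all add: algebra_simps)
  then have "2 * (d * (3 * m) + 3 * m) + 1 \<le> 7 * ?D * m" using m1 by linarith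
  then have "(2 * (d * (3 * m) + 3 * m) + 1) ^ ?D \<le> (7 * ?D * m) ^ ?D" by (rule power_mono) simp
  then have "(2 * (d * (3 * m) + 3 * m) + 1) ^ ?D * (2 * K) \<le> (7 * ?D * m) ^ ?D * (2 * K)"
    by (rule mult_le_mono1)
  also have "\<dots> = 2 * (7 * ?D) ^ ?D * (m ^ ?D * K)" by (simp only: power_mult_distrib mult_ac)
  finally have 1: "(2 * (d * (3 * m) + 3 * m) + 1) ^ ?D * (2 * K) \<le> 2 * (7 * ?D) ^ ?D * (m ^ ?D * K)" .
  have "m ^ ?D * (2 * K) + 1 \<le> 3 * (m ^ ?D * K)" using mK by linarith
  then have "5 ^ ?D * (m ^ ?D * (2 * K) + 1) * (2 + (3 ^ ?D + 2 ^ ?D)) \<le> 5 ^ ?D * (3 * (m ^ ?D * K)) * (2 + (3 ^ ?D + 2 ^ ?D))"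
    by (intro mult_le_mono1 mult_le_mono2)
  then have 2: "5 ^ ?D * (m ^ ?D * (2 * K) + 1) * (2 + (3 ^ ?D + 2 ^ ?D)) \<le> 3 * 5 ^ ?D * (2 + (3 ^ ?D + 2 ^ ?D)) * (m ^ ?D * K)"
    by (simp only: mult.assoc mult.commute mult.left_commute)
  have "1 + (2 * (d * (3 * m) + 3 * m) + 1) ^ ?D * (2 * K) +
      5 ^ ?D * (m ^ ?D * (2 * K) + 1) * (2 + (3 ^ ?D + 2 ^ ?D))
    \<le> (m ^ ?D * K) + 2 * (7 * ?D) ^ ?D * (m ^ ?D * K) + 3 * 5 ^ ?D * (2 + (3 ^ ?D + 2 ^ ?D)) * (m ^ ?D * K)"
    by (intro add_mono 1 2 mK)
  also have "\<dots> = (1 + 2 * (7 * ?D) ^ ?D + 3 * 5 ^ ?D * (2 + (3 ^ ?D + 2 ^ ?D))) * (m ^ ?D * K)"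
    by (simp only: distrib_right mult_1)
  also have "m ^ ?D * K = (16 * ?D) ^ ?D * (q ^ ?D * K)"
    unfolding assms(1) power_mult_distrib[of "16 * ?D"] by (rule mult.assoc)
  finally show ?thesis by (simp only: mult.assoc)
qed

theorem theorem6p1:
  fixes d :: nat
  assumes "d \<ge> 1"
  shows "\<exists>C>0. \<forall>(l :: nat list) (B :: nat) (c :: nat).
     length l = d \<longrightarrow> (\<forall>j<d. 1 \<le> l!j) \<longrightarrow>
     3 \<le> B \<longrightarrow> real B \<le> log 2 (real (prod_list l)) \<longrightarrow>
     3 \<le> c \<longrightarrow> real c \<le> log 2 (real (prod_list l)) \<longrightarrow>
     (let n = prod_list l;
          pmax = 2 * real (diameter (grid_vertices l) (grid_edges l)) *
                   (1 + real n * (real B / real c + real d));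
          k = \<lceil>log 2 (1 + 3 * pmax)\<rceil>
      in \<exists>A \<rho>. online A \<and> competitive (grid_edges l) c B (grid_request l) A \<rho> \<and>
           \<rho> \<le> C * real_of_int k ^ (d + 3) * (real B + real d * real c) \<and>
           \<rho> \<le> C * (log 2 (real n)) ^ (d + 4))"
proof -
  \<comment> \<open>The constant of \<open>ratio_le\<close>; the power of 2 in \<open>C1\<close>
    pays for rounding \<open>log 2 n\<close> up to \<open>q\<close>, which at most doubles
    it.\<close>
  define C0 :: nat where "C0 = (1 + 2 * (7 * Suc d) ^ Suc d + 3 * 5 ^ Suc d * (2 + (3 ^ Suc d + 2 ^ Suc d))) * (16 * Suc d) ^ Suc d"
  define C1 :: real where "C1 = real C0 * 2 ^ Suc d"
  have C0: "0 < C0" by (simp add: C0_def)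
  then have C1: "0 < C1" by (simp add: C1_def)
  have "\<exists>A \<rho>. online A \<and> competitive (grid_edges l) c B (grid_request l) A \<rho> \<and>
      \<rho> \<le> (C1 * Suc d) * real_of_int k ^ (d + 3) * (real B + real d * real c) \<and>
      \<rho> \<le> (C1 * Suc d) * (log 2 (real n)) ^ (d + 4)"
    if len: "length l = d" and pos: "\<forall>j<d. 1 \<le> l ! j" and B: "3 \<le> B" "real B \<le> log 2 (real n)"
      and c: "3 \<le> c" "real c \<le> log 2 (real n)" and n: "n = prod_list l"
      and pmax: "pmax = 2 * real (diameter (grid_vertices l) (grid_edges l)) * (1 + real n * (real B / real c + real d))"
      and k: "k = \<lceil>log 2 (1 + 3 * pmax)\<rceil>"
    for l :: "nat list" and B c n :: nat and pmax :: real and k :: int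
  proof -
    define x where "x = log 2 (real n)"
    have x3: "3 \<le> x" using B by (simp add: x_def)
    have posl: "1 \<le> y" if "y \<in> set l" for y using pos len that by (metis in_set_conv_nth)
    have sl: "sum_list l \<le> d * n" "1 \<le> n" using sum_list_le_prod_list[of l] posl len n by auto
    have n2: "2 powr x = n" using sl(2) by (simp add: x_def)
    have n1: "1 < n"
    proof (rule ccontr)
      assume "\<not> 1 < n"
      then have "n = 1" using sl(2) by simp
      then show False using x3 by (simp add: x_def)
    qed
    define q where "q = nat \<lceil>x\<rceil>"
    have q: "x \<le> q" "q \<le> 2 * x" using x3 by (auto simp: q_def) linarith+
    have q3: "3 \<le> q" using q(1) x3 by linarith
    have "real n \<le> 2 powr q" using q(1) n2 by (metis one_le_numeral powr_mono)
    then have "real n \<le> real (2 ^ q)" by (simp add: powr_realpow)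
    then have nq: "n \<le> 2 ^ q" by (simp only: of_nat_le_iff)
    define K where "K = B + d * c"
    have Bq: "B \<le> q" "c \<le> q" using B(2) c(2) q(1) unfolding x_def[symmetric] by linarith+
    then have Kq: "K \<le> Suc d * q" unfolding K_def by (simp add: add_mono)
    have Kx: "real K \<le> Suc d * x"
    proof -
      have "real d * real c \<le> d * x" using c(2) by (intro mult_left_mono) (auto simp: x_def)
      then show ?thesis using B(2) by (simp add: K_def x_def distrib_right)
    qed
    define m where "m = 16 * Suc d * q"
    define W where "W = (Suc d * m + sum_list l) * (n * K)"
    \<comment> \<open>The least value with \<open>2 * W + \<Lambda> < p\<close>, as required for
      shortcuts to be admissible chains.\<close>
    define p where "p = 2 * W + sum_list l + 1"
    have K1: "1 \<le> K" using B(1) by (simp add: K_def)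
    have mp: "2 * p < 2 ^ (m - 1)"
      unfolding p_def using assms sl(1) by (intro tile_side_large[OF _ q3 nq _ Kq m_def W_def]) auto
    have W2: "sum_list l + 3 * m \<le> W"
    proof -
      have "2 \<le> n * K" using n1 K1 by (metis One_nat_def Suc_1 Suc_leI mult_le_mono nat_mult_1_right)
      then have big: "(Suc d * m + sum_list l) * 2 \<le> W" unfolding W_def by (rule mult_le_mono2)
      have "(2 * m + sum_list l) * 2 \<le> (Suc d * m + sum_list l) * 2"
        using assms by (intro mult_le_mono1 add_le_mono1) simp
      then have "(2 * m + sum_list l) * 2 \<le> W" using big by (rule le_trans)
      then show ?thesis by simp
    qed
    define \<rho> where "\<rho> = 1 + (2 * (d * (3 * m) + 3 * m) + 1) ^ Suc d * (2 * K) +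
      5 ^ Suc d * (m ^ Suc d * (2 * K) + 1) * (2 + (3 ^ Suc d + 2 ^ Suc d))"
    let ?A = "router.alg l m p"
    have "competitive (grid_edges l) c B (grid_request l) ?A (real \<rho>)"
      unfolding competitive_def
    proof (intro allI impI)
      fix \<sigma> assume \<sigma>: "input_seq (grid_request l) \<sigma>"
      interpret router_run l m p \<sigma>
        using assms len mp \<sigma> by unfold_locales (auto simp: input_seq_def p_def)
      have "opt_throughput (grid_edges l) c B \<sigma> \<le> \<rho> * throughput \<sigma> (?A \<sigma>)"
        using alg_competitive[of B c W] W2 B(1) c(1) unfolding \<rho>_def K_def W_def p_def len n by simp
      then have "real (opt_throughput (grid_edges l) c B \<sigma>) \<le> real \<rho> * real (throughput \<sigma> (?A \<sigma>))"
        by (metis of_nat_le_iff of_nat_mult)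
      then show "feasible_schedule (grid_edges l) c B \<sigma> (?A \<sigma>) \<and>
          real (opt_throughput (grid_edges l) c B \<sigma>) \<le> real \<rho> * real (throughput \<sigma> (?A \<sigma>))"
        using alg_feasible[OF B(1) c(1)] by simp
    qed
    moreover have "online ?A" by (rule router.alg_online)
    moreover have \<rho>: "real \<rho> \<le> C1 * x ^ Suc d * K"
    proof -
      have "\<rho> \<le> C0 * (q ^ Suc d * K)"
        unfolding \<rho>_def C0_def using q3 K1 by (intro ratio_le[OF m_def]) auto
      then have "real \<rho> \<le> real (C0 * (q ^ Suc d * K))" by (simp only: of_nat_le_iff)
      also have "\<dots> = C0 * (real q ^ Suc d * K)" by simp
      also have "\<dots> \<le> C0 * ((2 * x) ^ Suc d * K)"
        using q(2) by (intro mult_left_mono mult_right_mono power_mono) auto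
      also have "\<dots> = C1 * x ^ Suc d * K" by (simp only: C1_def power_mult_distrib mult_ac)
      finally show ?thesis .
    qed
    have xk: "x \<le> k"
    proof -
      have "1 \<le> diameter (grid_vertices l) (grid_edges l)"
        using diameter_pos[of l] n1 pos len n by simp
      then have dm: "1 \<le> real (diameter (grid_vertices l) (grid_edges l))" by simp
      have "real n * 1 \<le> real n * (real B / real c + real d)"
        using assms by (intro mult_left_mono) (auto intro: add_increasing)
      then have "real n \<le> 1 + real n * (real B / real c + real d)" by simp
      then have "1 * real n \<le> (2 * real (diameter (grid_vertices l) (grid_edges l))) * (1 + real n * (real B / real c + real d))"
        using dm by (intro mult_mono) auto
      then have "real n \<le> 1 + 3 * pmax" unfolding pmax by linarith
      then have "x \<le> log 2 (1 + 3 * pmax)" unfolding x_def using n1 by (intro log_mono) auto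
      also have "\<dots> \<le> k" unfolding k by (rule le_of_int_ceiling)
      finally show ?thesis .
    qed
    \<comment> \<open>The ratio obtained is of order \<open>x ^ (d + 1) * K\<close>; both required
      bounds follow by enlarging it, here with \<open>x\<close> at most \<open>k\<close> and below
      with \<open>K\<close> at most \<open>Suc d * x\<close>.\<close>
    have b1: "real \<rho> \<le> (C1 * Suc d) * real_of_int k ^ (d + 3) * (real B + real d * real c)"
    proof -
      have "x ^ Suc d \<le> real_of_int k ^ Suc d" using xk x3 by (intro power_mono) auto
      also have "\<dots> \<le> real_of_int k ^ (d + 3)" using xk x3 by (intro power_increasing) auto
      finally have pw: "x ^ Suc d \<le> real_of_int k ^ (d + 3)" .
      have "C1 * x ^ Suc d * K \<le> (C1 * Suc d) * real_of_int k ^ (d + 3) * K"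
        using C1 pw x3 by (intro mult_right_mono mult_mono) auto
      then show ?thesis using \<rho> by (simp add: K_def)
    qed
    have b2: "real \<rho> \<le> (C1 * Suc d) * (log 2 (real n)) ^ (d + 4)"
    proof -
      have "C1 * x ^ Suc d * K \<le> C1 * x ^ Suc d * (Suc d * x)"
        using C1 x3 by (intro mult_left_mono Kx) auto
      also have "\<dots> = (C1 * Suc d) * x ^ (d + 2)" by (simp add: mult_ac)
      also have "\<dots> \<le> (C1 * Suc d) * x ^ (d + 4)"
        using C1 x3 by (intro mult_left_mono power_increasing) auto
      finally show ?thesis using \<rho> by (simp add: x_def)
    qed
    ultimately show ?thesis using b1 b2 by blast
  qed
  then show ?thesis using C1 unfolding Let_def by (intro exI[of _ "C1 * Suc d"]) auto
qed

end
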